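(* Fix $n\ge1$ and a number $C(n)>\max\{3,\,n-3,\,J_1(n),\,J_2(n),\,J_3(n)\}$ (constants described in the context). Let $q$ be a power of a prime $p>C(n)$, and let $G$ be a semisimple subgroup of $GL_n(\mathbb{F}_q)$ satisfying $C(\eta,N)$ for some $0<\eta<1/C(n)$. Then either $|G|$ or $q$ is bounded by a constant depending only on $n,\eta,N$; consequently $|G|\le B$ for a constant $B=B(\eta,N,n)$ depending only on $\eta,N,n$.
   Context: $G\subset GL_n(\mathbb{F}_q)$ is semisimple if $\mathbb{F}_q^{\oplus n}$ is a semisimple $G$-module. Property $C(\eta,N)$ ($N>0$, $0<\eta<1$): there is a subset $H\subset G$ with $(1-\eta)|G|\le|H|$ and $|\{\det(1-hT):h\in H\}|\le N$. $J_1(n)$ is a constant depending only on $n$ such that every finite subgroup $G$ of $GL_n(\mathbb{F}_q)$ ($q$ a power of $p$) has normal subgroups $G\supset G_1\supset G_2\supset G_3$ with $[G:G_1]\le J_1(n)$, $G_1/G_2$ a direct product of finite simple groups of Lie type in characteristic $p$ (with number of factors bounded in terms of $n$), $G_2/G_3$ abelian of order prime to $p$, and $G_3$ a $p$-group. $J_2(n)$ is a constant depending only on $n$ such that every solvable subgroup of $GL_n(\mathbb{F}_q)$ has a normal subgroup of index $\le J_2(n)$ conjugate into the upper triangular matrices. $J_3(n)$ is a constant depending only on $n$ such that every finite subgroup of $GL_n(k)$, $k$ algebraically closed of characteristic zero, has an abelian normal subgroup of index $\le J_3(n)$. *)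

theory Defs
  imports Complex_Main "HOL-Algebra.Algebra" "HOL-Combinatorics.Permutations"
begin

text \<open>
  The bounds in the theorem are uniform in the finite field, so fields have to be quantified inside
  formulas; they are therefore rings in the sense of HOL-Algebra, with explicit carrier. Every
  finite field, finite group and algebraic closure of a finite field is countable, hence isomorphic
  to a structure whose carrier consists of natural numbers; such fields have type \<^typ>\<open>nat ring\<close>.
\<close>

section \<open>Matrices and vectors over a ring\<close>

definition mat_monoid :: "nat \<Rightarrow> ('a, 'b) ring_scheme \<Rightarrow> (nat \<times> nat \<Rightarrow> 'a) monoid" where
  "mat_monoid n R =
    \<lparr> carrier = ({..<n} \<times> {..<n}) \<rightarrow>\<^sub>E carrier R,
      monoid.mult = (\<lambda>A B. \<lambda>(i, j)\<in>{..<n} \<times> {..<n}. \<Oplus>\<^bsub>R\<^esub>k\<in>{..<n}. A (i, k) \<otimes>\<^bsub>R\<^esub> B (k, j)),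
      monoid.one = (\<lambda>(i, j)\<in>{..<n} \<times> {..<n}. if i = j then \<one>\<^bsub>R\<^esub> else \<zero>\<^bsub>R\<^esub>) \<rparr>"

definition GL :: "nat \<Rightarrow> ('a, 'b) ring_scheme \<Rightarrow> (nat \<times> nat \<Rightarrow> 'a) monoid" where
  "GL n R = units_of (mat_monoid n R)"

definition mat_det :: "nat \<Rightarrow> ('a, 'b) ring_scheme \<Rightarrow> (nat \<times> nat \<Rightarrow> 'a) \<Rightarrow> 'a" where
  "mat_det n R A =
    (\<Oplus>\<^bsub>R\<^esub>\<sigma>\<in>{\<sigma>. \<sigma> permutes {..<n}}.
       (if evenperm \<sigma> then \<one>\<^bsub>R\<^esub> else \<ominus>\<^bsub>R\<^esub> \<one>\<^bsub>R\<^esub>) \<otimes>\<^bsub>R\<^esub> (\<Otimes>\<^bsub>R\<^esub>i\<in>{..<n}. A (i, \<sigma> i)))"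

text \<open>\<open>char_det n R h\<close> is the polynomial \<open>det(1 - h T)\<close>, with coefficients in \<open>R\<close>.\<close>

definition char_det :: "nat \<Rightarrow> ('a, 'b) ring_scheme \<Rightarrow> (nat \<times> nat \<Rightarrow> 'a) \<Rightarrow> nat \<Rightarrow> 'a" where
  "char_det n R h =
    mat_det n (UP R)
      (\<lambda>(i, j). (if i = j then \<one>\<^bsub>UP R\<^esub> else \<zero>\<^bsub>UP R\<^esub>) \<ominus>\<^bsub>UP R\<^esub> UnivPoly.monom (UP R) (h (i, j)) 1)"

definition vec_space :: "nat \<Rightarrow> ('a, 'b) ring_scheme \<Rightarrow> ('a, nat \<Rightarrow> 'a) module" where
  "vec_space n R =
    \<lparr> carrier = {..<n} \<rightarrow>\<^sub>E carrier R,
      monoid.mult = undefined,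
      monoid.one = undefined,
      ring.zero = (\<lambda>i\<in>{..<n}. \<zero>\<^bsub>R\<^esub>),
      ring.add = (\<lambda>v w. \<lambda>i\<in>{..<n}. v i \<oplus>\<^bsub>R\<^esub> w i),
      module.smult = (\<lambda>c v. \<lambda>i\<in>{..<n}. c \<otimes>\<^bsub>R\<^esub> v i) \<rparr>"

definition mat_vec ::
    "nat \<Rightarrow> ('a, 'b) ring_scheme \<Rightarrow> (nat \<times> nat \<Rightarrow> 'a) \<Rightarrow> (nat \<Rightarrow> 'a) \<Rightarrow> nat \<Rightarrow> 'a" where
  "mat_vec n R A v = (\<lambda>i\<in>{..<n}. \<Oplus>\<^bsub>R\<^esub>j\<in>{..<n}. A (i, j) \<otimes>\<^bsub>R\<^esub> v j)"


section \<open>Semisimple linear groups and property \<open>C(\<eta>, N)\<close>\<close>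

definition G_submodule ::
    "nat \<Rightarrow> ('a, 'b) ring_scheme \<Rightarrow> (nat \<times> nat \<Rightarrow> 'a) set \<Rightarrow> (nat \<Rightarrow> 'a) set \<Rightarrow> bool" where
  "G_submodule n K G W \<longleftrightarrow>
    submodule W K (vec_space n K) \<and> (\<forall>g\<in>G. \<forall>w\<in>W. mat_vec n K g w \<in> W)"

definition simple_G_submodule ::
    "nat \<Rightarrow> ('a, 'b) ring_scheme \<Rightarrow> (nat \<times> nat \<Rightarrow> 'a) set \<Rightarrow> (nat \<Rightarrow> 'a) set \<Rightarrow> bool" where
  "simple_G_submodule n K G W \<longleftrightarrow>
    G_submodule n K G W \<and> W \<noteq> {\<zero>\<^bsub>vec_space n K\<^esub>} \<and>
    (\<forall>U. G_submodule n K G U \<and> U \<subseteq> W \<longrightarrow> U = {\<zero>\<^bsub>vec_space n K\<^esub>} \<or> U = W)"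

definition semisimple_linear_group ::
    "nat \<Rightarrow> ('a, 'b) ring_scheme \<Rightarrow> (nat \<times> nat \<Rightarrow> 'a) set \<Rightarrow> bool" where
  "semisimple_linear_group n K G \<longleftrightarrow>
    (\<exists>(r::nat) W. (\<forall>i<r. simple_G_submodule n K G (W i)) \<and>
      (\<forall>v\<in>carrier (vec_space n K).
         \<exists>!w. w \<in> (\<Pi>\<^sub>E i\<in>{..<r}. W i) \<and> v = (\<Oplus>\<^bsub>vec_space n K\<^esub>i\<in>{..<r}. w i)))"

definition property_C ::
    "nat \<Rightarrow> ('a, 'b) ring_scheme \<Rightarrow> (nat \<times> nat \<Rightarrow> 'a) set \<Rightarrow> real \<Rightarrow> real \<Rightarrow> bool" where
  "property_C n K G \<eta> N \<longleftrightarrow>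
    (\<exists>H\<subseteq>G. (1 - \<eta>) * real (card G) \<le> real (card H) \<and>
            real (card (char_det n K ` H)) \<le> N)"


section \<open>Linear algebraic groups\<close>

text \<open>Polynomial functions in the entries of an \<open>m \<times> m\<close> matrix.\<close>

inductive_set poly_funs ::
    "nat \<Rightarrow> ('a, 'b) ring_scheme \<Rightarrow> ((nat \<times> nat \<Rightarrow> 'a) \<Rightarrow> 'a) set"
  for m :: nat and L :: "('a, 'b) ring_scheme" where
  const: "c \<in> carrier L \<Longrightarrow> (\<lambda>_. c) \<in> poly_funs m L"
| coord: "i < m \<Longrightarrow> j < m \<Longrightarrow> (\<lambda>A. A (i, j)) \<in> poly_funs m L"
| add: "f \<in> poly_funs m L \<Longrightarrow> g \<in> poly_funs m L \<Longrightarrow> (\<lambda>A. f A \<oplus>\<^bsub>L\<^esub> g A) \<in> poly_funs m L"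
| mult: "f \<in> poly_funs m L \<Longrightarrow> g \<in> poly_funs m L \<Longrightarrow> (\<lambda>A. f A \<otimes>\<^bsub>L\<^esub> g A) \<in> poly_funs m L"

definition zariski_closed ::
    "nat \<Rightarrow> ('a, 'b) ring_scheme \<Rightarrow> (nat \<times> nat \<Rightarrow> 'a) set \<Rightarrow> bool" where
  "zariski_closed m L Z \<longleftrightarrow>
    (\<exists>S\<subseteq>poly_funs m L. Z = {A \<in> carrier (GL m L). \<forall>f\<in>S. f A = \<zero>\<^bsub>L\<^esub>})"

definition algebraic_group ::
    "nat \<Rightarrow> ('a, 'b) ring_scheme \<Rightarrow> (nat \<times> nat \<Rightarrow> 'a) set \<Rightarrow> bool" where
  "algebraic_group m L G \<longleftrightarrow> subgroup G (GL m L) \<and> zariski_closed m L G"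

definition zariski_connected ::
    "nat \<Rightarrow> ('a, 'b) ring_scheme \<Rightarrow> (nat \<times> nat \<Rightarrow> 'a) set \<Rightarrow> bool" where
  "zariski_connected m L Z \<longleftrightarrow>
    \<not> (\<exists>Z1 Z2. zariski_closed m L Z1 \<and> zariski_closed m L Z2 \<and>
             Z1 \<noteq> {} \<and> Z2 \<noteq> {} \<and> Z1 \<inter> Z2 = {} \<and> Z1 \<union> Z2 = Z)"

text \<open>
  The last conjunct asks only that the group of points of the centre be trivial, whereas an adjoint
  group has trivial centre as a group scheme. The two differ by a purely inseparable (hence
  bijective) isogeny that is compatible with Steinberg endomorphisms, so the groups of fixed points
  that arise are the same.
\<close>

definition adjoint_simple_algebraic_group ::
    "nat \<Rightarrow> ('a, 'b) ring_scheme \<Rightarrow> (nat \<times> nat \<Rightarrow> 'a) set \<Rightarrow> bool" where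
  "adjoint_simple_algebraic_group m L G \<longleftrightarrow>
    algebraic_group m L G \<and> zariski_connected m L G \<and>
    \<not> comm_group ((GL m L)\<lparr>carrier := G\<rparr>) \<and>
    (\<forall>M. M \<lhd> ((GL m L)\<lparr>carrier := G\<rparr>) \<and> algebraic_group m L M \<and> zariski_connected m L M \<longrightarrow>
         M = {\<one>\<^bsub>GL m L\<^esub>} \<or> M = G) \<and>
    {z \<in> G. \<forall>g\<in>G. z \<otimes>\<^bsub>GL m L\<^esub> g = g \<otimes>\<^bsub>GL m L\<^esub> z} = {\<one>\<^bsub>GL m L\<^esub>}"

text \<open>The coordinate ring of \<open>GL\<^sub>m\<close> is generated by the entries and the inverse of the determinant.\<close>

definition regular_map ::
    "nat \<Rightarrow> ('a, 'b) ring_scheme \<Rightarrow> (nat \<times> nat \<Rightarrow> 'a) set \<Rightarrow>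
     ((nat \<times> nat \<Rightarrow> 'a) \<Rightarrow> (nat \<times> nat \<Rightarrow> 'a)) \<Rightarrow> bool" where
  "regular_map m L G F \<longleftrightarrow>
    (\<forall>i<m. \<forall>j<m. \<exists>f\<in>poly_funs m L. \<exists>d::nat. \<forall>A\<in>G.
       F A (i, j) = f A \<otimes>\<^bsub>L\<^esub> inv\<^bsub>L\<^esub> (mat_det m L A [^]\<^bsub>L\<^esub> d))"

text \<open>
  Steinberg endomorphism: a surjective endomorphism of algebraic groups with finitely many fixed
  points. This covers the standard Frobenius maps and those giving the twisted, Suzuki and Ree groups.
\<close>

definition steinberg_endomorphism ::
    "nat \<Rightarrow> ('a, 'b) ring_scheme \<Rightarrow> (nat \<times> nat \<Rightarrow> 'a) set \<Rightarrow>
     ((nat \<times> nat \<Rightarrow> 'a) \<Rightarrow> (nat \<times> nat \<Rightarrow> 'a)) \<Rightarrow> bool" where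
  "steinberg_endomorphism m L G F \<longleftrightarrow>
    F \<in> hom ((GL m L)\<lparr>carrier := G\<rparr>) ((GL m L)\<lparr>carrier := G\<rparr>) \<and>
    regular_map m L G F \<and> F ` G = G \<and> finite {A \<in> G. F A = A}"

text \<open>
  A finite simple group of Lie type in characteristic \<open>p\<close> is a non-abelian finite simple group
  isomorphic to the derived group of the group of fixed points of a Steinberg endomorphism of an
  adjoint simple algebraic group over an algebraic closure \<open>L\<close> of the field \<open>k\<close> with \<open>p\<close> elements.
  (The library's \<^const>\<open>simple_group\<close> includes finiteness, since \<^const>\<open>order\<close> is \<open>0\<close> for infinite
  groups.)
\<close>

definition simple_group_of_lie_type :: "nat \<Rightarrow> ('c, 'd) monoid_scheme \<Rightarrow> bool" where
  "simple_group_of_lie_type p S \<longleftrightarrow>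
    simple_group S \<and> \<not> comm_group S \<and>
    (\<exists>(L :: nat ring) k m G F.
       algebraic_closure L k \<and> card k = p \<and>
       adjoint_simple_algebraic_group m L G \<and> steinberg_endomorphism m L G F \<and>
       S \<cong> (GL m L)\<lparr>carrier := derived (GL m L) {A \<in> G. F A = A}\<rparr>)"


section \<open>The constants \<open>J\<^sub>1(n)\<close>, \<open>J\<^sub>2(n)\<close>, \<open>J\<^sub>3(n)\<close>\<close>

definition J1_constant :: "nat \<Rightarrow> real \<Rightarrow> bool" where
  "J1_constant n J \<longleftrightarrow>
    (\<exists>rmax::nat. \<forall>p a (K :: nat ring) G.
       Factorial_Ring.prime p \<and> a \<ge> 1 \<and> field K \<and> card (carrier K) = p ^ a \<and> subgroup G (GL n K) \<longrightarrow>
       (\<exists>G1 G2 G3.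
          G1 \<lhd> ((GL n K)\<lparr>carrier := G\<rparr>) \<and>
          G2 \<lhd> ((GL n K)\<lparr>carrier := G\<rparr>) \<and>
          G3 \<lhd> ((GL n K)\<lparr>carrier := G\<rparr>) \<and>
          G3 \<subseteq> G2 \<and> G2 \<subseteq> G1 \<and>
          real (card (rcosets\<^bsub>(GL n K)\<lparr>carrier := G\<rparr>\<^esub> G1)) \<le> J \<and>
          (\<exists>r\<le>rmax. \<exists>S :: nat \<Rightarrow> nat monoid.
             (\<forall>i<r. simple_group_of_lie_type p (S i)) \<and>
             (GL n K)\<lparr>carrier := G1\<rparr> Mod G2 \<cong> product_group {..<r} S) \<and>
          comm_group ((GL n K)\<lparr>carrier := G2\<rparr> Mod G3) \<and>
          coprime (order ((GL n K)\<lparr>carrier := G2\<rparr> Mod G3)) p \<and>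
          (\<exists>e::nat. card G3 = p ^ e)))"

text \<open>
  Conjugation into the upper triangular matrices takes place over the algebraic closure: over \<open>K\<close>
  itself no bounded index would do, as the cyclic
  subgroups of order \<open>q\<^sup>n - 1\<close> show for \<open>n \<ge> 2\<close>.
\<close>

definition geometrically_triangularizable ::
    "nat \<Rightarrow> nat ring \<Rightarrow> (nat \<times> nat \<Rightarrow> nat) set \<Rightarrow> bool" where
  "geometrically_triangularizable n K H \<longleftrightarrow>
    (\<exists>(L :: nat ring) \<phi>. \<phi> \<in> ring_hom K L \<and> algebraic_closure L (\<phi> ` carrier K) \<and>
      (\<exists>g\<in>carrier (GL n L). \<forall>h\<in>H. \<forall>i<n. \<forall>j<i.
         (g \<otimes>\<^bsub>GL n L\<^esub> (\<lambda>x\<in>{..<n} \<times> {..<n}. \<phi> (h x)) \<otimes>\<^bsub>GL n L\<^esub> inv\<^bsub>GL n L\<^esub> g) (i, j) = \<zero>\<^bsub>L\<^esub>))"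

definition J2_constant :: "nat \<Rightarrow> real \<Rightarrow> bool" where
  "J2_constant n J \<longleftrightarrow>
    (\<forall>p a (K :: nat ring) G.
       Factorial_Ring.prime p \<and> a \<ge> 1 \<and> field K \<and> card (carrier K) = p ^ a \<and>
       subgroup G (GL n K) \<and> solvable ((GL n K)\<lparr>carrier := G\<rparr>) \<longrightarrow>
       (\<exists>H. H \<lhd> ((GL n K)\<lparr>carrier := G\<rparr>) \<and>
            real (card (rcosets\<^bsub>(GL n K)\<lparr>carrier := G\<rparr>\<^esub> H)) \<le> J \<and>
            geometrically_triangularizable n K H))"

text \<open>
  A finite linear group in characteristic \<open>0\<close> is conjugate to one over the algebraic numbers, so
  algebraically closed fields with carrier in \<^typ>\<open>complex\<close> (among them the complex field itself)
  determine the same constants as all algebraically closed fields of characteristic \<open>0\<close>.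
\<close>

definition J3_constant :: "nat \<Rightarrow> real \<Rightarrow> bool" where
  "J3_constant n J \<longleftrightarrow>
    (\<forall>(k :: complex ring) G.
       algebraically_closed k \<and> (\<forall>m::nat. m > 0 \<longrightarrow> [m] \<cdot>\<^bsub>k\<^esub> \<one>\<^bsub>k\<^esub> \<noteq> \<zero>\<^bsub>k\<^esub>) \<and>
       subgroup G (GL n k) \<and> finite G \<longrightarrow>
       (\<exists>A. A \<lhd> ((GL n k)\<lparr>carrier := G\<rparr>) \<and>
            comm_group ((GL n k)\<lparr>carrier := A\<rparr>) \<and>
            real (card (rcosets\<^bsub>(GL n k)\<lparr>carrier := G\<rparr>\<^esub> A)) \<le> J))"

end

theory Submission
  imports Defs "HOL-Analysis.Determinants" "HOL-Analysis.Convex" "HOL-Library.Function_Algebras"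
    "HOL-Algebra.Algebraic_Closure_Type" "HOL-Number_Theory.Residues"
begin

text \<open>
  Call a subset of \<open>G\<close> closed if it is cut out by polynomial conditions of degree at most \<open>n\<close> on
  the matrix entries. If a closed set \<open>X\<close> has density at least \<open>\<delta>\<close> in \<open>G\<close>, then either few of its
  translates are distinct, so that \<open>X\<close> contains a coset of its stabilizer, or two distinct translates have a
  dense intersection, which is closed of smaller dimension. Hence dense closed sets contain cosets of subgroups
  of bounded index, and \<open>G\<close> has a normal subgroup \<open>\<Gamma>\<close> of bounded index that behaves like a
  Zariski connected group: a polynomial condition that holds on a dense part of a coset \<open>g \<Gamma>\<close>
  holds on all of \<open>g \<Gamma>\<close>.

  Over the algebraic closure \<open>\<Gamma>\<close> acts semisimply with at most \<open>n\<close> isomorphism types of simple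
  submodules, so the subgroup \<open>G'\<close> of \<open>G\<close> that fixes all types has index at most
  \<open>n!\<close>. Monomial groups show \<open>J\<^sub>3(n) \<ge> n!\<close>, so \<open>\<eta> n! < 1\<close> and some coset
  \<open>g \<Gamma>\<close> with \<open>g \<in> G'\<close> meets \<open>H\<close> in positive density; therefore
  \<open>det(1 - h T)\<close> is constant on it. Every type contains a simple \<open>\<Gamma>\<close>-submodule
  \<open>W\<close> with \<open>g W = W\<close>. The trace of \<open>g \<gamma>\<close> on \<open>W\<close> is a sum of eigenvalues from a fixed set
  of size \<open>n\<close>, so it takes few values and is constant by connectedness. As \<open>\<Gamma>\<close> spans
  \<open>End(W)\<close>, this forces \<open>\<Gamma>\<close> to act trivially on \<open>W\<close>. Thus \<open>\<Gamma> = 1\<close> and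
  \<open>|G|\<close> is bounded by the index.
\<close>

text \<open>The size of the field is arbitrary, so every constant has to come from a dimension that
  does not see it. The polynomial functions of degree at most \<open>n\<close> on \<open>n\<close>
  by \<open>n\<close> matrices form a space of dimension at most \<open>(n^2 + 1)^n\<close> over any
  field, so a strictly descending chain of sets closed in this sense has bounded length. Degree
  \<open>n\<close> is forced by \<open>det(1 - t g x)\<close>, which for fixed \<open>g\<close> and
  \<open>t\<close> has degree at most \<open>n\<close> in \<open>x\<close>. \<open>N\<close> enters
  by pigeonhole: one polynomial is shared by a part of density \<open>(1 - \<eta> n!) / N\<close> of
  a coset of \<Gamma>. A coset must be used, since \<open>H\<close> may miss \<Gamma> itself; hence
  the twisted traces of \<open>g \<gamma>\<close>, which make sense on \<open>W\<close> only if
  \<open>g W = W\<close>, and hence the condition that \<open>g\<close> fixes the types. A constant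
  twisted trace vanishes on the ideal generated by \<open>\<gamma> - 1\<close>. If \<gamma> acted
  nontrivially on \<open>W\<close>, this ideal would contain operators of rank one on
  \<open>W\<close>, and one of them would have twisted trace 1. Producing them needs eigenvalues,
  hence the algebraic closure; semisimplicity is carried there by Clifford's argument and by the
  rational vectors in Frobenius-stable subspaces.\<close>

no_notation Polynomials.var (\<open>X\<index>\<close>)

interpretation fs: vector_space "\<lambda>(c::'a::field) (f::'b \<Rightarrow> 'a) x. c * f x"
  by unfold_locales (auto simp: fun_eq_iff algebra_simps)

text \<open>Functions on matrices over an infinite field form an infinite-dimensional space, where
  \<open>fs.dim\<close> need not be monotone. The finite set \<open>B\<close> makes both bases
  finite, and a vector outside \<open>S\<close> then enlarges the basis of \<open>S\<close>.\<close>

lemma fs_dim_psubset: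
  fixes S T B :: "('b \<Rightarrow> 'a::field) set"
  assumes "fs.subspace S" "S \<subset> T" "T \<subseteq> fs.span B" "finite B"
  shows "fs.dim S < fs.dim T"
proof -
  obtain BS where BS: "BS \<subseteq> S" "fs.independent BS" "S \<subseteq> fs.span BS" "card BS = fs.dim S"
    using fs.basis_exists by blast
  obtain BT where BT: "BT \<subseteq> T" "fs.independent BT" "T \<subseteq> fs.span BT" "card BT = fs.dim T"
    using fs.basis_exists by blast
  have finBT: "finite BT"
    using fs.independent_span_bound[OF \<open>finite B\<close> BT(2)] BT(1) assms(3) by blast
  have finBS: "finite BS"
    using fs.independent_span_bound[OF \<open>finite B\<close> BS(2)] BS(1) assms(2,3) by blast
  obtain t where t: "t \<in> T" "t \<notin> S" using assms(2) by blast
  have sS: "fs.span BS = S"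
    using BS(3) fs.span_minimal[OF BS(1) assms(1)] by blast
  have "fs.independent (insert t BS)"
    using fs.independent_insertI[of t BS] t sS BS by auto
  moreover have "insert t BS \<subseteq> fs.span BT"
    using t BT BS assms(2) by blast
  ultimately have "card (insert t BS) \<le> card BT"
    using fs.independent_span_bound[OF finBT] by blast
  moreover have "t \<notin> BS" using t sS BS(1) by blast
  ultimately show ?thesis using finBS BS(4) BT(4) by simp
qed

section \<open>Finite matrix groups\<close>

definition matrix_group :: "('a::field^'n^'n) set \<Rightarrow> bool" where
  "matrix_group G \<longleftrightarrow> finite G \<and> mat 1 \<in> G \<and> (\<forall>x\<in>G. \<forall>y\<in>G. x ** y \<in> G) \<and>
     (\<forall>x\<in>G. \<exists>y\<in>G. y ** x = mat 1)"

definition minv :: "'a::field^'n^'n \<Rightarrow> 'a^'n^'n" where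
  "minv x = (SOME y. y ** x = mat 1)"

lemma minv_eq:
  assumes "y ** x = mat 1"
  shows "minv x = y"
proof -
  have "minv x ** x = mat 1" unfolding minv_def by (rule someI[of _ y]) (fact assms)
  then have "minv x ** (x ** y) = mat 1 ** y" by (simp add: matrix_mul_assoc)
  moreover have "x ** y = mat 1" using assms matrix_left_right_inverse by blast
  ultimately show ?thesis by simp
qed

context
  fixes G :: "('a::field^'n^'n) set"
  assumes G: "matrix_group G"
begin

lemma mg_finite: "finite G" and mg_one: "mat 1 \<in> G"
  and mg_mult: "x \<in> G \<Longrightarrow> y \<in> G \<Longrightarrow> x ** y \<in> G"
  using G by (auto simp: matrix_group_def)

lemma mg_inv: "x \<in> G \<Longrightarrow> minv x \<in> G"
  using G minv_eq unfolding matrix_group_def by metis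

lemma mg_left: "x \<in> G \<Longrightarrow> minv x ** x = mat 1"
  using G minv_eq unfolding matrix_group_def by metis

lemma mg_right: "x \<in> G \<Longrightarrow> x ** minv x = mat 1"
  using mg_left matrix_left_right_inverse by blast

lemma mg_inv_cancel: "x \<in> G \<Longrightarrow> minv x ** (x ** y) = y" "x \<in> G \<Longrightarrow> x ** (minv x ** y) = y"
  by (simp_all add: matrix_mul_assoc mg_left mg_right)

lemma mg_inv_cancel_right: "x \<in> G \<Longrightarrow> y ** x ** minv x = y" "x \<in> G \<Longrightarrow> y ** minv x ** x = y"
  by (simp_all add: matrix_mul_assoc[symmetric] mg_left mg_right)

lemma mg_inv_inv: "x \<in> G \<Longrightarrow> minv (minv x) = x"
  by (intro minv_eq mg_right)

lemma mg_inv_mult: "x \<in> G \<Longrightarrow> y \<in> G \<Longrightarrow> minv (x ** y) = minv y ** minv x"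
  by (intro minv_eq) (metis matrix_mul_assoc mg_inv_cancel(1) mg_left)

lemma mg_inj_left: "x \<in> G \<Longrightarrow> inj_on ((**) x) S"
  by (metis inj_onI mg_inv_cancel(1))

lemma mg_card_pos: "card G > 0"
  using mg_finite mg_one card_gt_0_iff by blast

end

lemma matrix_groupI:
  assumes "matrix_group G" "K \<subseteq> G" "mat 1 \<in> K" "\<And>x y. x \<in> K \<Longrightarrow> y \<in> K \<Longrightarrow> x ** y \<in> K"
    "\<And>x. x \<in> K \<Longrightarrow> minv x \<in> K"
  shows "matrix_group K"
  unfolding matrix_group_def
  using assms mg_left[OF assms(1)] finite_subset[OF assms(2) mg_finite[OF assms(1)]] by blast

text \<open>Each nonempty fibre of \<open>F\<close> is moved into \<open>K\<close> by left
  translation with \<open>minv g\<close>, for any \<open>g\<close> in the fibre. The number of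
  values of \<open>F\<close> thus bounds the index of \<open>K\<close>.\<close>

lemma card_le_index_mult:
  assumes G: "matrix_group G" and "finite K"
    and K: "\<And>g h. g \<in> G \<Longrightarrow> h \<in> G \<Longrightarrow> F g = F h \<Longrightarrow> minv g ** h \<in> K"
  shows "card G \<le> card (F ` G) * card K"
proof -
  have fin: "finite G" by (rule mg_finite[OF G])
  have "G = (\<Union>y\<in>F ` G. {h\<in>G. F h = y})" by auto
  then have "card G = card (\<Union>y\<in>F ` G. {h\<in>G. F h = y})" by (rule arg_cong)
  also have "\<dots> \<le> (\<Sum>y\<in>F ` G. card {h\<in>G. F h = y})"
    by (rule card_UN_le) (use fin in simp)
  also have "\<dots> \<le> (\<Sum>y\<in>F ` G. card K)"
  proof (rule sum_mono)
    fix y assume "y \<in> F ` G"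
    then obtain g where g: "g \<in> G" "F g = y" by auto
    show "card {h \<in> G. F h = y} \<le> card K"
    proof (rule card_inj_on_le[of "\<lambda>h. minv g ** h"])
      show "inj_on (\<lambda>h. minv g ** h) {h \<in> G. F h = y}"
        by (rule mg_inj_left[OF G mg_inv[OF G g(1)]])
    qed (use g K \<open>finite K\<close> in auto)
  qed
  finally show ?thesis by simp
qed

text \<open>An action on \<open>s\<close> points is a homomorphism into a group of order
  \<open>s!\<close>. It is applied to left cosets, for the normal core, and to isomorphism types of
  simple submodules.\<close>

lemma card_le_fact_mult_kernel:
  assumes G: "matrix_group G" and S: "finite S"
    and act: "\<And>g s. g \<in> G \<Longrightarrow> s \<in> S \<Longrightarrow> act g s \<in> S"
    and one: "\<And>s. s \<in> S \<Longrightarrow> act (mat 1) s = s"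
    and mult: "\<And>g h s. g \<in> G \<Longrightarrow> h \<in> G \<Longrightarrow> s \<in> S \<Longrightarrow> act (g ** h) s = act g (act h s)"
  shows "card G \<le> fact (card S) * card {g\<in>G. \<forall>s\<in>S. act g s = s}"
proof -
  let ?K = "{g\<in>G. \<forall>s\<in>S. act g s = s}"
  \<comment> \<open>Extended by the identity outside \<open>S\<close>, as \<open>permutes\<close>
    requires.\<close>
  define F where "F g = (\<lambda>s. if s \<in> S then act g s else s)" for g
  have inv: "act (minv g) (act g s) = s" "act g (act (minv g) s) = s" if "g \<in> G" "s \<in> S" for g s
    using mult[of "minv g" g s] mult[of g "minv g" s] mg_left[OF G] mg_right[OF G] mg_inv[OF G] one that
    by auto
  have perm: "F g permutes S" if "g \<in> G" for g
  proof (rule bij_imp_permutes)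
    show "bij_betw (F g) S S"
      by (rule bij_betw_byWitness[where f' = "F (minv g)"])
        (use inv act that mg_inv[OF G] in \<open>auto simp: F_def\<close>)
  qed (auto simp: F_def)
  have "card G \<le> card (F ` G) * card ?K"
  proof (rule card_le_index_mult[OF G])
    fix g h assume gh: "g \<in> G" "h \<in> G" "F g = F h"
    have "act (minv g ** h) s = s" if "s \<in> S" for s
    proof -
      have "act g s = act h s" using gh(3) that by (auto simp: F_def fun_eq_iff split: if_splits)
      then show ?thesis using mult[of "minv g" h s] inv[of g s] gh that mg_inv[OF G] by metis
    qed
    then show "minv g ** h \<in> ?K" using gh mg_mult[OF G] mg_inv[OF G] by auto
  qed (use mg_finite[OF G] in auto)
  also have "card (F ` G) \<le> card {\<pi>. \<pi> permutes S}"
    using perm S by (intro card_mono) (auto simp: finite_permutations)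
  also have "\<dots> = fact (card S)" using S by (simp add: card_permutations)
  finally show ?thesis by (simp add: mult_right_mono)
qed

text \<open>The core is the kernel of the action of \<open>G\<close> on the left cosets of
  \<open>H\<close>; there are at most \<open>m\<close> of them.\<close>

lemma normal_core:
  assumes G: "matrix_group G" and H: "matrix_group H" "H \<subseteq> G" and idx: "card G \<le> m * card H"
  obtains N where "matrix_group N" "N \<subseteq> H" "\<And>g x. g \<in> G \<Longrightarrow> x \<in> N \<Longrightarrow> g ** x ** minv g \<in> N"
    "card G \<le> fact m * card N"
proof -
  define S where "S = (\<lambda>g. (**) g ` H) ` G"
  define act :: "'a^'b^'b \<Rightarrow> ('a^'b^'b) set \<Rightarrow> ('a^'b^'b) set" where "act g X = (**) g ` X" for g X
  define N where "N = {g\<in>G. \<forall>X\<in>S. act g X = X}"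
  have finG: "finite G" and finH: "finite H" using mg_finite G H by auto
  have finS: "finite S" by (simp add: S_def finG)
  have act1: "act (mat 1) X = X" and actm: "act (g ** h) X = act g (act h X)" for X g h
    by (auto simp: act_def image_image matrix_mul_assoc)
  have actS: "act g X \<in> S" if "g \<in> G" and X: "X \<in> S" for g X
  proof -
    obtain h where h: "h \<in> G" "X = (**) h ` H" using X by (auto simp: S_def)
    then have "act g X = (**) (g ** h) ` H" by (auto simp: act_def image_image matrix_mul_assoc)
    then show ?thesis using h that mg_mult[OF G] by (auto simp: S_def)
  qed
  have NG: "N \<subseteq> G" by (auto simp: N_def)
  have Ngrp: "matrix_group N"
  proof (rule matrix_groupI[OF G NG])
    fix x assume x: "x \<in> N"
    have "act (minv x) X = X" if "X \<in> S" for X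
      using x that actm[of "minv x" x X] act1 mg_left[OF G, of x] by (auto simp: N_def)
    then show "minv x \<in> N" using x mg_inv[OF G] by (auto simp: N_def)
  qed (auto simp: N_def act1 actm mg_one[OF G] mg_mult[OF G])
  have NH: "N \<subseteq> H"
  proof
    fix g assume g: "g \<in> N"
    have "(**) (mat 1) ` H = H" by simp
    then have "H \<in> S" unfolding S_def using mg_one[OF G] by blast
    then have "act g H = H" using g by (auto simp: N_def)
    then have "g ** mat 1 \<in> H" using mg_one[OF H(1)] unfolding act_def by blast
    then show "g \<in> H" by simp
  qed
  have normal: "g ** x ** minv g \<in> N" if g: "g \<in> G" and x: "x \<in> N" for g x
  proof -
    have "act (g ** x ** minv g) X = X" if "X \<in> S" for X
    proof -
      have "act (minv g) X \<in> S" by (rule actS[OF mg_inv[OF G g] that])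
      then have "act x (act (minv g) X) = act (minv g) X" using x by (auto simp: N_def)
      then show ?thesis by (metis actm act1 mg_right[OF G g])
    qed
    then show ?thesis using g x mg_mult[OF G] mg_inv[OF G] by (auto simp: N_def)
  qed
  \<comment> \<open>Lagrange by counting: the cosets are disjoint, cover \<open>G\<close> and have
    the size of \<open>H\<close>. Cancelling \<open>card H\<close> leaves at most \<open>m\<close>
    cosets.\<close>
  have "card S * card H = card G"
  proof -
    have disj: "X \<inter> Y = {}" if "X \<in> S" "Y \<in> S" "X \<noteq> Y" for X Y
    proof (rule ccontr)
      assume "X \<inter> Y \<noteq> {}"
      obtain a b where ab: "a \<in> G" "X = (**) a ` H" "b \<in> G" "Y = (**) b ` H"
        using \<open>X \<in> S\<close> \<open>Y \<in> S\<close> by (auto simp: S_def)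
      then obtain h k where hk: "h \<in> H" "k \<in> H" "a ** h = b ** k" using \<open>X \<inter> Y \<noteq> {}\<close> by auto
      have a: "b ** k ** minv h = a" and b: "a ** h ** minv k = b"
        using mg_inv_cancel_right(1)[OF H(1) hk(1), of a] mg_inv_cancel_right(1)[OF H(1) hk(2), of b] hk(3)
        by simp_all
      have "a ** x \<in> Y" "b ** x \<in> X" if x: "x \<in> H" for x
      proof -
        have "a ** x = b ** (k ** (minv h ** x))" "b ** x = a ** (h ** (minv k ** x))"
          by (simp_all only: matrix_mul_assoc a b)
        moreover have "k ** (minv h ** x) \<in> H" "h ** (minv k ** x) \<in> H"
          by (intro mg_mult[OF H(1)] mg_inv[OF H(1)] hk x)+
        ultimately show "a ** x \<in> Y" "b ** x \<in> X" unfolding ab by simp_all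
      qed
      then have "X \<subseteq> Y" "Y \<subseteq> X" using ab by auto
      then show False using that by blast
    qed
    have "G = \<Union> S"
    proof (intro subset_antisym subsetI)
      fix g assume "g \<in> G"
      moreover have "g \<in> (**) g ` H" using mg_one[OF H(1)] by (intro image_eqI[of _ _ "mat 1"]) simp_all
      ultimately show "g \<in> \<Union> S" unfolding S_def by blast
    qed (use H(2) mg_mult[OF G] in \<open>auto simp: S_def\<close>)
    moreover have "card (\<Union> S) = (\<Sum>X\<in>S. card X)"
      by (rule card_Union_disjoint) (use disj finH in \<open>auto simp: S_def pairwise_def disjnt_def\<close>)
    moreover have "(\<Sum>X\<in>S. card X) = (\<Sum>X\<in>S. card H)"
      by (rule sum.cong) (auto simp: S_def card_image[OF mg_inj_left[OF G]])
    ultimately show ?thesis by simp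
  qed
  then have "card S \<le> m" using idx mg_card_pos[OF H(1)] by (metis mult_le_cancel2 less_numeral_extra(3))
  have "card G \<le> fact (card S) * card N"
    unfolding N_def using card_le_fact_mult_kernel[OF G finS, of act] actS act1 actm by auto
  also have "\<dots> \<le> fact m * card N"
    using \<open>card S \<le> m\<close> by (intro mult_right_mono fact_mono) auto
  finally show thesis using that[OF Ngrp NH] normal by blast
qed

section \<open>Polynomial functions of bounded degree\<close>

definition entry_funs :: "('a::field^'n^'n \<Rightarrow> 'a) set" where
  "entry_funs = insert (\<lambda>_. 1) (range (\<lambda>(i, j) x. x $ i $ j))"

text \<open>Since \<open>entry_funs\<close> contains the constant 1, products of exactly
  \<open>d\<close> factors include all monomials of lower degree; the span consists of all
  polynomial functions of degree at most \<open>d\<close>.\<close>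

primrec monomials :: "nat \<Rightarrow> ('a::field^'n^'n \<Rightarrow> 'a) set" where
  "monomials 0 = {\<lambda>_. 1}"
| "monomials (Suc d) = (\<lambda>(f, h) x. f x * h x) ` (monomials d \<times> entry_funs)"

abbreviation affine_funs :: "('a::field^'n^'n \<Rightarrow> 'a) set" where
  "affine_funs \<equiv> fs.span entry_funs"

abbreviation poly_maps :: "nat \<Rightarrow> ('a::field^'n^'n \<Rightarrow> 'a) set" where
  "poly_maps d \<equiv> fs.span (monomials d)"

lemma finite_entry_funs: "finite (entry_funs :: ('a::field^'n^'n \<Rightarrow> 'a) set)"
  by (simp add: entry_funs_def)

lemma card_entry_funs: "card (entry_funs :: ('a::field^'n^'n \<Rightarrow> 'a) set) \<le> CARD('n)^2 + 1"
proof -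
  have "card (entry_funs :: ('a^'n^'n \<Rightarrow> 'a) set)
      \<le> Suc (card (range (\<lambda>(i, j) (x::'a^'n^'n). x $ i $ j)))"
    unfolding entry_funs_def by (rule card_insert_le_m1) auto
  also have "card (range (\<lambda>(i, j) (x::'a^'n^'n). x $ i $ j)) \<le> card (UNIV :: ('n \<times> 'n) set)"
    by (rule card_image_le) simp
  also have "\<dots> = CARD('n)^2" by (simp add: card_prod power2_eq_square)
  finally show ?thesis by simp
qed

lemma finite_monomials: "finite (monomials d :: ('a::field^'n^'n \<Rightarrow> 'a) set)"
  by (induction d) (simp_all add: finite_entry_funs)

text \<open>The bound is the same over every field. It limits the dimension of all spaces of
  equations and so keeps the field out of the final constant.\<close>

lemma card_monomials: "card (monomials d :: ('a::field^'n^'n \<Rightarrow> 'a) set) \<le> (CARD('n)^2 + 1)^d"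
proof (induction d)
  case (Suc d)
  have "card (monomials (Suc d) :: ('a^'n^'n \<Rightarrow> 'a) set)
      \<le> card (monomials d \<times> entry_funs :: (('a^'n^'n \<Rightarrow> 'a) \<times> ('a^'n^'n \<Rightarrow> 'a)) set)"
    by (simp only: monomials.simps) (rule card_image_le, simp add: finite_monomials finite_entry_funs)
  also have "\<dots> = card (monomials d :: ('a^'n^'n \<Rightarrow> 'a) set) * card (entry_funs :: ('a^'n^'n \<Rightarrow> 'a) set)"
    by (rule card_cartesian_product)
  also have "\<dots> \<le> (CARD('n)^2 + 1)^d * (CARD('n)^2 + 1)"
    by (rule mult_mono[OF Suc card_entry_funs]) simp_all
  finally show ?case by (simp only: power_Suc2)
qed simp

lemma poly_maps_mult:
  assumes "f \<in> poly_maps d" "h \<in> affine_funs"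
  shows "(\<lambda>x. f x * h x) \<in> poly_maps (Suc d)"
  using assms(1)
proof (induction rule: fs.span_induct_alt)
  case base
  show ?case using fs.span_zero by (simp add: zero_fun_def)
next
  case (step c m f)
  have "(\<lambda>x. m x * h x) \<in> poly_maps (Suc d)"
    using assms(2)
  proof (induction rule: fs.span_induct_alt)
    case base
    show ?case using fs.span_zero by (simp add: zero_fun_def)
  next
    case (step c e h)
    have "(\<lambda>x. m x * e x) \<in> poly_maps (Suc d)"
      using step(1) \<open>m \<in> monomials d\<close> by (intro fs.span_base) auto
    from fs.span_add[OF fs.span_scale[OF this, of c] step(2)]
    show ?case by (simp add: plus_fun_def algebra_simps)
  qed
  from fs.span_add[OF fs.span_scale[OF this, of c] step(2)]
  show ?case by (simp add: plus_fun_def algebra_simps)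
qed

lemma poly_maps_const: "(\<lambda>_. c) \<in> poly_maps d"
proof -
  have "(\<lambda>_. 1) \<in> (poly_maps d :: ('a::field^'n^'n \<Rightarrow> 'a) set)"
  proof (induction d)
    case (Suc d)
    then show ?case
      using poly_maps_mult[OF Suc, of "\<lambda>_. 1"] by (simp add: fs.span_base entry_funs_def)
  qed (simp add: fs.span_base)
  from fs.span_scale[OF this, of c] show ?thesis by simp
qed

lemma affine_subset_poly_maps: "d \<ge> 1 \<Longrightarrow> affine_funs \<subseteq> poly_maps d"
proof (induction d rule: dec_induct)
  case base
  show ?case using poly_maps_mult[OF poly_maps_const[of 1 0]] by auto
next
  case (step d)
  have "(\<lambda>_. 1) \<in> affine_funs" by (simp add: fs.span_base entry_funs_def)
  then show ?case using poly_maps_mult[where h = "\<lambda>_. 1"] step by fastforce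
qed

lemma affine_const: "(\<lambda>_. c) \<in> affine_funs"
proof -
  have "(\<lambda>_. 1) \<in> affine_funs" by (simp add: fs.span_base entry_funs_def)
  from fs.span_scale[OF this, of c] show ?thesis by simp
qed

lemma affine_entry: "(\<lambda>x. x $ i $ j) \<in> affine_funs"
  by (rule fs.span_base) (auto simp: entry_funs_def image_iff)

lemma affine_scale: "f \<in> affine_funs \<Longrightarrow> (\<lambda>x. c * f x) \<in> affine_funs"
  by (rule fs.span_scale)

lemma affine_add: "f \<in> affine_funs \<Longrightarrow> g \<in> affine_funs \<Longrightarrow> (\<lambda>x. f x + g x) \<in> affine_funs"
  using fs.span_add[of f entry_funs g] by (simp add: plus_fun_def)

lemma affine_sum:
  assumes "\<And>i. i \<in> I \<Longrightarrow> f i \<in> affine_funs"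
  shows "(\<lambda>x. \<Sum>i\<in>I. f i x) \<in> affine_funs"
  using assms affine_const[of 0] by (induction I rule: infinite_finite_induct) (auto intro: affine_add)

lemma poly_maps_sum:
  assumes "\<And>i. i \<in> I \<Longrightarrow> f i \<in> poly_maps d"
  shows "(\<lambda>x. \<Sum>i\<in>I. f i x) \<in> poly_maps d"
proof (use assms in \<open>induction I rule: infinite_finite_induct\<close>)
  case (insert i I)
  then show ?case using fs.span_add[of "f i" "monomials d"] by (auto simp: plus_fun_def)
qed (use poly_maps_const[of 0] in auto)

lemma poly_maps_scale: "f \<in> poly_maps d \<Longrightarrow> (\<lambda>x. c * f x) \<in> poly_maps d"
  by (rule fs.span_scale)

lemma poly_maps_diff: "f \<in> poly_maps d \<Longrightarrow> g \<in> poly_maps d \<Longrightarrow> (\<lambda>x. f x - g x) \<in> poly_maps d"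
  using fs.span_diff[of f "monomials d" g] by (simp add: fun_diff_def)

lemma poly_maps_prod:
  assumes "\<And>i. i \<in> I \<Longrightarrow> f i \<in> affine_funs" "finite I"
  shows "(\<lambda>x. \<Prod>i\<in>I. f i x) \<in> poly_maps (card I)"
  using assms(2,1)
proof (induction I rule: finite_induct)
  case empty
  show ?case using poly_maps_const[of 1 0] by simp
next
  case (insert i I)
  have "(\<lambda>x. (\<Prod>i\<in>I. f i x) * f i x) \<in> poly_maps (Suc (card I))"
    by (rule poly_maps_mult) (use insert in auto)
  then show ?case using insert by (simp add: mult.commute)
qed

text \<open>The map from \<open>x\<close> to \<open>a ** x ** b\<close> is linear in the entries, so
  substituting it does not raise the degree. This makes translates of closed sets closed in the same
  degree.\<close>

lemma poly_maps_translate: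
  assumes "f \<in> poly_maps d"
  shows "(\<lambda>x. f (a ** x ** b)) \<in> poly_maps d"
  using assms
proof (induction rule: fs.span_induct_alt)
  case base
  show ?case using fs.span_zero by (simp add: zero_fun_def)
next
  case (step c m f)
  have aff: "(\<lambda>x. e (a ** x ** b)) \<in> affine_funs" if "e \<in> entry_funs" for e
  proof -
    have "(\<lambda>x. (a ** x ** b) $ i $ j) \<in> affine_funs" for i j
    proof -
      have "(\<lambda>x. (a ** x ** b) $ i $ j) = (\<lambda>x. \<Sum>l\<in>UNIV. \<Sum>k\<in>UNIV. (b $ l $ j * a $ i $ k) * x $ k $ l)"
        by (simp add: fun_eq_iff matrix_matrix_mult_def sum_distrib_left sum_distrib_right mult_ac)
      also have "\<dots> \<in> affine_funs"
        by (intro affine_sum affine_scale affine_entry)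
      finally show ?thesis .
    qed
    then show ?thesis using that affine_const[of 1] by (auto simp: entry_funs_def)
  qed
  have "(\<lambda>x. m (a ** x ** b)) \<in> poly_maps d"
    using step(1)
  proof (induction d arbitrary: m)
    case 0
    then show ?case using poly_maps_const[of 1 0] by simp
  next
    case (Suc d)
    then obtain m' e where "m' \<in> monomials d" "e \<in> entry_funs" "m = (\<lambda>x. m' x * e x)" by auto
    then show ?case using poly_maps_mult[OF Suc.IH[of m'] aff[of e]] by simp
  qed
  from fs.span_add[OF fs.span_scale[OF this, of c] step(2)]
  show ?case by (simp add: plus_fun_def)
qed

section \<open>Equations of bounded degree and their dimension\<close>

definition vanishing :: "nat \<Rightarrow> ('a::field^'n^'n) set \<Rightarrow> ('a^'n^'n \<Rightarrow> 'a) set" where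
  "vanishing d X = {f \<in> poly_maps d. \<forall>x\<in>X. f x = 0}"

lemma subspace_vanishing: "fs.subspace (vanishing d X)"
  unfolding vanishing_def fs.subspace_def
  using fs.span_zero fs.span_add[of _ "monomials d"] fs.span_scale[of _ "monomials d"] by auto

lemma vanishing_subset: "vanishing d X \<subseteq> poly_maps d"
  by (auto simp: vanishing_def)

lemma vanishing_antimono: "X \<subseteq> Y \<Longrightarrow> vanishing d Y \<subseteq> vanishing d X"
  by (auto simp: vanishing_def)

text \<open>A substitute for dimension with the order reversed: a smaller closed set satisfies more
  equations and has larger \<open>vdim\<close>. Its uniform bound is what ends every
  descent.\<close>

definition vdim :: "nat \<Rightarrow> ('a::field^'n^'n) set \<Rightarrow> nat" where
  "vdim d X = fs.dim (vanishing d X)"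

lemma vdim_le: "vdim d (X :: ('a::field^'n^'n) set) \<le> (CARD('n)^2 + 1)^d"
proof -
  have "vdim d X \<le> card (monomials d :: ('a^'n^'n \<Rightarrow> 'a) set)"
    unfolding vdim_def by (rule fs.dim_le_card[OF vanishing_subset finite_monomials])
  then show ?thesis using card_monomials[of d, where 'a = 'a and 'n = 'n] by linarith
qed

lemma vdim_psubset: "vanishing d X \<subset> vanishing d Y \<Longrightarrow> vdim d X < vdim d Y"
  unfolding vdim_def
  by (rule fs_dim_psubset[OF subspace_vanishing _ vanishing_subset finite_monomials])

lemma vdim_antimono: "X \<subseteq> Y \<Longrightarrow> vdim d Y \<le> vdim d X"
  using vdim_psubset[of d Y X] vanishing_antimono[of X Y d]
  by (cases "vanishing d Y = vanishing d X") (simp_all add: vdim_def psubset_eq)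

text \<open>Composition with the inverse translation carries equations of \<open>X\<close> to
  equations of its translate, linearly and injectively.\<close>

lemma vdim_translate_le:
  fixes a a' b b' :: "'a::field^'b^'b"
  assumes "a' ** a = mat 1" "b ** b' = mat 1"
  shows "vdim d X \<le> vdim d ((\<lambda>x. a ** x ** b) ` X)"
proof -
  define T where "T = (\<lambda>f :: 'a^'b^'b \<Rightarrow> 'a. \<lambda>x. f (a' ** x ** b'))"
  obtain B where B: "B \<subseteq> vanishing d X" "fs.independent B" "vanishing d X \<subseteq> fs.span B" "card B = vdim d X"
    unfolding vdim_def using fs.basis_exists by blast
  have cancel: "a' ** (a ** x ** b) ** b' = x" "a ** (a' ** x ** b') ** b = x" for x
  proof -
    have "a ** a' = mat 1" "b' ** b = mat 1"
      using assms matrix_left_right_inverse by blast+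
    then show "a ** (a' ** x ** b') ** b = x"
      by (metis matrix_mul_assoc matrix_mul_lid matrix_mul_rid)
    show "a' ** (a ** x ** b) ** b' = x"
      by (metis assms matrix_mul_assoc matrix_mul_lid matrix_mul_rid)
  qed
  have linT: "Vector_Spaces.linear (\<lambda>c (f::'a^'b^'b \<Rightarrow> 'a) x. c * f x) (\<lambda>c f x. c * f x) T"
    by unfold_locales (auto simp: T_def fun_eq_iff algebra_simps)
  have injT: "inj T"
  proof (rule injI)
    fix f g assume "T f = T g"
    then have "f (a' ** (a ** x ** b) ** b') = g (a' ** (a ** x ** b) ** b')" for x
      unfolding T_def by metis
    then show "f = g" by (simp add: cancel fun_eq_iff)
  qed
  interpret T: Vector_Spaces.linear "\<lambda>c (f::'a^'b^'b \<Rightarrow> 'a) x. c * f x" "\<lambda>c f x. c * f x" T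
    by (rule linT)
  have "fs.independent (T ` B)"
    using T.independent_injective_image[OF B(2)] injT by (meson inj_on_subset subset_UNIV)
  moreover have TB: "T ` B \<subseteq> vanishing d ((\<lambda>x. a ** x ** b) ` X)"
    using B(1) by (auto simp: vanishing_def T_def cancel intro: poly_maps_translate)
  ultimately have "card (T ` B) \<le> vdim d ((\<lambda>x. a ** x ** b) ` X)"
  proof -
    assume ind: "fs.independent (T ` B)"
    obtain C where C: "C \<subseteq> vanishing d ((\<lambda>x. a ** x ** b) ` X)" "fs.independent C"
      "vanishing d ((\<lambda>x. a ** x ** b) ` X) \<subseteq> fs.span C" "card C = vdim d ((\<lambda>x. a ** x ** b) ` X)"
      unfolding vdim_def using fs.basis_exists by blast
    have "finite C"
      using fs.independent_span_bound[OF finite_monomials C(2)] C(1) vanishing_subset by blast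
    then show ?thesis using fs.independent_span_bound[OF _ ind, of C] C TB by auto
  qed
  then show ?thesis using B(4) card_image[of T B] injT by (metis inj_on_subset subset_UNIV)
qed

lemma vdim_translate:
  fixes a a' b b' :: "'a::field^'b^'b"
  assumes "a' ** a = mat 1" "b ** b' = mat 1"
  shows "vdim d ((\<lambda>x. a ** x ** b) ` X) = vdim d X"
proof (rule antisym)
  have inv: "a ** a' = mat 1" "b' ** b = mat 1"
    using assms matrix_left_right_inverse by blast+
  have "(\<lambda>x. a' ** x ** b') ` (\<lambda>x. a ** x ** b) ` X = X"
  proof -
    have "a' ** (a ** x ** b) ** b' = x" for x
      by (metis assms matrix_mul_assoc matrix_mul_lid matrix_mul_rid)
    then show ?thesis by (simp add: image_image)
  qed
  then show "vdim d ((\<lambda>x. a ** x ** b) ` X) \<le> vdim d X"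
    using vdim_translate_le[OF inv, of d "(\<lambda>x. a ** x ** b) ` X"] by simp
qed (rule vdim_translate_le[OF assms])

section \<open>Dense closed subsets of finite matrix groups\<close>

text \<open>Cauchy-Schwarz for the multiplicity with which the family covers \<open>G\<close>.\<close>

lemma card_overlapping_family:
  fixes \<T> :: "'b set set" and \<delta> :: real
  assumes G: "finite G" "G \<noteq> {}" and sub: "\<And>A. A \<in> \<T> \<Longrightarrow> A \<subseteq> G"
    and c: "\<And>A. A \<in> \<T> \<Longrightarrow> card A = a"
    and \<delta>: "\<delta> > 0" "\<delta> * card G \<le> a"
    and small: "\<And>A B. A \<in> \<T> \<Longrightarrow> B \<in> \<T> \<Longrightarrow> A \<noteq> B \<Longrightarrow> card (A \<inter> B) \<le> \<delta>\<^sup>2 / 2 * card G"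
  shows "card \<T> \<le> 2 / \<delta>"
proof -
  have fin: "finite \<T>" using G(1) sub by (metis Pow_iff finite_Pow_iff finite_subset subsetI)
  have finA: "finite A" if "A \<in> \<T>" for A using sub[OF that] G(1) finite_subset by blast
  define m :: "'b \<Rightarrow> real" where "m x = (\<Sum>A\<in>\<T>. of_bool (x \<in> A))" for x
  have cnt: "(\<Sum>x\<in>G. of_bool (x \<in> A)) = real (card A)" if "A \<subseteq> G" for A
    using that G(1) by (simp add: of_bool_def sum.If_cases Int_absorb1)
  have m1: "(\<Sum>x\<in>G. m x) = card \<T> * real a"
  proof -
    have "(\<Sum>x\<in>G. m x) = (\<Sum>A\<in>\<T>. \<Sum>x\<in>G. of_bool (x \<in> A))"
      unfolding m_def by (rule sum.swap)
    also have "\<dots> = (\<Sum>A\<in>\<T>. real a)"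
      by (rule sum.cong) (use cnt sub c in simp_all)
    finally show ?thesis by simp
  qed
  have "(\<Sum>x\<in>G. (m x)\<^sup>2) = (\<Sum>x\<in>G. \<Sum>A\<in>\<T>. \<Sum>B\<in>\<T>. of_bool (x \<in> A \<inter> B))"
    unfolding m_def power2_eq_square sum_product by (intro sum.cong refl) auto
  also have "\<dots> = (\<Sum>A\<in>\<T>. \<Sum>x\<in>G. \<Sum>B\<in>\<T>. of_bool (x \<in> A \<inter> B))"
    by (rule sum.swap)
  also have "\<dots> = (\<Sum>A\<in>\<T>. \<Sum>B\<in>\<T>. \<Sum>x\<in>G. of_bool (x \<in> A \<inter> B))"
    by (intro sum.cong refl sum.swap)
  also have "\<dots> = (\<Sum>A\<in>\<T>. \<Sum>B\<in>\<T>. real (card (A \<inter> B)))"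
    by (intro sum.cong refl cnt) (use sub in auto)
  \<comment> \<open>The diagonal terms contribute \<open>a\<close> each; all other pairs overlap in
    at most \<open>\<delta>\<^sup>2 / 2 * card G\<close>.\<close>
  also have "\<dots> \<le> (\<Sum>A\<in>\<T>. \<Sum>B\<in>\<T>. (if A = B then real a else 0) + \<delta>\<^sup>2 / 2 * card G)"
    using small c \<delta> by (intro sum_mono) (auto simp: add_increasing2)
  also have "\<dots> = card \<T> * real a + (card \<T>)\<^sup>2 * (\<delta>\<^sup>2 / 2 * card G)"
    using fin by (simp add: sum.distrib power2_eq_square algebra_simps)
  finally have m2: "(\<Sum>x\<in>G. (m x)\<^sup>2) \<le> card \<T> * real a + (card \<T>)\<^sup>2 * (\<delta>\<^sup>2 / 2 * card G)" .
  have "(\<Sum>x\<in>G. m x)\<^sup>2 \<le> (\<Sum>x\<in>G. (m x)\<^sup>2) * card G"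
    by (rule sum_squared_le_sum_of_squares)
  also have "\<dots> \<le> (card \<T> * real a + (card \<T>)\<^sup>2 * (\<delta>\<^sup>2 / 2 * card G)) * card G"
    using m2 by (rule mult_right_mono) simp
  finally have main: "(card \<T> * real a)\<^sup>2 \<le> (card \<T> * real a + (card \<T>)\<^sup>2 * (\<delta>\<^sup>2 / 2 * card G)) * card G"
    by (simp add: m1)
  define k x g where "k = real (card \<T>)" and "x = real a" and "g = real (card G)"
  have g: "g > 0" using G by (simp add: g_def card_gt_0_iff)
  have "0 < \<delta> * g" using \<delta>(1) g by (rule mult_pos_pos)
  then have x: "x > 0" using \<delta>(2) unfolding x_def g_def by linarith
  show ?thesis
  proof (cases "k = 0")
    case True
    then show ?thesis using \<delta>(1) by (simp add: k_def)
  next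
    case False
    then have k: "k > 0" by (simp add: k_def)
    \<comment> \<open>As \<open>x\<close> is at least \<open>\<delta> * g\<close>, the quadratic
      term is at most half of \<open>(k * x)\<^sup>2\<close> and is absorbed by the left side, which
      leaves \<open>k * x \<le> 2 * g\<close>.\<close>
    have "(\<delta> * g)\<^sup>2 \<le> x\<^sup>2" using \<delta> g by (intro power_mono) (auto simp: x_def g_def)
    then have "k\<^sup>2 * (\<delta> * g)\<^sup>2 \<le> k\<^sup>2 * x\<^sup>2" by (rule mult_left_mono) simp
    then have "k\<^sup>2 * (\<delta>\<^sup>2 / 2 * g) * g \<le> k\<^sup>2 * x\<^sup>2 / 2"
      by (simp add: power2_eq_square algebra_simps)
    moreover have "(k * x)\<^sup>2 \<le> k * x * g + k\<^sup>2 * (\<delta>\<^sup>2 / 2 * g) * g"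
      using main by (simp add: k_def x_def g_def algebra_simps)
    ultimately have "(k * x) * (k * x) \<le> (k * x) * (2 * g)"
      by (simp add: power2_eq_square algebra_simps)
    then have "k * x \<le> 2 * g" using k x by (simp add: mult_le_cancel_left_pos)
    moreover have "k * (\<delta> * g) \<le> k * x" using \<delta>(2) k by (simp add: x_def g_def)
    ultimately have "k * \<delta> * g \<le> 2 * g" by (simp add: mult.assoc)
    then have "k * \<delta> \<le> 2" using g by simp
    then show ?thesis using \<delta>(1) by (simp add: k_def field_simps)
  qed
qed

text \<open>Index bound for a closed set of density \<delta> whose \<open>vdim\<close> can still
  grow \<open>k\<close> times: either the stabilizer has index at most \<open>2 / \<delta>\<close>,
  or the search goes on in an intersection of density \<open>\<delta>\<^sup>2 / 2\<close>.\<close>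

primrec coset_index :: "nat \<Rightarrow> real \<Rightarrow> real" where
  "coset_index 0 \<delta> = 2 / \<delta>"
| "coset_index (Suc k) \<delta> = max (2 / \<delta>) (coset_index k (\<delta>\<^sup>2 / 2))"

lemma coset_index_ge: "2 / \<delta> \<le> coset_index k \<delta>"
  by (cases k) auto

lemma vanishing_translate:
  assumes "f \<in> vanishing d X"  "b ** a = mat 1"
  shows "(\<lambda>x. f (b ** x)) \<in> vanishing d ((**) a ` X)"
  using assms poly_maps_translate[of f d b "mat 1"]
  by (auto simp: vanishing_def matrix_mul_assoc)

text \<open>Closedness without named equations: \<open>X\<close> is the zero set in \<open>G\<close>
  of all its own equations of degree at most \<open>d\<close>. Intersections and translates by
  \<open>G\<close> stay in this family. Unions in general need a higher degree, so a decomposition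
  into irreducible components is not at hand.\<close>

definition rel_closed :: "nat \<Rightarrow> ('a::field^'n^'n) set \<Rightarrow> ('a^'n^'n) set \<Rightarrow> bool" where
  "rel_closed d G X \<longleftrightarrow> X \<subseteq> G \<and> (\<forall>x\<in>G. (\<forall>f\<in>vanishing d X. f x = 0) \<longrightarrow> x \<in> X)"

lemma rel_closed_psubset_vdim:
  assumes "rel_closed d G Y" "Y \<subset> X" "X \<subseteq> G"
  shows "vdim d X < vdim d Y"
proof -
  obtain x where x: "x \<in> X" "x \<notin> Y" using assms(2) by blast
  then obtain f where "f \<in> vanishing d Y" "f x \<noteq> 0"
    using assms(1,3) unfolding rel_closed_def by blast
  then have "f \<notin> vanishing d X" "f \<in> vanishing d Y" using x by (auto simp: vanishing_def)
  then have "vanishing d X \<subset> vanishing d Y" using assms(2) vanishing_antimono[of Y X d] by blast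
  then show ?thesis by (rule vdim_psubset)
qed

text \<open>
  The first alternative holds with \<open>\<Gamma>\<close> the stabilizer of \<open>X\<close>, the second with \<open>Y\<close> the intersection of
  \<open>X\<close> and a distinct translate.
\<close>

lemma translates_dichotomy:
  fixes G :: "('a::field^'n^'n) set" and \<delta> :: real
  assumes G: "matrix_group G" and X: "rel_closed d G X"
    and \<delta>: "\<delta> > 0" "\<delta> * card G \<le> card X"
  shows "(\<exists>\<Gamma> x. matrix_group \<Gamma> \<and> \<Gamma> \<subseteq> G \<and> card G \<le> 2 / \<delta> * card \<Gamma> \<and> x \<in> X \<and> (\<forall>\<gamma>\<in>\<Gamma>. \<gamma> ** x \<in> X)) \<or>
    (\<exists>Y. Y \<subset> X \<and> rel_closed d G Y \<and> \<delta>\<^sup>2 / 2 * card G \<le> card Y)"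
proof -
  have XG: "X \<subseteq> G" using X by (simp add: rel_closed_def)
  have finG: "finite G" and posG: "card G > 0" by (rule mg_finite[OF G], rule mg_card_pos[OF G])
  have finX: "finite X" using XG finG finite_subset by blast
  define tr where "tr g = (**) g ` X" for g :: "'a^'n^'n"
  have card_tr: "card (tr g) = card X" if "g \<in> G" for g
    unfolding tr_def by (rule card_image[OF mg_inj_left[OF G that]])
  have trG: "tr g \<subseteq> G" if "g \<in> G" for g using that XG mg_mult[OF G] by (auto simp: tr_def)
  show ?thesis
  proof (cases "\<exists>g\<in>G. tr g \<noteq> X \<and> \<delta>\<^sup>2 / 2 * card G \<le> card (X \<inter> tr g)")
    case True
    then obtain g where g: "g \<in> G" "tr g \<noteq> X" "\<delta>\<^sup>2 / 2 * card G \<le> card (X \<inter> tr g)" by blast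
    have "X \<inter> tr g \<noteq> X"
    proof
      assume "X \<inter> tr g = X"
      then have "X \<subseteq> tr g" by blast
      moreover have "finite (tr g)" using finX by (simp add: tr_def)
      ultimately have "X = tr g" by (intro card_subset_eq) (simp_all only: card_tr[OF g(1)])
      then show False using g(2) by blast
    qed
    moreover have "rel_closed d G (X \<inter> tr g)"
      unfolding rel_closed_def
    proof (intro conjI ballI impI IntI)
      fix x assume x: "x \<in> G" "\<forall>f\<in>vanishing d (X \<inter> tr g). f x = 0"
      then show "x \<in> X"
        using X vanishing_antimono[of "X \<inter> tr g" X d] unfolding rel_closed_def by blast
      have "f (minv g ** x) = 0" if "f \<in> vanishing d X" for f
      proof -
        have "(\<lambda>x. f (minv g ** x)) \<in> vanishing d (X \<inter> tr g)"
          using vanishing_translate[OF that mg_left[OF G g(1)]]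
            vanishing_antimono[of "X \<inter> tr g" "tr g" d] unfolding tr_def by blast
        from bspec[OF x(2) this] show ?thesis .
      qed
      then have "minv g ** x \<in> X"
        using X x(1) mg_mult[OF G mg_inv[OF G g(1)]] unfolding rel_closed_def by blast
      then have "g ** (minv g ** x) \<in> tr g" unfolding tr_def by blast
      then show "x \<in> tr g" by (simp add: mg_inv_cancel[OF G g(1)])
    qed (use XG in auto)
    ultimately show ?thesis using g(3) by blast
  next
    case False
    define \<Gamma> where "\<Gamma> = {g\<in>G. tr g = X}"
    have tr_mult: "tr (g ** h) = (**) g ` tr h" for g h
      by (simp add: tr_def image_image matrix_mul_assoc)
    have tr1: "tr (mat 1) = X" by (simp add: tr_def)
    have \<Gamma>: "matrix_group \<Gamma>"
    proof (rule matrix_groupI[OF G])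
      fix x assume "x \<in> \<Gamma>"
      then have x: "x \<in> G" "tr x = X" by (auto simp: \<Gamma>_def)
      have "tr (minv x) = (**) (minv x) ` tr x" unfolding x(2) by (simp add: tr_def)
      also have "\<dots> = X" by (simp add: tr_mult[symmetric] mg_left[OF G x(1)] tr1)
      finally show "minv x \<in> \<Gamma>" using mg_inv[OF G x(1)] by (simp add: \<Gamma>_def)
    next
      fix x y assume "x \<in> \<Gamma>" "y \<in> \<Gamma>"
      then have xy: "x \<in> G" "tr x = X" "y \<in> G" "tr y = X" by (auto simp: \<Gamma>_def)
      have "tr (x ** y) = (**) x ` X" by (simp only: tr_mult xy(4))
      also have "\<dots> = X" using xy(2) by (simp only: tr_def)
      finally show "x ** y \<in> \<Gamma>" using mg_mult[OF G xy(1,3)] by (simp only: \<Gamma>_def mem_Collect_eq)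
    qed (auto simp: \<Gamma>_def tr1 mg_one[OF G])
    have tr_inter: "card (tr g \<inter> tr h) = card (X \<inter> tr (minv g ** h))" if "g \<in> G" "h \<in> G" for g h
    proof -
      have "(**) g ` (X \<inter> tr (minv g ** h)) = tr g \<inter> (**) g ` (tr (minv g ** h))"
        by (simp only: image_Int[OF mg_inj_left[OF G that(1)]] tr_def)
      also have "(**) g ` (tr (minv g ** h)) = tr h"
        by (simp only: tr_mult[symmetric] mg_inv_cancel[OF G that(1)])
      finally show ?thesis
        using card_image[OF mg_inj_left[OF G that(1)], of "X \<inter> tr (minv g ** h)"] by simp
    qed
    \<comment> \<open>Translation by \<open>minv g\<close> turns any overlap of two translates into
      an overlap with \<open>X\<close>, which is small in this case. So there are few translates,
      and their number bounds the index of the stabilizer.\<close>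
    have "card (tr ` G) \<le> 2 / \<delta>"
    proof (rule card_overlapping_family[OF finG _ _ _ \<delta>])
      fix A B assume AB: "A \<in> tr ` G" "B \<in> tr ` G" "A \<noteq> B"
      then obtain g h where gh: "g \<in> G" "h \<in> G" "A = tr g" "B = tr h" by blast
      have "tr (minv g ** h) \<noteq> X"
      proof
        assume "tr (minv g ** h) = X"
        then have "(**) g ` tr (minv g ** h) = tr g" by (simp add: tr_def)
        then have "tr h = tr g" by (simp only: tr_mult[symmetric] mg_inv_cancel[OF G gh(1)])
        then show False using AB(3) gh by simp
      qed
      then have "\<not> \<delta>\<^sup>2 / 2 * card G \<le> card (X \<inter> tr (minv g ** h))"
        using False gh mg_mult[OF G] mg_inv[OF G] by blast
      then show "card (A \<inter> B) \<le> \<delta>\<^sup>2 / 2 * card G" using tr_inter[OF gh(1,2)] gh by simp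
    qed (use posG trG card_tr in auto)
    moreover have "card G \<le> card (tr ` G) * card \<Gamma>"
    proof (rule card_le_index_mult[OF G])
      fix g h assume gh: "g \<in> G" "h \<in> G" "tr g = tr h"
      then have "tr (minv g ** h) = tr (minv g ** g)" by (simp add: tr_mult)
      then show "minv g ** h \<in> \<Gamma>"
        using gh mg_mult[OF G] mg_inv[OF G] by (simp add: \<Gamma>_def mg_left[OF G] tr1)
    qed (rule mg_finite[OF \<Gamma>])
    ultimately have "real (card G) \<le> 2 / \<delta> * card \<Gamma>"
      by (metis (no_types, opaque_lifting) mult_right_mono of_nat_0_le_iff of_nat_le_iff of_nat_mult order_trans)
    moreover obtain x where "x \<in> X"
    proof -
      have "0 < \<delta> * card G" using \<delta> posG by simp
      then have "card X > 0" using \<delta>(2) by linarith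
      then show thesis using that by (metis all_not_in_conv card.empty less_irrefl)
    qed
    moreover have "\<gamma> ** x \<in> X" if "\<gamma> \<in> \<Gamma>" "x \<in> X" for \<gamma> x using that by (auto simp: \<Gamma>_def tr_def)
    ultimately show ?thesis using \<Gamma> by (auto simp: \<Gamma>_def)
  qed
qed

text \<open>Induction on the number \<open>k\<close> of increases of \<open>vdim\<close> that the
  uniform bound still permits: each pass to a smaller closed set uses up one of them and replaces
  \<delta> by \<open>\<delta>\<^sup>2 / 2\<close>.\<close>

lemma dense_closed_contains_coset:
  fixes G :: "('a::field^'n^'n) set" and \<delta> :: real
  assumes G: "matrix_group G"
    and "rel_closed d G X" "\<delta> > 0" "\<delta> * card G \<le> card X" "(CARD('n)^2 + 1)^d \<le> vdim d X + k"
  shows "\<exists>\<Gamma> x. matrix_group \<Gamma> \<and> \<Gamma> \<subseteq> G \<and> card G \<le> coset_index k \<delta> * card \<Gamma> \<and> x \<in> X \<and>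
    (\<forall>\<gamma>\<in>\<Gamma>. \<gamma> ** x \<in> X)"
  using assms(2-)
proof (induction k arbitrary: X \<delta>)
  case (0 X \<delta>)
  \<comment> \<open>With \<open>k = 0\<close> the value \<open>vdim d X\<close> is already maximal,
    so the descending alternative is impossible.\<close>
  have "\<not> (\<exists>Y. Y \<subset> X \<and> rel_closed d G Y \<and> \<delta>\<^sup>2 / 2 * card G \<le> card Y)"
  proof
    assume "\<exists>Y. Y \<subset> X \<and> rel_closed d G Y \<and> \<delta>\<^sup>2 / 2 * card G \<le> card Y"
    then obtain Y where "Y \<subset> X" "rel_closed d G Y" by blast
    then have "vdim d X < vdim d Y" using 0(1) rel_closed_psubset_vdim unfolding rel_closed_def by blast
    then show False using 0(4) vdim_le[of d Y] by simp
  qed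
  then show ?case using translates_dichotomy[OF G 0(1-3)] unfolding coset_index.simps by blast
next
  case (Suc k X \<delta>)
  from translates_dichotomy[OF G Suc.prems(1-3)] show ?case
  proof (elim disjE exE conjE)
    fix \<Gamma> x assume *: "matrix_group \<Gamma>" "\<Gamma> \<subseteq> G" "card G \<le> 2 / \<delta> * card \<Gamma>" "x \<in> X" "\<forall>\<gamma>\<in>\<Gamma>. \<gamma> ** x \<in> X"
    have "2 / \<delta> * card \<Gamma> \<le> coset_index (Suc k) \<delta> * card \<Gamma>"
      by (intro mult_right_mono coset_index_ge) simp
    then show ?thesis using * by (meson order_trans)
  next
    fix Y assume Y: "Y \<subset> X" "rel_closed d G Y" "\<delta>\<^sup>2 / 2 * card G \<le> card Y"
    have "vdim d X < vdim d Y"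
      using Y Suc.prems(1) rel_closed_psubset_vdim unfolding rel_closed_def by blast
    then have "(CARD('n)^2 + 1)^d \<le> vdim d Y + k" using Suc.prems(4) by simp
    from Suc.IH[OF Y(2) _ Y(3) this] obtain \<Gamma> x where *: "matrix_group \<Gamma>" "\<Gamma> \<subseteq> G"
      "card G \<le> coset_index k (\<delta>\<^sup>2 / 2) * card \<Gamma>" "x \<in> Y" "\<forall>\<gamma>\<in>\<Gamma>. \<gamma> ** x \<in> Y"
      using Suc.prems(2) by (auto simp: )
    have "coset_index k (\<delta>\<^sup>2 / 2) * card \<Gamma> \<le> coset_index (Suc k) \<delta> * card \<Gamma>"
      by (intro mult_right_mono) simp_all
    then show ?thesis using * Y(1) by (meson order_trans psubsetD)
  qed
qed

text \<open>A Zariski connected group has no proper closed subgroup of finite index. The finite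
  analogue: subgroups of index at most \<open>m\<close> are not separated from \<open>N\<close> by
  equations of degree at most \<open>d\<close>.\<close>

definition connected_level :: "nat \<Rightarrow> nat \<Rightarrow> ('a::field^'n^'n) set \<Rightarrow> bool" where
  "connected_level d m N \<longleftrightarrow>
     (\<forall>\<Gamma>. matrix_group \<Gamma> \<and> \<Gamma> \<subseteq> N \<and> card N \<le> m * card \<Gamma> \<longrightarrow> vdim d \<Gamma> = vdim d N)"

text \<open>Starting from index \<open>b\<close>, a subgroup of index at most \<open>m\<close> has
  index at most \<open>b * m\<close> in the whole group, and its core at most
  \<open>fact (b * m)\<close>. The \<open>max\<close> allows for stopping early; \<open>k\<close>
  counts the possible rounds.\<close>

primrec core_index :: "nat \<Rightarrow> nat \<Rightarrow> nat \<Rightarrow> nat" where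
  "core_index 0 m b = b"
| "core_index (Suc k) m b = max b (core_index k m (fact (b * m)))"

lemma core_index_ge: "b \<le> core_index k m b"
  by (cases k) auto

text \<open>While some subgroup of index at most \<open>m\<close> satisfies more equations, it is
  replaced by its core in \<open>G\<close>. Passing to the core cannot lower \<open>vdim\<close>, so
  each round raises it strictly and at most \<open>k\<close> rounds occur.\<close>

lemma connected_normal_subgroup_aux:
  fixes G :: "('a::field^'n^'n) set"
  assumes G: "matrix_group G"
    and "matrix_group \<Gamma>" "\<Gamma> \<subseteq> G" "\<And>g x. g \<in> G \<Longrightarrow> x \<in> \<Gamma> \<Longrightarrow> g ** x ** minv g \<in> \<Gamma>"
      "card G \<le> b * card \<Gamma>" "(CARD('n)^2 + 1)^d \<le> vdim d \<Gamma> + k"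
  shows "\<exists>N. matrix_group N \<and> N \<subseteq> G \<and> (\<forall>g\<in>G. \<forall>x\<in>N. g ** x ** minv g \<in> N) \<and>
    card G \<le> core_index k m b * card N \<and> connected_level d m N"
  using assms(2-)
proof (induction k arbitrary: \<Gamma> b)
  case (0 \<Gamma> b)
  have "connected_level d m \<Gamma>"
    unfolding connected_level_def
  proof (intro allI impI)
    fix \<Gamma>' assume "matrix_group \<Gamma>' \<and> \<Gamma>' \<subseteq> \<Gamma> \<and> card \<Gamma> \<le> m * card \<Gamma>'"
    then show "vdim d \<Gamma>' = vdim d \<Gamma>"
      using vdim_antimono[of \<Gamma>' \<Gamma> d] vdim_le[of d \<Gamma>'] 0(5) by simp
  qed
  then show ?case using 0 by auto
next
  case (Suc k \<Gamma> b)
  show ?case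
  proof (cases "connected_level d m \<Gamma>")
    case True
    have "card G \<le> core_index (Suc k) m b * card \<Gamma>"
      using Suc.prems(4) core_index_ge[of b "Suc k" m] by (meson mult_le_mono1 order_trans)
    then show ?thesis using Suc.prems True by blast
  next
    case False
    then obtain \<Gamma>1 where \<Gamma>1: "matrix_group \<Gamma>1" "\<Gamma>1 \<subseteq> \<Gamma>" "card \<Gamma> \<le> m * card \<Gamma>1" "vdim d \<Gamma>1 \<noteq> vdim d \<Gamma>"
      by (auto simp: connected_level_def)
    have "card G \<le> (b * m) * card \<Gamma>1"
      using Suc.prems(4) \<Gamma>1(3) by (metis mult.assoc mult_le_mono2 order_trans)
    moreover have "\<Gamma>1 \<subseteq> G" using \<Gamma>1 Suc.prems by blast
    ultimately obtain N where N: "matrix_group N" "N \<subseteq> \<Gamma>1" "\<And>g x. g \<in> G \<Longrightarrow> x \<in> N \<Longrightarrow> g ** x ** minv g \<in> N"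
      "card G \<le> fact (b * m) * card N"
      using normal_core[OF G \<Gamma>1(1)] by metis
    have "vdim d \<Gamma> < vdim d \<Gamma>1" using \<Gamma>1(4) vdim_antimono[OF \<Gamma>1(2), of d] by simp
    also have "\<dots> \<le> vdim d N" by (rule vdim_antimono[OF N(2)])
    finally have "(CARD('n)^2 + 1)^d \<le> vdim d N + k" using Suc.prems(5) by simp
    from Suc.IH[OF N(1) _ N(3,4) this]
    obtain N' where N': "matrix_group N' \<and> N' \<subseteq> G \<and> (\<forall>g\<in>G. \<forall>x\<in>N'. g ** x ** minv g \<in> N') \<and>
      card G \<le> core_index k m (fact (b * m)) * card N' \<and> connected_level d m N'"
      using N(2) \<open>\<Gamma>1 \<subseteq> G\<close> by blast
    moreover have "core_index k m (fact (b * m)) * card N' \<le> core_index (Suc k) m b * card N'"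
      by (intro mult_right_mono) simp_all
    ultimately show ?thesis by (meson order_trans)
  qed
qed

lemma connected_normal_subgroup:
  fixes G :: "('a::field^'n^'n) set"
  assumes G: "matrix_group G"
  obtains N where "matrix_group N" "N \<subseteq> G" "\<And>g x. g \<in> G \<Longrightarrow> x \<in> N \<Longrightarrow> g ** x ** minv g \<in> N"
    "card G \<le> core_index ((CARD('n)^2 + 1)^d) m 1 * card N" "connected_level d m N"
  using connected_normal_subgroup_aux[OF G G, of 1 d "(CARD('n)^2 + 1)^d" m]
    mg_mult[OF G] mg_inv[OF G] by auto

text \<open>The zero set of \<open>S\<close> in \<open>N\<close> contains a coset of a subgroup of
  index at most \<open>m\<close>. Translation preserves \<open>vdim\<close>, so by
  \<open>connected_level\<close> this coset has as few equations as \<open>N\<close>. The zero set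
  lies in between and has no further equations either.\<close>

lemma connected_dense_vanishing:
  fixes N :: "('a::field^'n^'n) set" and \<delta> :: real
  assumes N: "matrix_group N" "connected_level d m N" and S: "S \<subseteq> poly_maps d"
    and \<delta>: "\<delta> > 0" "\<delta> * card N \<le> card {x\<in>N. \<forall>f\<in>S. f x = 0}"
    and m: "coset_index ((CARD('n)^2 + 1)^d) \<delta> \<le> m"
    and fx: "f \<in> S" "x \<in> N"
  shows "f x = 0"
proof -
  define X where "X = {x\<in>N. \<forall>f\<in>S. f x = 0}"
  have SX: "S \<subseteq> vanishing d X" using S by (auto simp: vanishing_def X_def)
  then have "rel_closed d N X" by (auto simp: rel_closed_def X_def)
  then obtain \<Gamma> y where \<Gamma>: "matrix_group \<Gamma>" "\<Gamma> \<subseteq> N"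
    "card N \<le> coset_index ((CARD('n)^2 + 1)^d) \<delta> * card \<Gamma>" "y \<in> X" "\<forall>\<gamma>\<in>\<Gamma>. \<gamma> ** y \<in> X"
    using dense_closed_contains_coset[OF N(1), of d X \<delta> "(CARD('n)^2 + 1)^d"] \<delta> by (auto simp: X_def)
  have "real (card N) \<le> real (m * card \<Gamma>)"
    using \<Gamma>(3) mult_right_mono[OF m, of "card \<Gamma>"] by simp
  then have "card N \<le> m * card \<Gamma>" by (simp only: of_nat_le_iff)
  then have "vdim d \<Gamma> = vdim d N" using N(2) \<Gamma>(1,2) by (simp add: connected_level_def)
  moreover have "vdim d ((\<lambda>x. mat 1 ** x ** y) ` \<Gamma>) = vdim d \<Gamma>"
    by (rule vdim_translate[of "mat 1" _ _ "minv y"])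
      (use \<Gamma>(4) mg_right[OF N(1)] in \<open>auto simp: X_def\<close>)
  moreover have "vdim d X \<le> vdim d ((\<lambda>x. mat 1 ** x ** y) ` \<Gamma>)"
    by (rule vdim_antimono) (use \<Gamma>(5) in auto)
  ultimately have "\<not> vdim d N < vdim d X" by simp
  then have "\<not> vanishing d N \<subset> vanishing d X" using vdim_psubset by blast
  moreover have "vanishing d N \<subseteq> vanishing d X" by (rule vanishing_antimono) (auto simp: X_def)
  ultimately have "f \<in> vanishing d N" using SX fx by blast
  then show ?thesis using fx by (simp add: vanishing_def)
qed

text \<open>Pigeonhole: one of the at most \<open>v\<close> values is taken with density at least
  \<open>1 / v\<close>. Subtracting it gives an equation that holds on a dense part, hence
  everywhere.\<close>

lemma connected_few_values_const:
  fixes N :: "('a::field^'n^'n) set"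
  assumes N: "matrix_group N" "connected_level d m N" and f: "f \<in> poly_maps d"
    and V: "finite V" "f ` N \<subseteq> V" "card V \<le> v" "v > 0"
    and m: "coset_index ((CARD('n)^2 + 1)^d) (1 / real v) \<le> m"
    and x: "x \<in> N"
  shows "f x = f (mat 1)"
proof -
  have fin: "finite N" by (rule mg_finite[OF N(1)])
  have "N = (\<Union>c\<in>V. {x\<in>N. f x = c})" using V(2) by auto
  then have "card N = card (\<Union>c\<in>V. {x\<in>N. f x = c})" by (rule arg_cong)
  also have "\<dots> \<le> (\<Sum>c\<in>V. card {x\<in>N. f x = c})" by (rule card_UN_le[OF V(1)])
  finally have le: "card N \<le> (\<Sum>c\<in>V. card {x\<in>N. f x = c})" .
  have "\<exists>c\<in>V. card N \<le> v * card {x\<in>N. f x = c}"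
  proof (rule ccontr)
    assume "\<not> ?thesis"
    then have small: "v * card {x\<in>N. f x = c} < card N" if "c \<in> V" for c using that by auto
    have "V \<noteq> {}" using V(2) x by blast
    have "v * card N \<le> (\<Sum>c\<in>V. v * card {x\<in>N. f x = c})"
      using le by (simp add: sum_distrib_left[symmetric])
    also have "\<dots> < (\<Sum>c\<in>V. card N)" by (rule sum_strict_mono[OF V(1) \<open>V \<noteq> {}\<close> small])
    also have "\<dots> \<le> v * card N" using V(3) by simp
    finally show False by simp
  qed
  then obtain c where c: "card N \<le> v * card {x\<in>N. f x = c}" by blast
  define h where "h x = f x - c" for x
  have h: "h \<in> poly_maps d" unfolding h_def by (intro poly_maps_diff f poly_maps_const)
  have "real (card N) \<le> v * real (card {x\<in>N. f x = c})" 
    using of_nat_mono[OF c, where 'a = real] by simp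
  then have "1 / real v * real (card N) \<le> card {x\<in>N. \<forall>k\<in>{h}. k x = 0}"
    using V(4) by (simp add: h_def field_simps)
  then have "h y = 0" if "y \<in> N" for y
    using connected_dense_vanishing[OF N, of "{h}" "1 / real v" h y] h V(4) m that by simp
  from this[OF x] this[OF mg_one[OF N(1)]] show ?thesis by (simp add: h_def)
qed

section \<open>Spans of matrix groups and simple submodules\<close>

lemma mat_mult_vec: "mat c *v v = c *s (v :: 'a::field^'n)"
  by (simp add: vec_eq_iff matrix_vector_mult_def mat_def if_distrib if_distribR cong: if_cong)

lemma mat_mult_component: "(mat c ** A) $ i $ j = c * (A :: 'a::field^'n^'n) $ i $ j"
  by (simp add: matrix_matrix_mult_def mat_def if_distrib if_distribR cong: if_cong)

lemma mat_mult_commute: "(A :: 'a::field^'n^'n) ** (mat c ** B) = mat c ** (A ** B)"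
  by (simp add: vec_eq_iff mat_mult_component)
    (simp add: matrix_matrix_mult_def mat_mult_component sum_distrib_left mult_ac mat_def if_distrib if_distribR cong: if_cong)

lemma mat_mult_assoc_vec: "(mat c ** A) *v v = c *s ((A :: 'a::field^'n^'n) *v v)"
  by (simp flip: matrix_vector_mul_assoc add: mat_mult_vec)

lemma matrix_vector_smult: "(A :: 'a::field^'n^'n) *v (c *s v) = c *s (A *v v)"
  by (rule vec.scale)

lemma mat_minus_one_mult: "mat (-1) ** A = - (A :: 'a::field^'n^'n)"
  by (simp add: vec_eq_iff mat_mult_component)

lemma matrix_mult_diff_left: "(A - B) ** C = A ** C - B ** (C :: 'a::field^'n^'n)"
  by (simp add: vec_eq_iff matrix_matrix_mult_def left_diff_distrib sum_subtractf)

lemma matrix_mult_diff_right: "C ** (A - B) = C ** A - C ** (B :: 'a::field^'n^'n)"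
  by (simp add: vec_eq_iff matrix_matrix_mult_def right_diff_distrib sum_subtractf)

lemma matrix_mult_add_left: "(A + B) ** C = A ** C + B ** (C :: 'a::field^'n^'n)"
  by (simp add: vec_eq_iff matrix_matrix_mult_def distrib_right sum.distrib)

text \<open>For a group this is the image of its group algebra. Scalars are encoded as scalar
  matrices, so that matrix multiplication is the only product involved.\<close>

inductive_set mspan :: "('a::field^'n^'n) set \<Rightarrow> ('a^'n^'n) set" for S where
  mspan_zero: "0 \<in> mspan S"
| mspan_base: "A \<in> S \<Longrightarrow> A \<in> mspan S"
| mspan_add: "A \<in> mspan S \<Longrightarrow> B \<in> mspan S \<Longrightarrow> A + B \<in> mspan S"
| mspan_scale: "A \<in> mspan S \<Longrightarrow> mat c ** A \<in> mspan S"

lemma mspan_diff: "A \<in> mspan S \<Longrightarrow> B \<in> mspan S \<Longrightarrow> A - B \<in> mspan S"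
  using mspan_add[OF _ mspan_scale[of B S "-1"]] by (simp add: mat_minus_one_mult)

lemma mspan_conj:
  fixes g h :: "'a::field^'n^'n"
  assumes "A \<in> mspan S" "\<And>s. s \<in> S \<Longrightarrow> g ** s ** h \<in> mspan T"
  shows "g ** A ** h \<in> mspan T"
  using assms(1)
proof induction
  case (mspan_add A B)
  then show ?case by (simp add: matrix_add_ldistrib matrix_mult_add_left mspan.mspan_add)
next
  case (mspan_scale A c)
  have "g ** (mat c ** A) ** h = mat c ** (g ** A ** h)"
    by (simp only: mat_mult_commute matrix_mul_assoc[symmetric])
  then show ?case using mspan.mspan_scale[OF mspan_scale.IH] by simp
qed (auto intro: mspan.intros assms(2))

lemma mspan_mult:
  assumes "A \<in> mspan S" "B \<in> mspan T" "\<And>s t. s \<in> S \<Longrightarrow> t \<in> T \<Longrightarrow> s ** t \<in> mspan U"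
  shows "A ** B \<in> mspan U"
proof -
  have "s ** B ** mat 1 \<in> mspan U" if "s \<in> S" for s
    by (rule mspan_conj[OF assms(2)]) (simp add: assms(3) that)
  then have "mat 1 ** A ** B \<in> mspan U"
    by (intro mspan_conj[OF assms(1)]) simp
  then show ?thesis by simp
qed

section \<open>Polynomials in a matrix, applied to a vector\<close>

definition papply :: "'a::field^'n^'n \<Rightarrow> 'a poly \<Rightarrow> 'a^'n \<Rightarrow> 'a^'n" where
  "papply T p = fold_coeffs (\<lambda>a f v. a *s v + f (T *v v)) p (\<lambda>_. 0)"

lemma papply_0: "papply T 0 v = 0"
  by (simp add: papply_def)

lemma papply_pCons: "papply T (pCons a p) v = a *s v + papply T p (T *v v)"
  by (cases "p = 0 \<and> a = 0") (auto simp: papply_def)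

lemma papply_add: "papply T (p + q) v = papply T p v + papply T q v"
  by (induction p q arbitrary: v rule: poly_induct2)
    (simp_all add: papply_0 papply_pCons vector_sadd_rdistrib)

lemma papply_smult: "papply T (smult c p) v = c *s papply T p v"
  by (induction p arbitrary: v) (simp_all add: papply_0 papply_pCons vector_add_ldistrib)

lemma papply_shift: "papply T p (T *v v) = T *v papply T p v"
  by (induction p arbitrary: v)
    (simp_all add: papply_0 papply_pCons matrix_vector_right_distrib matrix_vector_smult)

text \<open>If the left side is 0 while \<open>papply T p v\<close> is not, then
  \<open>papply T p v\<close> is an eigenvector with eigenvalue \<open>c\<close>.\<close>

lemma papply_linear_factor:
  "papply T ([:- c, 1:] * p) v = T *v papply T p v - c *s papply T p v"
proof -
  have "[:- c, 1:] * p = pCons 0 p + smult (- c) p" by simp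
  then show ?thesis
    by (simp only: papply_add papply_smult papply_pCons papply_shift) simp
qed

lemma papply_monom: "papply T (monom c k) v = c *s (((*v) T ^^ k) v)"
  by (induction k arbitrary: v)
    (simp_all add: monom_0 monom_Suc papply_pCons papply_0 funpow_swap1)

lemma papply_sum: "papply T (\<Sum>i\<in>I. p i) v = (\<Sum>i\<in>I. papply T (p i) v)"
  by (induction I rule: infinite_finite_induct) (simp_all add: papply_0 papply_add)

lemma papply_in_subspace:
  assumes "vec.subspace S" "\<And>v. v \<in> S \<Longrightarrow> T *v v \<in> S" "v \<in> S"
  shows "papply T p v \<in> S"
  using assms(3)
  by (induction p arbitrary: v)
    (auto simp: papply_0 papply_pCons vec.subspace_0[OF assms(1)]
      intro!: vec.subspace_add[OF assms(1)] vec.subspace_scale[OF assms(1)] assms(2))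

text \<open>The \<open>n + 1\<close> vectors \<open>v\<close>, \<open>T v\<close>, ...,
  \<open>T^n v\<close> cannot be independent in dimension \<open>n\<close>.\<close>

lemma exists_annihilating_poly:
  fixes T :: "'a::field^'n^'n"
  shows "\<exists>p. p \<noteq> 0 \<and> papply T p v = 0"
proof -
  define x where "x i = (((*v) T ^^ i) v)" for i :: nat
  show ?thesis
  \<comment> \<open>Dependence is a property of sets and does not notice a repeated vector; a
    repetition is handled separately by a difference of two monomials.\<close>
  proof (cases "inj_on x {..CARD('n)}")
    case False
    then obtain i j where ij: "i \<noteq> j" "x i = x j" by (auto simp: inj_on_def)
    define p where "p = monom (1::'a) i + smult (-1) (monom 1 j)"
    have "coeff p i = 1" using ij by (simp add: p_def)
    then have "p \<noteq> 0" by auto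
    moreover have "papply T p v = 0"
      using ij(2) by (simp add: p_def papply_add papply_smult papply_monom x_def del: smult_minus_left)
    ultimately show ?thesis by blast
  next
    case True
    let ?X = "x ` {..CARD('n)}"
    have "card ?X = Suc CARD('n)" by (simp add: card_image[OF True])
    then have "vec.dependent ?X"
      using vec.independent_span_bound[OF finite_cart_basis, of ?X] card_cart_basis[where 'a='a and 'i='n]
      by (auto simp: )
    then obtain u y where u: "(\<Sum>w\<in>?X. u w *s w) = 0" "y \<in> ?X" "u y \<noteq> 0"
      using vec.dependent_finite[of ?X] by auto
    define p where "p = (\<Sum>i\<le>CARD('n). monom (u (x i)) i)"
    have "papply T p v = (\<Sum>i\<le>CARD('n). u (x i) *s x i)"
      by (simp add: p_def papply_sum papply_monom x_def)
    also have "\<dots> = (\<Sum>w\<in>?X. u w *s w)" by (simp add: sum.reindex[OF True])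
    finally have "papply T p v = 0" using u(1) by simp
    moreover obtain k where "k \<le> CARD('n)" "y = x k" using u(2) by auto
    then have "coeff p k \<noteq> 0" using u(3) by (simp add: p_def coeff_sum coeff_monom)
    then have "p \<noteq> 0" by auto
    ultimately show ?thesis by blast
  qed
qed

text \<open>Induction on the degree of a polynomial annihilating \<open>v\<close>: after a root is
  split off, either the cofactor still annihilates \<open>v\<close>, or its value at
  \<open>v\<close> is an eigenvector, which lies in \<open>S\<close> because \<open>S\<close> is
  stable under \<open>T\<close>.\<close>

lemma eigenvector_in_subspace:
  fixes T :: "'a::alg_closed_field^'n^'n"
  assumes S: "vec.subspace S" "\<And>v. v \<in> S \<Longrightarrow> T *v v \<in> S" and v: "v \<in> S" "v \<noteq> 0"
  obtains w c where "w \<in> S" "w \<noteq> 0" "T *v w = c *s w"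
proof -
  have "\<exists>w c. w \<in> S \<and> w \<noteq> 0 \<and> T *v w = c *s w" if "p \<noteq> 0" "papply T p v = 0" for p
    using that
  proof (induction "degree p" arbitrary: p)
    case 0
    then obtain a where "p = [:a:]" using degree_eq_zeroE by metis
    then show ?case using 0 v by (simp add: papply_pCons papply_0)
  next
    case (Suc d)
    then obtain c where "poly p c = 0" using alg_closed_imp_poly_has_root[of p] by auto
    then obtain q where q: "p = [:- c, 1:] * q" by (auto simp: poly_eq_0_iff_dvd elim: dvdE)
    then have "q \<noteq> 0" using Suc.prems by auto
    have "degree p = degree [:- c, 1:] + degree q"
      unfolding q by (rule degree_mult_eq) (use \<open>q \<noteq> 0\<close> in simp_all)
    then have "degree q = d" using Suc.hyps(2) by simp
    show ?case
    proof (cases "papply T q v = 0")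
      case True
      then show ?thesis using Suc.hyps(1)[of q] \<open>degree q = d\<close> \<open>q \<noteq> 0\<close> by blast
    next
      case False
      moreover have "T *v papply T q v = c *s papply T q v"
        using Suc.prems(2) unfolding q papply_linear_factor by simp
      ultimately show ?thesis using papply_in_subspace[OF S v(1)] by blast
    qed
  qed
  then show thesis using exists_annihilating_poly[of T v] that by blast
qed

text \<open>Extend \<open>s\<close> to a basis of \<open>S\<close>; the image is spanned by the
  images of the other basis vectors.\<close>

lemma dim_image_less:
  fixes f :: "'a::field^'n \<Rightarrow> 'a^'n"
  assumes f: "Vector_Spaces.linear (*s) (*s) f" and "s \<in> S" "s \<noteq> 0" "f s = 0"
  shows "vec.dim (f ` S) < vec.dim S"
proof -
  interpret f: Vector_Spaces.linear "(*s)" "(*s)" f by (rule f)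
  obtain B where B: "{s} \<subseteq> B" "B \<subseteq> S" "vec.independent B" "S \<subseteq> vec.span B"
    using vec.maximal_independent_subset_extend[of "{s}" S] assms(2,3) by auto
  have finB: "finite B" using vec.finiteI_independent[OF B(3)] .
  have "f ` S \<subseteq> vec.span (f ` (B - {s}))"
  proof -
    have "f ` S \<subseteq> vec.span (f ` B)" using B(4) by (metis f.span_image image_mono)
    also have "f ` B = insert 0 (f ` (B - {s}))" using B(1) assms(4) by auto
    finally show ?thesis by simp
  qed
  then have "vec.dim (f ` S) \<le> card (f ` (B - {s}))"
    using vec.dim_le_card finB by blast
  also have "\<dots> \<le> card (B - {s})" by (rule card_image_le) (simp add: finB)
  also have "\<dots> < card B" using B(1) finB by (intro psubset_card_mono) auto
  also have "\<dots> = vec.dim S" by (rule vec.basis_card_eq_dim[OF B(2,4,3)])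
  finally show ?thesis .
qed

section \<open>Submodules and annihilators\<close>

definition submod :: "('a::field^'n^'n) set \<Rightarrow> ('a^'n) set \<Rightarrow> bool" where
  "submod G W \<longleftrightarrow> vec.subspace W \<and> (\<forall>g\<in>G. \<forall>w\<in>W. g *v w \<in> W)"

definition simple_submod :: "('a::field^'n^'n) set \<Rightarrow> ('a^'n) set \<Rightarrow> bool" where
  "simple_submod G W \<longleftrightarrow> submod G W \<and> W \<noteq> {0} \<and> (\<forall>U. submod G U \<and> U \<subseteq> W \<longrightarrow> U = {0} \<or> U = W)"

text \<open>Annihilators serve as names of isomorphism types: for a finite group, two simple
  submodules are isomorphic exactly when their annihilators agree. This avoids module homomorphisms,
  and a normalizing element acts on annihilators by conjugation.\<close>

definition ann :: "('a::field^'n^'n) set \<Rightarrow> ('a^'n) set \<Rightarrow> ('a^'n^'n) set" where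
  "ann G X = {a \<in> mspan G. \<forall>x\<in>X. a *v x = 0}"

lemma submod_mspan:
  assumes "submod G W" "a \<in> mspan G" "w \<in> W"
  shows "a *v w \<in> W"
  using assms(2)
proof induction
  case (mspan_base A)
  then show ?case using assms by (auto simp: submod_def)
qed (use assms in \<open>auto simp: submod_def matrix_vector_mult_add_rdistrib mat_mult_assoc_vec
      vec.subspace_0 vec.subspace_add vec.subspace_scale\<close>)

lemma contains_simple_submod:
  assumes "submod G U" "U \<noteq> {0}"
  obtains X where "simple_submod G X" "X \<subseteq> U"
proof -
  let ?P = "\<lambda>X. submod G X \<and> X \<noteq> {0} \<and> X \<subseteq> U"
  obtain X where X: "?P X" "\<And>Y. ?P Y \<Longrightarrow> vec.dim X \<le> vec.dim Y"
    using ex_has_least_nat[of ?P U vec.dim] assms by blast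
  have "simple_submod G X"
    unfolding simple_submod_def
  proof (intro conjI allI impI)
    fix Y assume Y: "submod G Y \<and> Y \<subseteq> X"
    show "Y = {0} \<or> Y = X"
    proof (rule disjCI)
      assume "Y \<noteq> X"
      show "Y = {0}"
      proof (rule ccontr)
        assume "Y \<noteq> {0}"
        then have "vec.dim X \<le> vec.dim Y" using X Y by blast
        then have "Y = X"
          using vec.subspace_dim_equal[of Y X] X(1) Y by (auto simp: submod_def)
        then show False using \<open>Y \<noteq> X\<close> by simp
      qed
    qed
  qed (use X in auto)
  then show thesis using that X(1) by blast
qed

context
  fixes \<Gamma> :: "('a::field^'n^'n) set"
  assumes \<Gamma>: "matrix_group \<Gamma>"
begin

lemma mspan_group_one: "mat 1 \<in> mspan \<Gamma>"
  by (rule mspan_base[OF mg_one[OF \<Gamma>]])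

lemma mspan_group_mult: "a \<in> mspan \<Gamma> \<Longrightarrow> b \<in> mspan \<Gamma> \<Longrightarrow> a ** b \<in> mspan \<Gamma>"
  by (rule mspan_mult) (auto intro: mspan_base mg_mult[OF \<Gamma>])

lemma submod_orbit: "submod \<Gamma> {a *v v | a. a \<in> mspan \<Gamma>}"
  unfolding submod_def vec.subspace_def
proof (intro conjI ballI allI)
  show "0 \<in> {a *v v | a. a \<in> mspan \<Gamma>}" using mspan_zero[of \<Gamma>] by (force intro: exI[of _ 0])
next
  fix x y assume "x \<in> {a *v v | a. a \<in> mspan \<Gamma>}" "y \<in> {a *v v | a. a \<in> mspan \<Gamma>}"
  then obtain a b where "a \<in> mspan \<Gamma>" "b \<in> mspan \<Gamma>" "x + y = (a + b) *v v"
    by (auto simp: matrix_vector_mult_add_rdistrib)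
  then show "x + y \<in> {a *v v | a. a \<in> mspan \<Gamma>}" using mspan_add by blast
next
  fix c x assume "x \<in> {a *v v | a. a \<in> mspan \<Gamma>}"
  then obtain a where "a \<in> mspan \<Gamma>" "c *s x = (mat c ** a) *v v" by (auto simp: mat_mult_assoc_vec)
  then show "c *s x \<in> {a *v v | a. a \<in> mspan \<Gamma>}" using mspan_scale by blast
next
  fix g x assume "g \<in> \<Gamma>" "x \<in> {a *v v | a. a \<in> mspan \<Gamma>}"
  then obtain a where "a \<in> mspan \<Gamma>" "g *v x = (g ** a) *v v" by (auto simp: matrix_vector_mul_assoc)
  then show "g *v x \<in> {a *v v | a. a \<in> mspan \<Gamma>}"
    using mspan_group_mult mspan_base[OF \<open>g \<in> \<Gamma>\<close>] by blast
qed

text \<open>The vectors reached from \<open>w\<close> form a nonzero submodule of the simple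
  \<open>X\<close>.\<close>

lemma simple_submod_transitive:
  assumes X: "simple_submod \<Gamma> X" and "w \<in> X" "w \<noteq> 0" "x \<in> X"
  obtains a where "a \<in> mspan \<Gamma>" "a *v w = x"
proof -
  let ?U = "{a *v w | a. a \<in> mspan \<Gamma>}"
  have "?U \<subseteq> X" using submod_mspan X assms(2) by (auto simp: simple_submod_def)
  moreover have "w \<in> ?U" using mspan_group_one by (force intro: exI[of _ "mat 1"])
  ultimately have "?U = X" using X submod_orbit[of w] assms(3) unfolding simple_submod_def by blast
  then show thesis using that assms(4) by blast
qed

end

text \<open>
  The argument of Halperin and Rosenthal for Burnside's theorem: in an element \<open>y\<close> of minimal rank, an
  eigenvalue \<open>c\<close> of \<open>y a\<close> on the image of \<open>y\<close> gives \<open>y a y - c y\<close> of smaller rank.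
\<close>

lemma rank_one_element:
  fixes \<Gamma> :: "('a::alg_closed_field^'n^'n) set"
  assumes \<Gamma>: "matrix_group \<Gamma>" and X: "simple_submod \<Gamma> X"
    and I: "I \<subseteq> mspan \<Gamma>" "\<And>a b. a \<in> I \<Longrightarrow> b \<in> I \<Longrightarrow> a - b \<in> I"
      "\<And>a c. a \<in> I \<Longrightarrow> mat c ** a \<in> I"
      "\<And>a b. a \<in> mspan \<Gamma> \<Longrightarrow> b \<in> I \<Longrightarrow> a ** b \<in> I" "\<And>a b. a \<in> mspan \<Gamma> \<Longrightarrow> b \<in> I \<Longrightarrow> b ** a \<in> I"
    and "y0 \<in> I" "x0 \<in> X" "y0 *v x0 \<noteq> 0"
  obtains e w where "e \<in> I" "w \<in> X" "w \<noteq> 0" "e *v w = w" "\<And>x. x \<in> X \<Longrightarrow> \<exists>c. e *v x = c *s w"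
proof -
  have Xs: "submod \<Gamma> X" "vec.subspace X" using X by (auto simp: simple_submod_def submod_def)
  let ?P = "\<lambda>y. y \<in> I \<and> (\<exists>x\<in>X. y *v x \<noteq> 0)"
  obtain y where y: "?P y" "\<And>z. ?P z \<Longrightarrow> vec.dim ((*v) y ` X) \<le> vec.dim ((*v) z ` X)"
    using ex_has_least_nat[of ?P y0 "\<lambda>y. vec.dim ((*v) y ` X)"] assms(8-) by blast
  then obtain v where v: "v \<in> X" "y *v v \<noteq> 0" by blast
  let ?S = "(*v) y ` X"
  have yA: "y \<in> mspan \<Gamma>" using y I by blast
  have SX: "?S \<subseteq> X" using submod_mspan[OF Xs(1) yA] by blast
  have S: "vec.subspace ?S" by (rule vec.subspace_image[OF Xs(2)])
  have one: "\<exists>c. y *v x = c *s (y *v v)" if x: "x \<in> X" for x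
  proof (rule ccontr)
    assume no: "\<not> ?thesis"
    obtain a where a: "a \<in> mspan \<Gamma>" "a *v (y *v v) = x"
      using simple_submod_transitive[OF \<Gamma> X _ v(2) x] SX v(1) by blast
    have "(y ** a) *v s \<in> ?S" if "s \<in> ?S" for s
      using that SX submod_mspan[OF Xs(1) a(1)] by (auto simp flip: matrix_vector_mul_assoc)
    then obtain s c where s: "s \<in> ?S" "s \<noteq> 0" "(y ** a) *v s = c *s s"
      using eigenvector_in_subspace[OF S, of "y ** a" "y *v v"] v by blast
    define z where "z = y ** a ** y - mat c ** y"
    have "z \<in> I" unfolding z_def using I y(1) a yA by (metis mspan_group_mult[OF \<Gamma>])
    moreover have "z *v v \<noteq> 0"
    proof
      assume "z *v v = 0"
      then have "y *v x = c *s (y *v v)"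
        by (simp add: z_def matrix_vector_mult_diff_rdistrib mat_mult_vec a(2)
            flip: matrix_vector_mul_assoc)
      then show False using no by blast
    qed
    ultimately have "vec.dim ?S \<le> vec.dim ((*v) z ` X)" using y(2) v(1) by blast
    moreover have "(*v) z ` X = (*v) (y ** a - mat c) ` ?S"
      by (simp add: image_image z_def matrix_vector_mul_assoc matrix_mult_diff_left)
    moreover have "vec.dim ((*v) (y ** a - mat c) ` ?S) < vec.dim ?S"
      by (rule dim_image_less[OF _ s(1,2)])
        (simp_all add: matrix_vector_mult_diff_rdistrib mat_mult_vec s(3) matrix_vector_mul_linear_gen)
    ultimately show False by simp
  qed
  \<comment> \<open>Carrying \<open>y *v v\<close> back to \<open>v\<close> normalizes the rank one
    element so that it fixes the vector spanning its image.\<close>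
  obtain a where a: "a \<in> mspan \<Gamma>" "a *v (y *v v) = v"
    using simple_submod_transitive[OF \<Gamma> X _ v(2,1)] SX v(1) by blast
  show thesis
  proof (rule that[of "a ** y" v])
    show "a ** y \<in> I" using I(4) a(1) y(1) by blast
    show "v \<noteq> 0" using v(2) by auto
    show "(a ** y) *v v = v" using a(2) by (simp flip: matrix_vector_mul_assoc)
    show "\<exists>c. (a ** y) *v x = c *s v" if "x \<in> X" for x
    proof -
      obtain c where "y *v x = c *s (y *v v)" using one \<open>x \<in> X\<close> by blast
      then show ?thesis using a(2) by (auto simp: matrix_vector_smult simp flip: matrix_vector_mul_assoc)
    qed
  qed (rule v(1))
qed

section \<open>Twisted simple submodules\<close>

lemma annD: "a \<in> ann G X \<Longrightarrow> x \<in> X \<Longrightarrow> a *v x = 0"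
  by (simp add: ann_def)

text \<open>
  Take \<open>e\<close> in the span of \<open>\<Gamma>\<close> acting on \<open>X\<close> as an idempotent of rank one, and elements
  \<open>s\<close>, \<open>t\<close> that move the line of \<open>e\<close> to the line of \<open>e' = g e g\<^sup>-\<^sup>1\<close> and back. Then
  \<open>t g\<close> preserves the space of vectors fixed by \<open>e\<close> and killed by the annihilator of \<open>X\<close>, and an
  eigenvector of it generates \<open>W\<close>.
\<close>

lemma simple_submod_stable:
  fixes \<Gamma> :: "('a::alg_closed_field^'n^'n) set"
  assumes \<Gamma>: "matrix_group \<Gamma>" and X: "simple_submod \<Gamma> X"
    and g: "h ** g = mat 1" "\<And>\<gamma>. \<gamma> \<in> \<Gamma> \<Longrightarrow> g ** \<gamma> ** h \<in> \<Gamma>" "\<And>\<gamma>. \<gamma> \<in> \<Gamma> \<Longrightarrow> h ** \<gamma> ** g \<in> \<Gamma>"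
    and annX: "\<And>a. a \<in> ann \<Gamma> X \<Longrightarrow> g ** a ** h \<in> ann \<Gamma> X" "\<And>a. a \<in> ann \<Gamma> X \<Longrightarrow> h ** a ** g \<in> ann \<Gamma> X"
  obtains W where "simple_submod \<Gamma> W" "\<And>w. w \<in> W \<Longrightarrow> g *v w \<in> W"
    "ann \<Gamma> W \<subseteq> ann \<Gamma> X"
proof -
  let ?A = "mspan \<Gamma>"
  let ?I = "ann \<Gamma> X"
  note mult = mspan_group_mult[OF \<Gamma>]
  have gh: "g ** h = mat 1" using g(1) matrix_left_right_inverse by blast
  have conj: "g ** a ** h \<in> ?A" "h ** a ** g \<in> ?A" if "a \<in> ?A" for a
    by (intro mspan_conj[OF that] mspan_base g; assumption)+
  have Xs: "submod \<Gamma> X" using X by (auto simp: simple_submod_def)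
  have inX: "a *v x \<in> X" if "a \<in> ?A" "x \<in> X" for a x using submod_mspan[OF Xs that] .
  note vsimps = matrix_vector_mult_diff_rdistrib mat_mult_vec matrix_vector_smult matrix_vector_mul_assoc[symmetric]
  have "X \<noteq> {0}" "0 \<in> X" using X by (auto simp: simple_submod_def submod_def vec.subspace_0)
  then obtain x1 where x1: "x1 \<in> X" "x1 \<noteq> 0" by blast
  obtain e w where e: "e \<in> ?A" "w \<in> X" "w \<noteq> 0" "e *v w = w" "\<And>x. x \<in> X \<Longrightarrow> \<exists>c. e *v x = c *s w"
  proof (rule rank_one_element[OF \<Gamma> X, of ?A "mat 1" x1])
    show "mat 1 *v x1 \<noteq> 0" using x1 by simp
  qed (use x1 mspan_diff mspan_scale mult mspan_group_one[OF \<Gamma>] in auto)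
  define e' where "e' = g ** e ** h"
  have e'A: "e' \<in> ?A" unfolding e'_def by (rule conj[OF e(1)])
  have eg: "e' ** g = g ** e" by (simp add: e'_def g(1) flip: matrix_mul_assoc)
  \<comment> \<open>\<open>e\<close> is idempotent only as an operator on \<open>X\<close>; as a
    matrix it is so modulo the annihilator of \<open>X\<close>. All relations below are therefore
    memberships in \<open>?I\<close>.\<close>
  have ee: "e ** e - e \<in> ?I"
  proof -
    have "(e ** e - e) *v x = 0" if x: "x \<in> X" for x
      using e(5)[OF x] e(4) by (auto simp: vsimps)
    then show ?thesis by (auto simp: ann_def intro!: mspan_diff mspan_scale mult e(1))
  qed
  have e'e': "e' ** e' - e' \<in> ?I"
  proof -
    have "e' ** e' = g ** e ** (h ** g) ** e ** h" by (simp only: e'_def matrix_mul_assoc)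
    then have "e' ** e' - e' = g ** (e ** e - e) ** h"
      by (simp add: g(1) e'_def matrix_mult_diff_left matrix_mult_diff_right matrix_mul_assoc)
    then show ?thesis using annX(1)[OF ee] by simp
  qed
  \<comment> \<open>This expresses rank one on \<open>X\<close> by a relation inside the algebra. In
    this form it survives conjugation by \<open>g\<close> and yields rank one for
    \<open>e'\<close>.\<close>
  have exe: "\<exists>c. e ** a ** e - mat c ** e \<in> ?I" if a: "a \<in> ?A" for a
  proof -
    obtain c where c: "e *v (a *v w) = c *s w" using e(5)[OF inX[OF a e(2)]] by blast
    have "(e ** a ** e - mat c ** e) *v x = 0" if x: "x \<in> X" for x
      using e(5)[OF x] e(4) c by (auto simp: vsimps mult.commute)
    then have "e ** a ** e - mat c ** e \<in> ?I"
      by (auto simp: ann_def intro!: mspan_diff mspan_scale mult e(1) a)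
    then show ?thesis ..
  qed
  have e'xe': "\<exists>c. e' ** a ** e' - mat c ** e' \<in> ?I" if a: "a \<in> ?A" for a
  proof -
    obtain c where c: "e ** (h ** a ** g) ** e - mat c ** e \<in> ?I" using exe[OF conj(2)[OF a]] by blast
    have "e' ** a ** e' - mat c ** e' = g ** (e ** (h ** a ** g) ** e - mat c ** e) ** h"
      by (simp only: e'_def matrix_mult_diff_left matrix_mult_diff_right mat_mult_commute
          matrix_mul_assoc[symmetric])
    then show ?thesis using annX(1)[OF c] by metis
  qed
  have "e' \<notin> ?I"
  proof
    assume "e' \<in> ?I"
    then have "h ** e' ** g \<in> ?I" by (rule annX(2))
    moreover have "h ** e' ** g = (h ** g) ** e ** (h ** g)" by (simp only: e'_def matrix_mul_assoc)
    ultimately have "e \<in> ?I" by (simp add: g(1))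
    then show False using e by (auto simp: ann_def)
  qed
  then obtain x0 where x0: "x0 \<in> X" "e' *v x0 \<noteq> 0" using e'A by (auto simp: ann_def)
  define u where "u = e' *v x0"
  have u: "u \<in> X" "u \<noteq> 0" using x0 inX[OF e'A] by (auto simp: u_def)
  have "e' *v u - u = (e' ** e' - e') *v x0" by (simp add: u_def vsimps)
  then have e'u: "e' *v u = u" using annD[OF e'e' x0(1)] by simp
  have e'x: "\<exists>c. e' *v x = c *s u" if x: "x \<in> X" for x
  proof -
    obtain a where a: "a \<in> ?A" "a *v u = x" using simple_submod_transitive[OF \<Gamma> X u x] .
    obtain c where c: "e' ** a ** e' - mat c ** e' \<in> ?I" using e'xe'[OF a(1)] by blast
    have "e' *v x - c *s u = (e' ** a ** e' - mat c ** e') *v x0" by (simp add: u_def vsimps flip: a(2))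
    then show ?thesis using annD[OF c x0(1)] by auto
  qed
  obtain t where t: "t \<in> ?A" "t *v u = w" using simple_submod_transitive[OF \<Gamma> X u e(2)] .
  obtain s where s: "s \<in> ?A" "s *v w = u" using simple_submod_transitive[OF \<Gamma> X e(2,3) u(1)] .
  have ete': "e ** t ** e' - t ** e' \<in> ?I"
  proof -
    have "(e ** t ** e' - t ** e') *v x = 0" if x: "x \<in> X" for x
      using e'x[OF x] e(4) t(2) by (auto simp: vsimps)
    then show ?thesis by (auto simp: ann_def intro!: mspan_diff mspan_scale mult e(1) e'A t(1))
  qed
  have ste': "s ** t ** e' - e' \<in> ?I"
  proof -
    have "(s ** t ** e' - e') *v x = 0" if x: "x \<in> X" for x
      using e'x[OF x] t(2) s(2) by (auto simp: vsimps)
    then show ?thesis by (auto simp: ann_def intro!: mspan_diff mspan_scale mult s(1) e'A t(1))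
  qed
  \<comment> \<open>\<open>V\<close> is the isotypic part belonging to \<open>X\<close>. The span of
    \<Gamma> acts on it modulo \<open>?I\<close>, so the identities checked on \<open>X\<close> also
    hold on \<open>V\<close>; it is stable under \<open>g\<close> because conjugation preserves
    \<open>?I\<close>.\<close>
  define V where "V = {v. \<forall>a\<in>?I. a *v v = 0}"
  have Vg: "g *v v \<in> V" if "v \<in> V" for v
  proof -
    have "a *v (g *v v) = 0" if "a \<in> ?I" for a
    proof -
      have "a *v (g *v v) = g *v ((h ** a ** g) *v v)"
        by (simp add: matrix_vector_mul_assoc matrix_mul_assoc gh)
      then show ?thesis using annX(2)[OF that] \<open>v \<in> V\<close> by (simp add: V_def)
    qed
    then show ?thesis by (simp add: V_def)
  qed
  have Va: "a *v v \<in> V" if "a \<in> ?A" "v \<in> V" for a v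
  proof -
    have "b ** a \<in> ?I" if "b \<in> ?I" for b
      using that inX \<open>a \<in> ?A\<close> mult by (auto simp: ann_def simp flip: matrix_vector_mul_assoc)
    then show ?thesis using that(2) by (auto simp: V_def matrix_vector_mul_assoc)
  qed
  \<comment> \<open>The image of \<open>e\<close> on \<open>V\<close>, a model of the multiplicity
    space of \<open>X\<close>: an eigenvector of \<open>t ** g\<close> in it singles out one copy of
    \<open>X\<close>.\<close>
  define S where "S = {v\<in>V. e *v v = v}"
  have S: "vec.subspace S"
    unfolding vec.subspace_def S_def V_def by (simp add: matrix_vector_right_distrib matrix_vector_smult)
  have VD: "a *v v = b *v v" if "a - b \<in> ?I" "v \<in> V" for a b v
    using that by (auto simp: V_def matrix_vector_mult_diff_rdistrib)
  have gS: "e' *v (g *v v) = g *v v" if "v \<in> S" for v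
    using that eg by (simp add: S_def matrix_vector_mul_assoc) (simp flip: matrix_vector_mul_assoc)
  have "(t ** g) *v v \<in> S" if v: "v \<in> S" for v
  proof -
    have gv: "g *v v \<in> V" using Vg v by (auto simp: S_def)
    have "e *v (t *v (e' *v (g *v v))) = t *v (e' *v (g *v v))"
      using VD[OF ete' gv] by (simp flip: matrix_vector_mul_assoc)
    then have "e *v (t *v (g *v v)) = t *v (g *v v)" by (simp only: gS[OF v])
    then show ?thesis using Va[OF t(1) gv] by (simp add: S_def flip: matrix_vector_mul_assoc)
  qed
  moreover have "w \<in> S" using e by (auto simp: S_def V_def ann_def)
  ultimately obtain v c where v: "v \<in> S" "v \<noteq> 0" "(t ** g) *v v = c *s v"
    using eigenvector_in_subspace[OF S, of "t ** g" w] e(3) by blast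
  have vV: "v \<in> V" and ev: "e *v v = v" using v by (auto simp: S_def)
  \<comment> \<open>\<open>s ** t\<close> undoes itself on the image of \<open>e'\<close>, so the
    eigenvalue equation for \<open>t ** g\<close> places \<open>g *v v\<close> in the submodule
    generated by \<open>v\<close>.\<close>
  have gv: "g *v v = c *s (s *v v)"
  proof -
    have "s *v (t *v (e' *v (g *v v))) = e' *v (g *v v)"
      using VD[OF ste' Vg[OF vV]] by (simp flip: matrix_vector_mul_assoc)
    then have "g *v v = s *v ((t ** g) *v v)" by (simp add: gS[OF v(1)] flip: matrix_vector_mul_assoc)
    then show ?thesis using v(3) by (simp add: matrix_vector_smult)
  qed
  define W where "W = {a *v v | a. a \<in> ?A}"
  \<comment> \<open>Together with \<open>zero\<close> this says that \<open>y *v w\<close> and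
    \<open>y *v v\<close> vanish simultaneously, so sending the first to the second is an
    isomorphism from \<open>X\<close> onto \<open>W\<close>.\<close>
  have recover: "\<exists>x\<in>?A. x *v (y *v v) = v" if y: "y \<in> ?A" "y *v w \<noteq> 0" for y
  proof -
    obtain x where x: "x \<in> ?A" "x *v (y *v w) = w"
      using simple_submod_transitive[OF \<Gamma> X inX[OF y(1) e(2)] y(2) e(2)] .
    have "(x ** y ** e - e) *v z = 0" if z: "z \<in> X" for z
      using e(5)[OF z] x(2) by (auto simp: vsimps)
    then have "x ** y ** e - e \<in> ?I" by (auto simp: ann_def intro!: mspan_diff mspan_scale mult e(1) x(1) y(1))
    from VD[OF this vV] have "x *v (y *v v) = v" by (simp add: ev flip: matrix_vector_mul_assoc)
    then show ?thesis using x(1) by blast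
  qed
  have zero: "y *v v = 0" if y: "y \<in> ?A" "y *v w = 0" for y
  proof -
    have "(y ** e - 0) *v z = 0" if z: "z \<in> X" for z
      using e(5)[OF z] y(2) by (auto simp: vsimps)
    then have "y ** e - 0 \<in> ?I" using mult e(1) y(1) by (auto simp: ann_def)
    from VD[OF this vV] show ?thesis by (simp add: ev flip: matrix_vector_mul_assoc)
  qed
  have vW: "v \<in> W" unfolding W_def using mspan_group_one[OF \<Gamma>] by (force intro: exI[of _ "mat 1"])
  have W: "submod \<Gamma> W" unfolding W_def by (rule submod_orbit[OF \<Gamma>])
  show thesis
  proof (rule that[of W])
    show "simple_submod \<Gamma> W"
      unfolding simple_submod_def
    proof (intro conjI allI impI)
      show "W \<noteq> {0}" using vW v(2) by blast
      fix U assume U: "submod \<Gamma> U \<and> U \<subseteq> W"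
      show "U = {0} \<or> U = W"
      proof (rule disjCI)
        assume "U \<noteq> W"
        show "U = {0}"
        proof (rule ccontr)
          assume "U \<noteq> {0}"
          moreover have "0 \<in> U" using U by (simp add: submod_def vec.subspace_0)
          ultimately obtain z where z: "z \<in> U" "z \<noteq> 0" by blast
          then obtain y where y: "y \<in> ?A" "z = y *v v" using U by (auto simp: W_def)
          then obtain x where "x \<in> ?A" "x *v (y *v v) = v" using recover[OF y(1)] zero[OF y(1)] z(2) by blast
          then have "v \<in> U" using submod_mspan[of \<Gamma> U x z] U z(1) y(2) by simp
          then have "W \<subseteq> U" using submod_mspan[of \<Gamma> U] U by (auto simp: W_def)
          then show False using U \<open>U \<noteq> W\<close> by blast
        qed
      qed
    qed (rule W)
    show "g *v z \<in> W" if z: "z \<in> W" for z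
    proof -
      obtain a where a: "a \<in> ?A" "z = a *v v" using z by (auto simp: W_def)
      have "g *v z = (g ** a ** h) *v (g *v v)"
        by (simp add: a(2) matrix_vector_mul_assoc g(1) flip: matrix_mul_assoc)
      also have "\<dots> = ((mat c ** (g ** a ** h)) ** s) *v v"
        by (simp add: gv matrix_vector_smult mat_mult_vec flip: matrix_vector_mul_assoc matrix_mul_assoc)
      finally show ?thesis
        unfolding W_def using mult[OF mspan_scale[OF conj(1)[OF a(1)]] s(1)] by blast
    qed
    show "ann \<Gamma> W \<subseteq> ?I"
    proof
      fix a assume a: "a \<in> ann \<Gamma> W"
      have "a *v x = 0" if x: "x \<in> X" for x
      proof (rule ccontr)
        assume nz: "a *v x \<noteq> 0"
        obtain b where b: "b \<in> ?A" "b *v w = x" using simple_submod_transitive[OF \<Gamma> X e(2,3) x] .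
        have aA: "a \<in> ?A" using a by (simp add: ann_def)
        obtain z where "z *v ((a ** b) *v v) = v"
          using recover[OF mult[OF aA b(1)]] nz b(2) by (auto simp flip: matrix_vector_mul_assoc)
        moreover have "a *v (b *v v) = 0" using annD[OF a] b(1) by (auto simp: W_def)
        ultimately show False using v(2) by (simp flip: matrix_vector_mul_assoc)
      qed
      then show "a \<in> ?I" using a by (auto simp: ann_def)
    qed
  qed
qed

text \<open>If \<open>z v = f(v) w\<close> for a linear form \<open>f\<close>, then the trace of
  \<open>z\<close> is \<open>f(w)\<close>, and this is 1 because \<open>z\<close> fixes
  \<open>w\<close>.\<close>

lemma trace_rank_one:
  fixes z :: "'a::field^'n^'n"
  assumes "\<And>v. \<exists>c. z *v v = c *s w" "z *v w = w" "w \<noteq> 0"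
  shows "trace z = 1"
proof -
  obtain f where f: "\<And>v. z *v v = f v *s w" using assms(1) by metis
  have col: "z $ i $ j = f (axis j 1) * w $ i" for i j
  proof -
    have "(z *v axis j 1) $ i = z $ i $ j" 
      by (simp add: matrix_vector_mult_def axis_def if_distrib cong: if_cong)
    then show ?thesis by (simp add: f)
  qed
  have "trace z = (\<Sum>i\<in>UNIV. f (axis i 1) * w $ i)" by (simp add: trace_def col)
  moreover have "w = (\<Sum>j\<in>UNIV. f (axis j 1) * w $ j) *s w"
  proof -
    have "(z *v w) $ i = (\<Sum>j\<in>UNIV. f (axis j 1) * w $ j) * w $ i" for i
      by (simp add: matrix_vector_mult_def col sum_distrib_left sum_distrib_right mult_ac)
    then show ?thesis using assms(2) by (simp add: vec_eq_iff)
  qed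
  ultimately have "1 *s w = trace z *s w" by simp
  then show ?thesis using assms(3) by (simp only: vector_mul_rcancel) auto
qed

lemma trace_scale: "trace (mat c ** A) = c * trace (A :: 'a::field^'n^'n)"
  by (simp add: trace_def mat_mult_component sum_distrib_left)

text \<open>Composing with the projection \<open>P\<close> turns a trace on \<open>W\<close> into a
  trace of full matrices. The twisted trace is constant on \<Gamma>, so it vanishes on the two-sided
  ideal generated by \<open>\<gamma> - mat 1\<close>. If this ideal acted nontrivially on
  \<open>W\<close>, it would contain an element of rank one there, and a multiple of it would have
  twisted trace 1.\<close>

lemma constant_twisted_trace_trivial:
  fixes \<Gamma> :: "('a::alg_closed_field^'n^'n) set"
  assumes \<Gamma>: "matrix_group \<Gamma>" and W: "simple_submod \<Gamma> W"
    and g: "h ** g = mat 1" "\<And>w. w \<in> W \<Longrightarrow> g *v w \<in> W"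
    and P: "\<And>v. P *v v \<in> W" "\<And>w. w \<in> W \<Longrightarrow> P *v w = w"
    and tr: "\<And>\<gamma>. \<gamma> \<in> \<Gamma> \<Longrightarrow> trace (g ** \<gamma> ** P) = c"
    and \<gamma>: "\<gamma> \<in> \<Gamma>" "w0 \<in> W"
  shows "\<gamma> *v w0 = w0"
proof (rule ccontr)
  assume "\<gamma> *v w0 \<noteq> w0"
  \<comment> \<open>Stable under multiplication by \<Gamma> from both sides, so its span is already
    the two-sided ideal generated by \<open>\<gamma> - mat 1\<close>.\<close>
  define J where "J = {a ** (\<gamma> - mat 1) ** b | a b. a \<in> \<Gamma> \<and> b \<in> \<Gamma>}"
  define I where "I = mspan J"
  note mult = mspan_group_mult[OF \<Gamma>]
  have JA: "J \<subseteq> mspan \<Gamma>"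
    using mult mspan_diff[OF mspan_base[OF \<gamma>(1)] mspan_group_one[OF \<Gamma>]] mspan_base[of _ \<Gamma>]
    by (auto simp: J_def)
  have IA: "I \<subseteq> mspan \<Gamma>"
  proof
    fix y assume "y \<in> I"
    then show "y \<in> mspan \<Gamma>" unfolding I_def by induction (use JA in \<open>auto intro: mspan.intros\<close>)
  qed
  have left: "a ** b \<in> I" if "a \<in> mspan \<Gamma>" "b \<in> I" for a b
    unfolding I_def
  proof (rule mspan_mult[OF that(1)])
    show "b \<in> mspan J" using that(2) by (simp add: I_def)
    fix s t assume "s \<in> \<Gamma>" "t \<in> J"
    then obtain a b where ab: "a \<in> \<Gamma>" "b \<in> \<Gamma>" "t = a ** (\<gamma> - mat 1) ** b" by (auto simp: J_def)
    have "s ** t = (s ** a) ** (\<gamma> - mat 1) ** b" unfolding ab by (simp only: matrix_mul_assoc)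
    then show "s ** t \<in> mspan J"
      using ab mg_mult[OF \<Gamma> \<open>s \<in> \<Gamma>\<close> ab(1)] by (intro mspan_base) (auto simp: J_def)
  qed
  have right: "b ** a \<in> I" if "a \<in> mspan \<Gamma>" "b \<in> I" for a b
    unfolding I_def
  proof (rule mspan_mult[OF _ that(1)])
    show "b \<in> mspan J" using that(2) by (simp add: I_def)
    fix s t assume "t \<in> \<Gamma>" "s \<in> J"
    then obtain a b where ab: "a \<in> \<Gamma>" "b \<in> \<Gamma>" "s = a ** (\<gamma> - mat 1) ** b" by (auto simp: J_def)
    have "s ** t = a ** (\<gamma> - mat 1) ** (b ** t)" unfolding ab by (simp only: matrix_mul_assoc)
    then show "s ** t \<in> mspan J"
      using ab mg_mult[OF \<Gamma> ab(2) \<open>t \<in> \<Gamma>\<close>] by (intro mspan_base) (auto simp: J_def)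
  qed
  have trI: "trace (g ** y ** P) = 0" if "y \<in> I" for y
    using that unfolding I_def
  proof induction
    case mspan_zero
    show ?case by (simp add: trace_def)
  next
    case (mspan_base A)
    then obtain a b where ab: "a \<in> \<Gamma>" "b \<in> \<Gamma>" "A = a ** (\<gamma> - mat 1) ** b" by (auto simp: J_def)
    have "g ** A ** P = g ** (a ** \<gamma> ** b) ** P - g ** (a ** b) ** P"
      by (simp add: ab(3) matrix_mult_diff_left matrix_mult_diff_right)
    then show ?case using tr ab \<gamma>(1) mg_mult[OF \<Gamma>] by (simp add: trace_sub)
  next
    case (mspan_add A B)
    then show ?case by (simp add: matrix_add_ldistrib matrix_mult_add_left trace_add)
  next
    case (mspan_scale A c)
    have "g ** (mat c ** A) ** P = mat c ** (g ** A ** P)"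
      by (simp only: mat_mult_commute matrix_mul_assoc[symmetric])
    then show ?case using mspan_scale by (simp add: trace_scale)
  qed
  have "\<gamma> - mat 1 \<in> I"
    unfolding I_def using mg_one[OF \<Gamma>] by (intro mspan_base) (force simp: J_def)
  then obtain e w where e: "e \<in> I" "w \<in> W" "w \<noteq> 0" "e *v w = w" "\<And>x. x \<in> W \<Longrightarrow> \<exists>c. e *v x = c *s w"
  proof (rule rank_one_element[OF \<Gamma> W IA, rotated 4])
    show "(\<gamma> - mat 1) *v w0 \<noteq> 0" using \<open>\<gamma> *v w0 \<noteq> w0\<close> by (simp add: matrix_vector_mult_diff_rdistrib)
  qed (use left right \<gamma>(2) mspan_diff mspan_scale in \<open>auto simp: I_def\<close>)
  have Ws: "submod \<Gamma> W" "vec.subspace W" using W by (auto simp: simple_submod_def submod_def)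
  have ginj: "inj ((*v) g)" by (metis g(1) injI matrix_vector_mul_assoc matrix_vector_mul_lid)
  have "(*v) g ` W = W"
  proof (rule vec.subspace_dim_equal)
    show "vec.subspace ((*v) g ` W)" by (rule vec.subspace_image[OF Ws(2)])
    show "vec.dim W \<le> vec.dim ((*v) g ` W)"
      using vec.dim_image_eq[OF _ inj_on_subset[OF ginj subset_UNIV], of W] by simp
  qed (use g(2) Ws in auto)
  then have "w \<in> (*v) g ` W" using e(2) by simp
  then obtain w' where w': "w' \<in> W" "g *v w' = w" by blast
  obtain x where x: "x \<in> mspan \<Gamma>" "x *v w = w'"
    using simple_submod_transitive[OF \<Gamma> W e(2,3) w'(1)] .
  have "trace (g ** (x ** e) ** P) = 1"
  proof (rule trace_rank_one[of _ w])
    show "\<exists>c. (g ** (x ** e) ** P) *v v = c *s w" for v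
      using e(5)[OF P(1)[of v]] x(2) w'(2)
      by (auto simp: matrix_vector_smult simp flip: matrix_vector_mul_assoc)
    show "(g ** (x ** e) ** P) *v w = w"
      by (simp add: P(2)[OF e(2)] e(4) x(2) w'(2) flip: matrix_vector_mul_assoc)
  qed (rule e(3))
  moreover have "trace (g ** (x ** e) ** P) = 0" by (rule trI[OF left[OF x(1) e(1)]])
  ultimately show False by simp
qed

section \<open>Annihilators and characteristic polynomials\<close>

text \<open>
  An element of one annihilator that is not in another shortens a nontrivial relation without making it trivial.
\<close>

lemma simple_submods_distinct_ann_sum_zero:
  fixes \<Gamma> :: "('a::field^'n^'n) set"
  assumes \<Gamma>: "matrix_group \<Gamma>"
    and "finite T" "\<And>X. X \<in> T \<Longrightarrow> simple_submod \<Gamma> X" "inj_on (ann \<Gamma>) T"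
    and "\<And>X. X \<in> T \<Longrightarrow> x X \<in> X" "(\<Sum>X\<in>T. x X) = 0" "X \<in> T"
  shows "x X = 0"
  using assms(2-)
proof (induction "card T" arbitrary: T x X)
  case 0
  then show ?case by simp
next
  case (Suc k)
  note fin = Suc.prems(1) and simp = Suc.prems(2) and inj = Suc.prems(3)
    and xX = Suc.prems(4) and sum0 = Suc.prems(5)
  have smaller: "y A = 0" if "A \<in> T" "B \<in> T" "A \<noteq> B" "\<And>X. X \<in> T \<Longrightarrow> y X \<in> X" "y B = 0" "(\<Sum>X\<in>T. y X) = 0"
    for A B y
  proof (rule Suc.hyps(1)[of "T - {B}"])
    show "k = card (T - {B})" using Suc.hyps(2) that(2) fin by simp
    show "(\<Sum>X\<in>T - {B}. y X) = 0" using that(2,5,6) fin by (simp add: sum.remove)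
    show "inj_on (ann \<Gamma>) (T - {B})" using inj by (rule inj_on_subset) auto
  qed (use fin simp that in auto)
  have separated: "x A = 0" if AB: "A \<in> T" "B \<in> T" "A \<noteq> B" "\<not> ann \<Gamma> B \<subseteq> ann \<Gamma> A" for A B
  proof (rule ccontr)
    assume nz: "x A \<noteq> 0"
    obtain a where "a \<in> ann \<Gamma> B" "a \<notin> ann \<Gamma> A" using AB(4) by blast
    then obtain z where a: "a \<in> mspan \<Gamma>" "\<And>y. y \<in> B \<Longrightarrow> a *v y = 0" "z \<in> A" "a *v z \<noteq> 0"
      by (auto simp: ann_def)
    obtain b where b: "b \<in> mspan \<Gamma>" "b *v x A = z"
      using simple_submod_transitive[OF \<Gamma> simp[OF AB(1)] xX[OF AB(1)] nz a(3)] .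
    have ab: "a ** b \<in> mspan \<Gamma>" by (rule mspan_group_mult[OF \<Gamma> a(1) b(1)])
    have "(a ** b) *v x A = 0"
    proof (rule smaller[OF AB(1-3), where y = "\<lambda>X. (a ** b) *v x X"])
      show "(a ** b) *v x X \<in> X" if "X \<in> T" for X
        using submod_mspan[OF _ ab xX[OF that]] simp[OF that] by (simp add: simple_submod_def)
      have "b *v x B \<in> B"
        using submod_mspan[OF _ b(1) xX[OF AB(2)]] simp[OF AB(2)] by (simp add: simple_submod_def)
      then show "(a ** b) *v x B = 0" using a(2) by (simp flip: matrix_vector_mul_assoc)
      have "(\<Sum>X\<in>T. (a ** b) *v x X) = (a ** b) *v (\<Sum>X\<in>T. x X)"
        by (simp add: vec.linear_sum)
      then show "(\<Sum>X\<in>T. (a ** b) *v x X) = 0" using sum0 by simp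
    qed
    then show False using b(2) a(4) by (simp flip: matrix_vector_mul_assoc)
  qed
  show ?case
  proof (cases "T = {X}")
    case True
    then show ?thesis using sum0 by simp
  next
    case False
    then obtain Y where Y: "Y \<in> T" "Y \<noteq> X" using Suc.prems(6) by blast
    then have "ann \<Gamma> X \<noteq> ann \<Gamma> Y" using inj Suc.prems(6) by (auto simp: inj_on_def)
    \<comment> \<open>Either failure of inclusion may occur. In the second case the component at
      \<open>Y\<close> vanishes first, and the induction hypothesis for the remaining summands gives
      the one at \<open>X\<close>.\<close>
    then consider "\<not> ann \<Gamma> Y \<subseteq> ann \<Gamma> X" | "\<not> ann \<Gamma> X \<subseteq> ann \<Gamma> Y" by blast
    then show ?thesis
    proof cases
      case 1
      then show ?thesis using separated[of X Y] Suc.prems(6) Y by blast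
    next
      case 2
      then have "x Y = 0" using separated[of Y X] Suc.prems(6) Y by blast
      then show ?thesis using smaller[of X Y x] Suc.prems(6) Y xX sum0 by blast
    qed
  qed
qed

text \<open>Nonzero vectors taken from simple submodules with distinct annihilators are independent,
  so there are at most \<open>n\<close>. Finite subfamilies are counted, because finiteness of the
  whole family is part of the claim.\<close>

lemma card_simple_anns:
  fixes \<Gamma> :: "('a::field^'n^'n) set"
  assumes \<Gamma>: "matrix_group \<Gamma>"
  shows "finite (ann \<Gamma> ` {X. simple_submod \<Gamma> X}) \<and> card (ann \<Gamma> ` {X. simple_submod \<Gamma> X}) \<le> CARD('n)"
proof (rule finite_if_finite_subsets_card_bdd)
  fix \<I> assume \<I>: "\<I> \<subseteq> ann \<Gamma> ` {X. simple_submod \<Gamma> X}" "finite \<I>"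
  obtain T where T: "T \<subseteq> {X. simple_submod \<Gamma> X}" "inj_on (ann \<Gamma>) T" "\<I> = ann \<Gamma> ` T"
    using \<I>(1) by (auto simp: subset_image_inj)
  have finT: "finite T" using \<I>(2) T(2,3) by (simp add: finite_image_iff)
  have "\<exists>v. \<forall>X\<in>T. v X \<in> X \<and> v X \<noteq> 0"
  proof (intro bchoice ballI)
    fix X assume "X \<in> T"
    then have "X \<noteq> {0}" "0 \<in> X" using T(1) by (auto simp: simple_submod_def submod_def vec.subspace_0)
    then show "\<exists>v. v \<in> X \<and> v \<noteq> 0" by blast
  qed
  then obtain v where v: "\<And>X. X \<in> T \<Longrightarrow> v X \<in> X" "\<And>X. X \<in> T \<Longrightarrow> v X \<noteq> 0" by blast
  have sub: "vec.subspace X" if "X \<in> T" for X using that T(1) by (auto simp: simple_submod_def submod_def)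
  have zero: "x X = 0" if "\<And>X. X \<in> T \<Longrightarrow> x X \<in> X" "(\<Sum>X\<in>T. x X) = 0" "X \<in> T" for x X
    using simple_submods_distinct_ann_sum_zero[OF \<Gamma> finT _ T(2) that] T(1) by blast
  have injv: "inj_on v T"
  proof (rule inj_onI, rule ccontr)
    fix X Y assume XY: "X \<in> T" "Y \<in> T" "v X = v Y" "X \<noteq> Y"
    define x where "x Z = (if Z = X then v X else if Z = Y then - v Y else 0)" for Z
    have "(\<Sum>Z\<in>T. x Z) = x X + (x Y + (\<Sum>Z\<in>T - {X} - {Y}. x Z))"
      using XY finT by (simp add: sum.remove[of _ X] sum.remove[of _ Y])
    also have "(\<Sum>Z\<in>T - {X} - {Y}. x Z) = 0" by (rule sum.neutral) (auto simp: x_def)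
    finally have "(\<Sum>Z\<in>T. x Z) = 0" using XY by (simp add: x_def)
    moreover have "x Z \<in> Z" if "Z \<in> T" for Z
      using v(1) sub[OF that] that by (auto simp: x_def vec.subspace_0 vec.subspace_neg)
    ultimately have "x X = 0" using zero XY(1) by blast
    then show False using v(2) XY(1) by (simp add: x_def)
  qed
  have "vec.independent (v ` T)"
  proof (rule vec.independent_if_scalars_zero)
    fix f w assume f: "(\<Sum>w\<in>v ` T. f w *s w) = 0" and "w \<in> v ` T"
    then obtain X where X: "X \<in> T" "w = v X" by blast
    have "f (v X) *s v X = 0"
      using zero[of "\<lambda>X. f (v X) *s v X" X] f X v(1) sub
      by (simp add: sum.reindex[OF injv] vec.subspace_scale)
    then show "f w = 0" using v(2) X by simp
  qed (use finT in simp)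
  then have "card (v ` T) \<le> CARD('n)"
    using vec.independent_span_bound[OF finite_cart_basis, of "v ` T"] card_cart_basis[where 'a='a and 'i='n]
    by simp
  then show "card \<I> \<le> CARD('n)" by (simp add: T(3) card_image T(2) injv)
qed

lemma submod_translate:
  fixes g h :: "'a::field^'n^'n"
  assumes "submod \<Gamma> U" "h ** g = mat 1" "\<And>\<gamma>. \<gamma> \<in> \<Gamma> \<Longrightarrow> h ** \<gamma> ** g \<in> \<Gamma>"
  shows "submod \<Gamma> ((*v) g ` U)"
  unfolding submod_def
proof (intro conjI ballI)
  show "vec.subspace ((*v) g ` U)" using assms(1) by (intro vec.subspace_image) (simp add: submod_def)
  have gh: "g ** h = mat 1" using assms(2) matrix_left_right_inverse by blast
  fix \<gamma> w assume \<gamma>: "\<gamma> \<in> \<Gamma>" and "w \<in> (*v) g ` U"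
  then obtain u where u: "u \<in> U" "w = g *v u" by blast
  have "\<gamma> *v w = g *v ((h ** \<gamma> ** g) *v u)"
    by (simp add: u(2) matrix_vector_mul_assoc matrix_mul_assoc gh)
  moreover have "(h ** \<gamma> ** g) *v u \<in> U" using assms(1) assms(3)[OF \<gamma>] u(1) by (simp add: submod_def)
  ultimately show "\<gamma> *v w \<in> (*v) g ` U" by blast
qed

lemma translate_inverse:
  fixes g h :: "'a::field^'n^'n"
  assumes "h ** g = mat 1"
  shows "(*v) h ` ((*v) g ` U) = U"
  by (simp add: image_image matrix_vector_mul_assoc assms)

lemma simple_submod_translate:
  fixes g h :: "'a::field^'n^'n"
  assumes X: "simple_submod \<Gamma> X" and g: "h ** g = mat 1" "\<And>\<gamma>. \<gamma> \<in> \<Gamma> \<Longrightarrow> g ** \<gamma> ** h \<in> \<Gamma>"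
    "\<And>\<gamma>. \<gamma> \<in> \<Gamma> \<Longrightarrow> h ** \<gamma> ** g \<in> \<Gamma>"
  shows "simple_submod \<Gamma> ((*v) g ` X)" "ann \<Gamma> ((*v) g ` X) = (\<lambda>a. g ** a ** h) ` ann \<Gamma> X"
proof -
  have gh: "g ** h = mat 1" using g(1) matrix_left_right_inverse by blast
  show "simple_submod \<Gamma> ((*v) g ` X)"
    unfolding simple_submod_def
  proof (intro conjI allI impI)
    show "submod \<Gamma> ((*v) g ` X)"
      using X by (intro submod_translate[OF _ g(1,3)]) (auto simp: simple_submod_def)
    show "(*v) g ` X \<noteq> {0}"
    proof
      assume "(*v) g ` X = {0}"
      then have "(*v) h ` ((*v) g ` X) = {0}" by simp
      then have "X = {0}" by (simp only: translate_inverse[OF g(1)])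
      then show False using X by (simp add: simple_submod_def)
    qed
    fix U assume U: "submod \<Gamma> U \<and> U \<subseteq> (*v) g ` X"
    have "submod \<Gamma> ((*v) h ` U)" using U by (intro submod_translate[OF _ gh g(2)]) auto
    moreover have "(*v) h ` U \<subseteq> X" using U translate_inverse[OF g(1), of X] by (metis image_mono)
    ultimately have "(*v) h ` U = {0} \<or> (*v) h ` U = X" using X by (simp add: simple_submod_def)
    then have "(*v) g ` ((*v) h ` U) = (*v) g ` {0} \<or> (*v) g ` ((*v) h ` U) = (*v) g ` X"
      by (elim disjE) simp_all
    then show "U = {0} \<or> U = (*v) g ` X" by (simp add: translate_inverse[OF gh])
  qed
  have 1: "g ** a ** h \<in> ann \<Gamma> ((*v) g ` X)" if "a \<in> ann \<Gamma> X" for a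
  proof -
    have "g ** a ** h \<in> mspan \<Gamma>" using that by (intro mspan_conj[of a \<Gamma>]) (auto simp: ann_def intro: mspan_base g)
    moreover have "(g ** a ** h) *v (g *v x) = g *v (a *v x)" for x
      by (simp add: matrix_vector_mul_assoc) (simp add: g(1) flip: matrix_mul_assoc)
    ultimately show ?thesis using that by (auto simp: ann_def)
  qed
  show "ann \<Gamma> ((*v) g ` X) = (\<lambda>a. g ** a ** h) ` ann \<Gamma> X"
  proof (intro subset_antisym subsetI)
    fix b assume b: "b \<in> ann \<Gamma> ((*v) g ` X)"
    have "h ** b ** g \<in> mspan \<Gamma>" using b by (intro mspan_conj[of b \<Gamma>]) (auto simp: ann_def intro: mspan_base g)
    moreover have "(h ** b ** g) *v x = 0" if "x \<in> X" for x
    proof -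
      have "(h ** b ** g) *v x = h *v (b *v (g *v x))" by (simp add: matrix_vector_mul_assoc matrix_mul_assoc)
      then show ?thesis using annD[OF b] that by simp
    qed
    ultimately have "h ** b ** g \<in> ann \<Gamma> X" by (simp add: ann_def)
    moreover have "b = g ** (h ** b ** g) ** h"
      by (simp add: matrix_mul_assoc gh) (simp add: gh flip: matrix_mul_assoc)
    ultimately show "b \<in> (\<lambda>a. g ** a ** h) ` ann \<Gamma> X" by blast
  qed (use 1 in auto)
qed

text \<open>\<open>G\<close> permutes the at most \<open>n\<close> types by conjugating
  annihilators, and \<open>G'\<close> is the kernel. This is the origin of the factor
  \<open>n!\<close> next to \<eta>.\<close>

lemma stabilizer_of_simple_anns:
  fixes \<Gamma> :: "('a::field^'n^'n) set"
  assumes G: "matrix_group G" and \<Gamma>: "matrix_group \<Gamma>" "\<And>g x. g \<in> G \<Longrightarrow> x \<in> \<Gamma> \<Longrightarrow> g ** x ** minv g \<in> \<Gamma>"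
  defines "G' \<equiv> {g\<in>G. \<forall>X. simple_submod \<Gamma> X \<longrightarrow> (\<lambda>a. g ** a ** minv g) ` ann \<Gamma> X = ann \<Gamma> X}"
  shows "card G \<le> fact CARD('n) * card G'"
proof -
  let ?S = "ann \<Gamma> ` {X. simple_submod \<Gamma> X}"
  let ?act = "\<lambda>g I. (\<lambda>a. g ** a ** minv g) ` I"
  have conj: "minv g ** x ** g \<in> \<Gamma>" if "g \<in> G" "x \<in> \<Gamma>" for g x
    using \<Gamma>(2)[OF mg_inv[OF G that(1)] that(2)] by (simp add: mg_inv_inv[OF G that(1)])
  have "card G \<le> fact (card ?S) * card {g\<in>G. \<forall>I\<in>?S. ?act g I = I}"
  proof (rule card_le_fact_mult_kernel[OF G])
    fix g I assume g: "g \<in> G" and "I \<in> ?S"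
    then obtain X where X: "simple_submod \<Gamma> X" "I = ann \<Gamma> X" by blast
    from simple_submod_translate[OF X(1) mg_left[OF G g], OF \<Gamma>(2)[OF g] conj[OF g]]
    show "?act g I \<in> ?S" using X(2) by (metis imageI mem_Collect_eq)
  next
    fix I assume "I \<in> ?S"
    have "minv (mat 1) = (mat 1 :: 'a^'n^'n)" by (rule minv_eq) simp
    then show "?act (mat 1) I = I" by simp
  next
    fix g h I assume "g \<in> G" "h \<in> G"
    then show "?act (g ** h) I = ?act g (?act h I)"
      by (simp add: image_image mg_inv_mult[OF G] matrix_mul_assoc)
  qed (use card_simple_anns[OF \<Gamma>(1)] in simp)
  also have "\<dots> \<le> fact CARD('n) * card {g\<in>G. \<forall>I\<in>?S. ?act g I = I}"
    using card_simple_anns[OF \<Gamma>(1)] by (intro mult_right_mono fact_mono) auto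
  also have "{g\<in>G. \<forall>I\<in>?S. ?act g I = I} = G'" by (auto simp: G'_def)
  finally show ?thesis .
qed

lemma exists_projection:
  fixes W :: "('a::field^'n) set"
  assumes "vec.subspace W"
  obtains P :: "'a^'n^'n" where "\<And>v. P *v v \<in> W" "\<And>w. w \<in> W \<Longrightarrow> P *v w = w"
proof -
  obtain f :: "'a^'n \<Rightarrow> 'a^'n" where f: "f ` UNIV \<subseteq> W" "Vector_Spaces.linear (*s) (*s) f" "\<forall>v\<in>W. f (id v) = v"
    using vec.linear_exists_left_inverse_on[OF vec.linear_id assms] by auto
  show thesis
    by (rule that[of "matrix f"]) (use f in \<open>auto simp: matrix_works\<close>)
qed

section \<open>The polynomial det(1 - A T), eigenvalues and traces\<close>

definition rev_char_poly :: "'a::comm_ring_1^'n^'n \<Rightarrow> 'a poly" where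
  "rev_char_poly A = det (\<chi> i j. [:if i = j then 1 else 0, - A $ i $ j:])"

lemma poly_rev_char_poly: "poly (rev_char_poly A) t = det (mat 1 - mat t ** (A :: 'a::field^'n^'n))"
  by (simp add: rev_char_poly_def det_def poly_sum poly_prod mat_mult_component)
    (simp add: mat_def)

text \<open>In the Leibniz expansion each of the \<open>n\<close> factors is affine in the entries.
  This sets the degree in which connectedness is required.\<close>

lemma rev_char_poly_in_poly_maps:
  "(\<lambda>A :: 'a::field^'n^'n. poly (rev_char_poly A) t) \<in> poly_maps CARD('n)"
proof -
  have "(\<lambda>A :: 'a^'n^'n. poly (rev_char_poly A) t) = (\<lambda>A. \<Sum>p | p permutes (UNIV :: 'n set).
      of_int (sign p) * (\<Prod>i\<in>UNIV. (if i = p i then 1 else 0) + (- t) * A $ i $ p i))"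
    by (simp add: rev_char_poly_def det_def poly_sum poly_prod fun_eq_iff)
  also have "\<dots> \<in> poly_maps (card (UNIV :: 'n set))"
    by (intro poly_maps_sum poly_maps_scale poly_maps_prod affine_add affine_const affine_scale affine_entry) simp
  finally show ?thesis .
qed

lemma degree_rev_char_poly: "degree (rev_char_poly (A :: 'a::field^'n^'n)) \<le> CARD('n)"
  unfolding rev_char_poly_def det_def
proof (rule degree_sum_le)
  fix p :: "'n \<Rightarrow> 'n"
  have "degree (\<Prod>i\<in>UNIV. (\<chi> i j. [:if i = j then 1 else 0, - A $ i $ j:]) $ i $ p i)
      \<le> (\<Sum>i\<in>(UNIV::'n set). degree ((\<chi> i j. [:if i = j then 1 else 0, - A $ i $ j:]) $ i $ p i))"
    using degree_prod_sum_le[of UNIV "\<lambda>i. (\<chi> i j. [:if i = j then 1 else 0, - A $ i $ j:]) $ i $ p i"]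
    by (simp add: comp_def)
  also have "\<dots> \<le> (\<Sum>i\<in>(UNIV::'n set). 1)" by (intro sum_mono) simp
  finally have "degree (\<Prod>i\<in>UNIV. (\<chi> i j. [:if i = j then 1 else 0, - A $ i $ j:]) $ i $ p i) \<le> CARD('n)" by simp
  then show "degree (of_int (sign p) * (\<Prod>i\<in>UNIV. (\<chi> i j. [:if i = j then 1 else 0, - A $ i $ j:]) $ i $ p i)) \<le> CARD('n)"
    by (metis (no_types, lifting) degree_of_int add_0 degree_mult_le order_trans)
qed simp

lemma coeff_0_rev_char_poly: "coeff (rev_char_poly (A :: 'a::field^'n^'n)) 0 = 1"
  using poly_rev_char_poly[of A 0] by (simp add: poly_0_coeff_0)

lemma coeff_prod_linear:
  assumes "finite I"
  shows "coeff (\<Prod>i\<in>I. [:1, f i:]) 0 = (1::'a::comm_ring_1)" "coeff (\<Prod>i\<in>I. [:1, f i:]) 1 = (\<Sum>i\<in>I. f i)"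
  using assms by (induction I rule: finite_induct) (simp_all add: coeff_mult_0 coeff_mult)

text \<open>A permutation other than the identity moves at least two indices, and each moved index
  contributes a factor divisible by the variable; its term starts in degree 2.\<close>

lemma coeff_1_rev_char_poly: "coeff (rev_char_poly (A :: 'a::field^'n^'n)) 1 = - trace A"
proof -
  define q where "q i j = [:if i = j then 1 else 0, - A $ i $ j:]" for i j
  have "rev_char_poly A = (\<Sum>p | p permutes UNIV. of_int (sign p) * (\<Prod>i\<in>UNIV. q i (p i)))"
    by (simp add: rev_char_poly_def det_def q_def)
  also have "\<dots> = (\<Prod>i\<in>UNIV. q i i) + (\<Sum>p\<in>{p. p permutes UNIV} - {id}. of_int (sign p) * (\<Prod>i\<in>UNIV. q i (p i)))"
    by (subst sum.remove[of _ id]) (simp_all add: finite_permutations permutes_id)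
  finally have "coeff (rev_char_poly A) 1 = coeff (\<Prod>i\<in>UNIV. q i i) 1 +
      (\<Sum>p\<in>{p. p permutes UNIV} - {id}. coeff (of_int (sign p) * (\<Prod>i\<in>UNIV. q i (p i))) 1)"
    by (simp add: coeff_sum)
  also have "(\<Sum>p\<in>{p. p permutes UNIV} - {id}. coeff (of_int (sign p) * (\<Prod>i\<in>UNIV. q i (p i))) 1) = 0"
  proof (rule sum.neutral, rule ballI)
    fix p :: "'n \<Rightarrow> 'n" assume p: "p \<in> {p. p permutes UNIV} - {id}"
    then obtain i where i: "p i \<noteq> i" by (auto simp: fun_eq_iff)
    have "p (p i) \<noteq> p i" using p i by (metis DiffD1 mem_Collect_eq permutes_inj injD)
    have "(\<Prod>k\<in>UNIV. q k (p k)) = q i (p i) * (q (p i) (p (p i)) * (\<Prod>k\<in>UNIV - {i} - {p i}. q k (p k)))"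
      using i by (simp add: prod.remove[of UNIV i] prod.remove[of "UNIV - {i}" "p i"])
    also have "\<dots> = [:0, 1:]^2 * (smult (A $ i $ p i * A $ p i $ p (p i)) (\<Prod>k\<in>UNIV - {i} - {p i}. q k (p k)))"
      using i \<open>p (p i) \<noteq> p i\<close> by (simp add: q_def power2_eq_square mult.commute[of "A $ i $ p i"])
    finally have "of_int (sign p) * (\<Prod>k\<in>UNIV. q k (p k)) = [:0, 1:]^2 *
        (of_int (sign p) * smult (A $ i $ p i * A $ p i $ p (p i)) (\<Prod>k\<in>UNIV - {i} - {p i}. q k (p k)))"
      by (simp only: mult.left_commute)
    then show "coeff (of_int (sign p) * (\<Prod>i\<in>UNIV. q i (p i))) 1 = 0"
      by (simp add: power2_eq_square del: mult_pCons_right)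
  qed
  also have "coeff (\<Prod>i\<in>UNIV. q i i) 1 = - trace A"
    using coeff_prod_linear(2)[of UNIV "\<lambda>i. - A $ i $ i"] by (simp add: q_def trace_def sum_negf)
  finally show ?thesis by simp
qed

lemma rev_char_poly_root_eigenvector:
  fixes A :: "'a::field^'n^'n"
  shows "poly (rev_char_poly A) t = 0 \<longleftrightarrow> (\<exists>v. v \<noteq> 0 \<and> t *s (A *v v) = v)"
proof -
  have ker: "(mat 1 - mat t ** A) *v v = 0 \<longleftrightarrow> t *s (A *v v) = v" for v
    by (auto simp: matrix_vector_mult_diff_rdistrib mat_mult_assoc_vec)
  have "det (mat 1 - mat t ** A) = 0 \<longleftrightarrow> (\<exists>v. v \<noteq> 0 \<and> (mat 1 - mat t ** A) *v v = 0)"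
    using matrix_left_invertible_ker[of "mat 1 - mat t ** A"] invertible_det_nz[of "mat 1 - mat t ** A"]
      invertible_left_inverse[of "mat 1 - mat t ** A"] by blast
  then show ?thesis by (simp add: ker poly_rev_char_poly)
qed

lemma coeff_prod_mset_linear:
  "coeff (\<Prod>x\<in>#B. [:1, - x:]) 0 = (1::'a::comm_ring_1)" "coeff (\<Prod>x\<in>#B. [:1, - x:]) 1 = - (\<Sum>x\<in>#B. x)"
  by (induction B) (simp_all add: coeff_mult_0 coeff_mult)

text \<open>The polynomial factors into terms \<open>1 - \<mu> X\<close> with \<mu> the inverse of a
  root, hence a nonzero eigenvalue, and its coefficient of degree 1 is minus the trace. Zero
  eigenvalues only lower the degree.\<close>

lemma trace_sum_of_eigenvalues:
  fixes T :: "'a::alg_closed_field^'n^'n"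
  assumes \<Lambda>: "\<And>\<mu> v. \<mu> \<noteq> 0 \<Longrightarrow> v \<noteq> 0 \<Longrightarrow> T *v v = \<mu> *s v \<Longrightarrow> \<mu> \<in> \<Lambda>"
  shows "trace T \<in> sum_list ` {xs. set xs \<subseteq> insert 0 \<Lambda> \<and> length xs = CARD('n)}"
proof -
  define p where "p = rev_char_poly T"
  have p0: "poly p 0 = 1" "p \<noteq> 0" using coeff_0_rev_char_poly[of T] by (auto simp: p_def poly_0_coeff_0)
  obtain A where A: "size A = degree p" "p = smult (lead_coeff p) (\<Prod>x\<in>#A. [:- x, 1:])"
    using alg_closed_imp_factorization[OF p0(2)] by blast
  have root: "poly p x = 0" if "x \<in># A" for x
    using that by (subst A(2)) (auto simp: poly_prod_mset)
  then have nz: "x \<noteq> 0" if "x \<in># A" for x using p0(1) that by auto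
  define B where "B = image_mset inverse A"
  have "\<exists>c. (\<Prod>x\<in>#M. [:- x, 1:]) = smult c (\<Prod>x\<in>#M. [:1, - inverse x:])" if "\<And>x. x \<in># M \<Longrightarrow> x \<noteq> 0" for M :: "'a multiset"
    using that
  proof (induction M)
    case (add x M)
    then obtain c where c: "(\<Prod>x\<in>#M. [:- x, 1:]) = smult c (\<Prod>x\<in>#M. [:1, - inverse x:])" by auto
    have "[:- x, 1:] = smult (- x) [:1, - inverse x:]" using add.prems[of x] by simp
    then have "(\<Prod>x\<in>#add_mset x M. [:- x, 1:]) = smult (- x * c) (\<Prod>x\<in>#add_mset x M. [:1, - inverse x:])"
      by (simp only: image_mset_add_mset prod_mset.add_mset c mult_smult_left mult_smult_right smult_smult
          mult.commute[of c])
    then show ?case by blast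
  qed (auto intro: exI[of _ 1])
  then obtain c where c: "(\<Prod>x\<in>#A. [:- x, 1:]) = smult c (\<Prod>x\<in>#A. [:1, - inverse x:])" using nz by blast
  have "p = smult (lead_coeff p * c) (\<Prod>x\<in>#A. [:1, - inverse x:])"
    by (rule trans[OF A(2)]) (simp only: c smult_smult)
  also have "(\<Prod>x\<in>#A. [:1, - inverse x:]) = (\<Prod>x\<in>#B. [:1, - x:])"
    by (simp add: B_def image_mset.compositionality comp_def)
  finally have p: "p = smult (lead_coeff p * c) (\<Prod>x\<in>#B. [:1, - x:])" .
  have "lead_coeff p * c = 1"
    using arg_cong[OF p, of "\<lambda>p. coeff p 0"] p0(1) by (simp add: coeff_prod_mset_linear(1) poly_0_coeff_0)
  then have "p = (\<Prod>x\<in>#B. [:1, - x:])" by (intro trans[OF p]) simp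
  then have tr: "trace T = sum_mset B"
    using coeff_1_rev_char_poly[of T] coeff_prod_mset_linear(2)[of B] by (simp add: p_def)
  have B\<Lambda>: "set_mset B \<subseteq> \<Lambda>"
  proof
    fix \<mu> assume "\<mu> \<in># B"
    then obtain x where x: "x \<in># A" "\<mu> = inverse x" by (auto simp: B_def)
    obtain v where v: "v \<noteq> 0" "x *s (T *v v) = v"
      using root[OF x(1)] unfolding p_def rev_char_poly_root_eigenvector by blast
    have "T *v v = \<mu> *s v" using nz[OF x(1)] arg_cong[OF v(2), of "\<lambda>w. \<mu> *s w"] x(2) by simp
    then show "\<mu> \<in> \<Lambda>" using \<Lambda> nz[OF x(1)] v(1) x(2) by simp
  qed
  obtain xs where xs: "mset xs = B" using ex_mset by blast
  have "length xs = degree p" using xs A(1) by (metis B_def size_image_mset size_mset)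
  then have len: "length xs \<le> CARD('n)" using degree_rev_char_poly[of T] by (simp add: p_def)
  \<comment> \<open>The padding stands for the zero eigenvalues and gives all lists length
    \<open>n\<close>, so that they can be counted.\<close>
  have "trace T = sum_list (xs @ replicate (CARD('n) - length xs) 0)"
    using tr xs by (simp add: sum_list_replicate flip: sum_mset_sum_list)
  moreover have "set (xs @ replicate (CARD('n) - length xs) 0) \<subseteq> insert 0 \<Lambda>"
    using B\<Lambda> xs by auto
  ultimately show ?thesis using len by (intro image_eqI[of _ _ "xs @ replicate (CARD('n) - length xs) 0"]) auto
qed

lemma card_sum_lists:
  fixes \<Lambda> :: "'a::comm_monoid_add set"
  assumes "finite \<Lambda>" "card \<Lambda> \<le> n"
  shows "finite (sum_list ` {xs. set xs \<subseteq> insert 0 \<Lambda> \<and> length xs = n})"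
    "card (sum_list ` {xs. set xs \<subseteq> insert 0 \<Lambda> \<and> length xs = n}) \<le> (n + 1)^n"
proof -
  have fin: "finite {xs. set xs \<subseteq> insert 0 \<Lambda> \<and> length xs = n}"
    using assms by (intro finite_lists_length_eq) auto
  then show "finite (sum_list ` {xs. set xs \<subseteq> insert 0 \<Lambda> \<and> length xs = n})" by simp
  have "card (sum_list ` {xs. set xs \<subseteq> insert 0 \<Lambda> \<and> length xs = n}) \<le> card {xs. set xs \<subseteq> insert 0 \<Lambda> \<and> length xs = n}"
    by (rule card_image_le[OF fin])
  also have "\<dots> = card (insert 0 \<Lambda>)^n" using assms by (intro card_lists_length_eq) auto
  also have "\<dots> \<le> (n + 1)^n" using assms card_insert_le_m1[of "n+1" \<Lambda> 0] by (intro power_mono) auto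
  finally show "card (sum_list ` {xs. set xs \<subseteq> insert 0 \<Lambda> \<and> length xs = n}) \<le> (n + 1)^n" .
qed

section \<open>The bound over an algebraically closed field\<close>

text \<open>\<open>D\<close> bounds the dimension of the equations of degree \<open>n\<close>. The
  level \<open>m\<close> serves two densities: \<open>(1 - \<eta> * fact n) / N\<close>, for the
  points of a coset sharing one polynomial, and \<open>1 / (n + 1)^n\<close>, for a most frequent
  trace.\<close>

definition group_bound :: "nat \<Rightarrow> real \<Rightarrow> real \<Rightarrow> nat" where
  "group_bound n \<eta> N =
    (let D = (n^2 + 1)^n;
         m = nat \<lceil>max (coset_index D ((1 - \<eta> * fact n) / N)) (coset_index D (1 / real ((n + 1)^n)))\<rceil>
     in core_index D m 1)"

text \<open>Double counting of the pairs in \<open>G'\<close> and \<Gamma> whose product lies in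
  \<open>H\<close>. For fixed \<open>x\<close>, at most \<open>\<eta> * card G\<close>, hence at
  most \<open>\<eta> * k * card G'\<close>, elements \<open>g\<close> of \<open>G'\<close> fail;
  averaging over \<open>g\<close> gives a good one.\<close>

lemma exists_coset_dense:
  fixes G :: "('a::field^'n^'n) set"
  assumes G: "matrix_group G" and "\<Gamma> \<subseteq> G" "G' \<subseteq> G" "G' \<noteq> {}" "H \<subseteq> G"
    and \<eta>: "(1 - \<eta>) * real (card G) \<le> real (card H)" "\<eta> \<ge> 0" "card G \<le> k * card G'"
  obtains g where "g \<in> G'" "(1 - \<eta> * k) * card \<Gamma> \<le> card {x\<in>\<Gamma>. g ** x \<in> H}"
proof -
  have fin: "finite G" "finite G'" "finite \<Gamma>" "finite H"
    using mg_finite[OF G] assms(2,3,5) finite_subset by auto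
  have each: "(1 - \<eta> * k) * card G' \<le> card {g\<in>G'. g ** x \<in> H}" if x: "x \<in> \<Gamma>" for x
  proof -
    have xG: "x \<in> G" using x assms(2) by blast
    have inj: "inj_on (\<lambda>g. g ** x) S" for S
      by (rule inj_onI) (metis mg_inv_cancel_right(1)[OF G xG])
    have sub: "(\<lambda>g. g ** x) ` G' \<subseteq> G" using assms(3) mg_mult[OF G _ xG] by blast
    have split: "card G' = card {g\<in>G'. g ** x \<in> H} + card {g\<in>G'. g ** x \<notin> H}"
    proof -
      have "G' = {g\<in>G'. g ** x \<in> H} \<union> {g\<in>G'. g ** x \<notin> H}" by auto
      then have "card G' = card ({g\<in>G'. g ** x \<in> H} \<union> {g\<in>G'. g ** x \<notin> H})" by (rule arg_cong)
      also have "\<dots> = card {g\<in>G'. g ** x \<in> H} + card {g\<in>G'. g ** x \<notin> H}"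
        by (rule card_Un_disjoint) (use fin in auto)
      finally show ?thesis .
    qed
    have "card {g\<in>G'. g ** x \<notin> H} = card ((\<lambda>g. g ** x) ` {g\<in>G'. g ** x \<notin> H})"
      by (simp add: card_image[OF inj])
    also have "\<dots> \<le> card (G - H)" using sub fin by (intro card_mono) auto
    also have "\<dots> = card G - card H" using assms(5) fin by (simp add: card_Diff_subset)
    finally have "real (card {g\<in>G'. g ** x \<notin> H}) \<le> real (card G) - real (card H)"
      using card_mono[OF fin(1) assms(5)] by linarith
    also have "\<dots> \<le> \<eta> * card G" using \<eta>(1) by (simp add: algebra_simps)
    also have "\<dots> \<le> \<eta> * (k * card G')" using \<eta>(2,3) by (intro mult_left_mono) (simp_all flip: of_nat_mult)
    finally show ?thesis using split by (simp add: algebra_simps)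
  qed
  have swap: "(\<Sum>g\<in>G'. real (card {x\<in>\<Gamma>. g ** x \<in> H})) = (\<Sum>x\<in>\<Gamma>. real (card {g\<in>G'. g ** x \<in> H}))"
  proof -
    have cnt: "real (card {z\<in>Z. Q z}) = (\<Sum>z\<in>Z. of_bool (Q z))" if "finite Z" for Z :: "('a^'n^'n) set" and Q
      using sum.inter_filter[OF that, of "\<lambda>_. 1::real" Q] by (simp add: of_bool_def)
    show ?thesis by (simp only: cnt[OF fin(3)] cnt[OF fin(2)] sum.swap[of _ G' \<Gamma>])
  qed
  have "\<exists>g\<in>G'. (1 - \<eta> * k) * card \<Gamma> \<le> card {x\<in>\<Gamma>. g ** x \<in> H}"
  proof (rule ccontr)
    assume no: "\<not> ?thesis"
    have "(\<Sum>g\<in>G'. real (card {x\<in>\<Gamma>. g ** x \<in> H})) < (\<Sum>g\<in>G'. (1 - \<eta> * k) * card \<Gamma>)"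
    proof (rule sum_strict_mono[OF fin(2) assms(4)])
      show "real (card {x\<in>\<Gamma>. g ** x \<in> H}) < (1 - \<eta> * k) * card \<Gamma>" if "g \<in> G'" for g
        by (rule not_le_imp_less, rule notI, rule notE[OF no], rule bexI[OF _ that])
    qed
    also have "\<dots> = (\<Sum>x\<in>\<Gamma>. (1 - \<eta> * k) * card G')" by simp
    also have "\<dots> \<le> (\<Sum>x\<in>\<Gamma>. real (card {g\<in>G'. g ** x \<in> H}))" by (intro sum_mono each)
    finally show False using swap by simp
  qed
  then show thesis using that by blast
qed

lemma card_fibre_ge:
  fixes \<delta> N :: real
  assumes "finite Y" "finite P" "F ` Y \<subseteq> P" "card P \<le> N" "0 < \<delta>" "\<delta> \<le> card Y"
  obtains f where "f \<in> P" "\<delta> / N \<le> card {y\<in>Y. F y = f}"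
proof -
  have "Y \<noteq> {}" using assms(5,6) by auto
  then have P: "P \<noteq> {}" using assms(3) by blast
  then have N: "N > 0" using assms(2,4) by (metis card_gt_0_iff less_le_trans of_nat_0_less_iff)
  have "\<exists>f\<in>P. \<delta> / N \<le> card {y\<in>Y. F y = f}"
  proof (rule ccontr)
    assume no: "\<not> ?thesis"
    have "Y = (\<Union>f\<in>P. {y\<in>Y. F y = f})" using assms(3) by auto
    then have "card Y = card (\<Union>f\<in>P. {y\<in>Y. F y = f})" by (rule arg_cong)
    also have "\<dots> \<le> (\<Sum>f\<in>P. card {y\<in>Y. F y = f})" by (rule card_UN_le[OF assms(2)])
    finally have "real (card Y) \<le> real (\<Sum>f\<in>P. card {y\<in>Y. F y = f})" by (rule of_nat_mono)
    then have "real (card Y) \<le> (\<Sum>f\<in>P. real (card {y\<in>Y. F y = f}))" by simp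
    also have "\<dots> < (\<Sum>f\<in>P. \<delta> / N)"
    proof (rule sum_strict_mono[OF assms(2) P])
      show "real (card {y\<in>Y. F y = f}) < \<delta> / N" if "f \<in> P" for f
        by (rule not_le_imp_less, rule notI, rule notE[OF no], rule bexI[OF _ that])
    qed
    also have "\<dots> = card P * (\<delta> / N)" by simp
    also have "\<dots> \<le> N * (\<delta> / N)" using assms(4,5) N by (intro mult_right_mono) auto
    also have "\<dots> = \<delta>" using N by simp
    finally show False using assms(6) by simp
  qed
  then show thesis using that by blast
qed

text \<open>Semisimplicity is assumed for every subgroup normalized by \<open>G\<close>, because the
  one to which it is applied is constructed only in the proof.\<close>

theorem card_le_group_bound:
  fixes G :: "('a::alg_closed_field^'n^'n) set"
  assumes G: "matrix_group G" and H: "H \<subseteq> G" "(1 - \<eta>) * real (card G) \<le> real (card H)"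
    and \<eta>: "0 \<le> \<eta>" "\<eta> * fact CARD('n) < 1"
    and N: "real (card (rev_char_poly ` H)) \<le> N"
    and ss: "\<And>\<Gamma>. matrix_group \<Gamma> \<Longrightarrow> \<Gamma> \<subseteq> G \<Longrightarrow> (\<And>g x. g \<in> G \<Longrightarrow> x \<in> \<Gamma> \<Longrightarrow> g ** x ** minv g \<in> \<Gamma>) \<Longrightarrow>
      vec.span (\<Union>{X. simple_submod \<Gamma> X}) = UNIV"
  shows "card G \<le> group_bound CARD('n) \<eta> N"
proof -
  define n where "n = CARD('n)"
  define D where "D = (n^2 + 1)^n"
  define \<delta> where "\<delta> = 1 - \<eta> * fact n"
  define m where "m = nat \<lceil>max (coset_index D (\<delta> / N)) (coset_index D (1 / real ((n + 1)^n)))\<rceil>"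
  have \<delta>: "\<delta> > 0" using \<eta> by (simp add: \<delta>_def n_def)
  have m: "coset_index D (\<delta> / N) \<le> m" "coset_index D (1 / real ((n + 1)^n)) \<le> m"
    unfolding m_def by (meson max.cobounded1 max.cobounded2 order_trans real_nat_ceiling_ge)+
  obtain \<Gamma> where \<Gamma>: "matrix_group \<Gamma>" "\<Gamma> \<subseteq> G" "\<And>g x. g \<in> G \<Longrightarrow> x \<in> \<Gamma> \<Longrightarrow> g ** x ** minv g \<in> \<Gamma>"
    "card G \<le> core_index D m 1 * card \<Gamma>" "connected_level n m \<Gamma>"
    using connected_normal_subgroup[OF G, of n m] unfolding D_def n_def by metis
  define G' where "G' = {g\<in>G. \<forall>X. simple_submod \<Gamma> X \<longrightarrow> (\<lambda>a. g ** a ** minv g) ` ann \<Gamma> X = ann \<Gamma> X}"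
  have G'G: "G' \<subseteq> G" by (auto simp: G'_def)
  have idx: "card G \<le> fact n * card G'"
    unfolding n_def G'_def by (rule stabilizer_of_simple_anns[OF G \<Gamma>(1,3)])
  then have "G' \<noteq> {}" using mg_card_pos[OF G] by auto
  from exists_coset_dense[OF G \<Gamma>(2) G'G this H \<eta>(1) idx]
  obtain g where g: "g \<in> G'" "\<delta> * card \<Gamma> \<le> card {x\<in>\<Gamma>. g ** x \<in> H}"
    by (auto simp: \<delta>_def)
  have gG: "g \<in> G" using g(1) G'G by blast
  have finH: "finite H" using H(1) mg_finite[OF G] finite_subset by blast
  obtain f where f: "f \<in> rev_char_poly ` H"
    "\<delta> * card \<Gamma> / N \<le> card {y \<in> {x\<in>\<Gamma>. g ** x \<in> H}. rev_char_poly (g ** y) = f}"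
    by (rule card_fibre_ge[of "{x\<in>\<Gamma>. g ** x \<in> H}" "rev_char_poly ` H" "\<lambda>x. rev_char_poly (g ** x)" N "\<delta> * card \<Gamma>"])
      (use mg_finite[OF \<Gamma>(1)] finH N \<delta> mg_card_pos[OF \<Gamma>(1)] g(2) in auto)
  have Npos: "N > 0"
  proof -
    have "card (rev_char_poly ` H) > 0" using f(1) finH by (auto simp: card_gt_0_iff)
    then show ?thesis using N by linarith
  qed
  \<comment> \<open>Equality with \<open>f\<close> is tested by values: for each \<open>t\<close>
    the value at \<open>t\<close> gives one condition of degree at most \<open>n\<close> on
    \<open>x\<close>.\<close>
  define S where "S = (\<lambda>t x. poly (rev_char_poly (g ** x)) t - poly f t) ` UNIV"
  have S: "S \<subseteq> poly_maps n"
  proof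
    fix h assume "h \<in> S"
    then obtain t where h: "h = (\<lambda>x. poly (rev_char_poly (g ** x)) t - poly f t)" by (auto simp: S_def)
    have "(\<lambda>x. poly (rev_char_poly (g ** x ** mat 1)) t) \<in> poly_maps n"
      unfolding n_def by (rule poly_maps_translate[OF rev_char_poly_in_poly_maps])
    then show "h \<in> poly_maps n" unfolding h by (intro poly_maps_diff poly_maps_const) simp
  qed
  have const: "poly (rev_char_poly (g ** x)) t = poly f t" if "x \<in> \<Gamma>" for x t
  proof -
    have "(\<lambda>x. poly (rev_char_poly (g ** x)) t - poly f t) x = 0"
    proof (rule connected_dense_vanishing[OF \<Gamma>(1,5) S, where \<delta> = "\<delta> / N"
          and f = "\<lambda>x. poly (rev_char_poly (g ** x)) t - poly f t" and x = x])
      have "{y \<in> {x\<in>\<Gamma>. g ** x \<in> H}. rev_char_poly (g ** y) = f} \<subseteq> {x\<in>\<Gamma>. \<forall>h\<in>S. h x = 0}"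
        by (auto simp: S_def)
      then have "card {y \<in> {x\<in>\<Gamma>. g ** x \<in> H}. rev_char_poly (g ** y) = f} \<le> card {x\<in>\<Gamma>. \<forall>h\<in>S. h x = 0}"
        using mg_finite[OF \<Gamma>(1)] by (intro card_mono) auto
      then show "\<delta> / N * card \<Gamma> \<le> card {x\<in>\<Gamma>. \<forall>h\<in>S. h x = 0}" using f(2) by simp
      show "coset_index ((CARD('n)^2 + 1)^n) (\<delta> / N) \<le> m" using m(1) by (simp add: D_def n_def)
    qed (use \<delta> Npos that in \<open>auto simp: S_def\<close>)
    then show ?thesis by simp
  qed
  obtain h0 :: "'a^'n^'n" where h0: "f = rev_char_poly h0" using f(1) by blast
  have "coeff f 0 = 1" by (simp add: h0 coeff_0_rev_char_poly)
  then have f0: "f \<noteq> 0" by auto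
  have degf: "degree f \<le> n" by (simp add: h0 degree_rev_char_poly n_def)
  \<comment> \<open>The only possible nonzero eigenvalues of the matrices \<open>g ** x\<close> with
    \<open>x\<close> in \<Gamma>, as these share the polynomial \<open>f\<close>.\<close>
  define \<Lambda> where "\<Lambda> = inverse ` {t. poly f t = 0}"
  have \<Lambda>: "finite \<Lambda>" "card \<Lambda> \<le> n"
  proof -
    show "finite \<Lambda>" by (simp add: \<Lambda>_def poly_roots_finite[OF f0])
    have "card \<Lambda> \<le> card {t. poly f t = 0}" unfolding \<Lambda>_def by (rule card_image_le[OF poly_roots_finite[OF f0]])
    then show "card \<Lambda> \<le> n" using card_poly_roots_bound[OF f0] degf by linarith
  qed
  have eig: "\<mu> \<in> \<Lambda>" if "x \<in> \<Gamma>" "\<mu> \<noteq> 0" "v \<noteq> 0" "(g ** x) *v v = \<mu> *s v" for x \<mu> v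
  proof -
    have "inverse \<mu> *s ((g ** x) *v v) = v" using that by simp
    then have "poly (rev_char_poly (g ** x)) (inverse \<mu>) = 0"
      using that(3) unfolding rev_char_poly_root_eigenvector by blast
    then have "poly f (inverse \<mu>) = 0" using const[OF that(1)] by simp
    then show ?thesis unfolding \<Lambda>_def by (force intro: image_eqI[of _ _ "inverse \<mu>"])
  qed
  have conj: "minv g ** x ** g \<in> \<Gamma>" if "x \<in> \<Gamma>" for x
    using \<Gamma>(3)[OF mg_inv[OF G gG] that] by (simp add: mg_inv_inv[OF G gG])
  have trivial: "\<gamma> *v x = x" if \<gamma>: "\<gamma> \<in> \<Gamma>" and X: "simple_submod \<Gamma> X" "x \<in> X" for \<gamma> X x
  proof -
    have im: "(\<lambda>a. g ** a ** minv g) ` ann \<Gamma> X = ann \<Gamma> X" using g(1) X(1) by (simp add: G'_def)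
    have ann1: "g ** a ** minv g \<in> ann \<Gamma> X" if "a \<in> ann \<Gamma> X" for a using im that by blast
    have ann2: "minv g ** a ** g \<in> ann \<Gamma> X" if a: "a \<in> ann \<Gamma> X" for a
    proof -
      obtain b where b: "b \<in> ann \<Gamma> X" "a = g ** b ** minv g" using im a by blast
      have "minv g ** a ** g = (minv g ** g) ** b ** (minv g ** g)" by (simp only: b(2) matrix_mul_assoc)
      then show ?thesis using b(1) by (simp add: mg_left[OF G gG])
    qed
    obtain W where W: "simple_submod \<Gamma> W" "\<And>w. w \<in> W \<Longrightarrow> g *v w \<in> W" "ann \<Gamma> W \<subseteq> ann \<Gamma> X"
      using simple_submod_stable[OF \<Gamma>(1) X(1) mg_left[OF G gG] \<Gamma>(3)[OF gG] conj ann1 ann2] by metis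
    have Ws: "vec.subspace W" "submod \<Gamma> W" using W(1) by (auto simp: simple_submod_def submod_def)
    obtain P where P: "\<And>v. P *v v \<in> W" "\<And>w. w \<in> W \<Longrightarrow> P *v w = w" using exists_projection[OF Ws(1)] by blast
    define V where "V = sum_list ` {xs. set xs \<subseteq> insert 0 \<Lambda> \<and> length xs = n}"
    \<comment> \<open>An eigenvector of \<open>g ** y ** P\<close> for a nonzero eigenvalue lies in
      \<open>W\<close>, where \<open>P\<close> is the identity. So the eigenvalue is one of
      \<open>g ** y\<close>, and the projection adds at most the eigenvalue 0.\<close>
    have trV: "trace (g ** y ** P) \<in> V" if y: "y \<in> \<Gamma>" for y
      unfolding V_def n_def
    proof (rule trace_sum_of_eigenvalues)
      fix \<mu> v assume v: "\<mu> \<noteq> 0" "v \<noteq> 0" "(g ** y ** P) *v v = \<mu> *s v"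
      have "(g ** y ** P) *v v = g *v (y *v (P *v v))" by (simp add: matrix_vector_mul_assoc matrix_mul_assoc)
      also have "\<dots> \<in> W" using P(1) W(2) Ws(2) y by (simp add: submod_def)
      finally have "inverse \<mu> *s (\<mu> *s v) \<in> W" unfolding v(3) by (rule vec.subspace_scale[OF Ws(1)])
      then have "v \<in> W" using v(1) by simp
      then have "(g ** y) *v v = \<mu> *s v" using v(3) P(2) by (simp flip: matrix_vector_mul_assoc)
      then show "\<mu> \<in> \<Lambda>" using eig[OF y v(1,2)] by blast
    qed
    have "(\<lambda>x. trace (g ** x ** P)) \<in> poly_maps n"
    proof -
      have "(\<lambda>x::'a^'n^'n. trace x) \<in> affine_funs"
        unfolding trace_def by (intro affine_sum affine_entry)
      then have "(\<lambda>x::'a^'n^'n. trace x) \<in> poly_maps n"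
        using affine_subset_poly_maps[of n] by (auto simp: n_def Suc_le_eq)
      then show ?thesis by (rule poly_maps_translate)
    qed
    then have trc: "trace (g ** y ** P) = trace (g ** mat 1 ** P)" if "y \<in> \<Gamma>" for y
      by (rule connected_few_values_const[OF \<Gamma>(1,5), of _ V "(n + 1)^n"])
        (use card_sum_lists[OF \<Lambda>] trV m(2) that in \<open>auto simp: V_def D_def n_def\<close>)
    have "\<gamma> *v w = w" if "w \<in> W" for w
      by (rule constant_twisted_trace_trivial[OF \<Gamma>(1) W(1) mg_left[OF G gG] W(2) P trc \<gamma> that])
    \<comment> \<open>Triviality is known on \<open>W\<close> and wanted on \<open>X\<close>, which
      need not be stable under \<open>g\<close>; the inclusion of annihilators carries it
      over.\<close>
    then have "\<gamma> - mat 1 \<in> ann \<Gamma> W"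
      using mspan_diff[OF mspan_base[OF \<gamma>] mspan_group_one[OF \<Gamma>(1)]]
      by (simp add: ann_def matrix_vector_mult_diff_rdistrib)
    then have "(\<gamma> - mat 1) *v x = 0" using W(3) annD X(2) by blast
    then show ?thesis by (simp add: matrix_vector_mult_diff_rdistrib)
  qed
  have "\<gamma> = mat 1" if \<gamma>: "\<gamma> \<in> \<Gamma>" for \<gamma>
  proof -
    have "\<gamma> *v v = mat 1 *v v" for v
    proof -
      have "v \<in> vec.span (\<Union>{X. simple_submod \<Gamma> X})" using ss[OF \<Gamma>(1-3)] by simp
      then have "\<gamma> *v v = v"
      proof (induction rule: vec.span_induct_alt)
        case (step c x y)
        then show ?case using trivial[OF \<gamma>] by (auto simp: matrix_vector_right_distrib matrix_vector_smult)
      qed simp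
      then show ?thesis by simp
    qed
    then show ?thesis unfolding matrix_eq by blast
  qed
  then have "\<Gamma> \<subseteq> {mat 1}" by blast
  then have "card \<Gamma> \<le> 1" using card_mono[of "{mat 1}" \<Gamma>] by simp
  then have "core_index D m 1 * card \<Gamma> \<le> core_index D m 1 * 1" by (rule mult_left_mono) simp
  then have "card G \<le> core_index D m 1" using \<Gamma>(4) by linarith
  then show ?thesis by (simp add: group_bound_def m_def D_def \<delta>_def n_def Let_def)
qed

section \<open>Descent from the algebraic closure of a finite field\<close>

definition vec_ac :: "'k::field^'n \<Rightarrow> 'k alg_closure^'n" where
  "vec_ac v = (\<chi> i. to_ac (v $ i))"

text \<open>Semilinear rather than linear. The exponent is the size of the base field, so that
  exactly the vectors over this field are fixed.\<close>

definition frob :: "'k::finite_field alg_closure^'n \<Rightarrow> 'k alg_closure^'n" where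
  "frob v = (\<chi> i. (v $ i) ^ CARD('k))"

lemma vec_ac_mult: "vec_ac (A *v v) = map_matrix to_ac A *v vec_ac v"
  by (simp add: vec_ac_def vec_eq_iff matrix_vector_mult_def to_ac_sum)

lemma map_matrix_to_ac_mult: "map_matrix to_ac (A ** B) = map_matrix to_ac A ** map_matrix to_ac B"
  by (simp add: vec_eq_iff matrix_matrix_mult_def to_ac_sum)

lemma map_matrix_to_ac_one: "map_matrix to_ac (mat 1) = mat 1"
  by (simp add: vec_eq_iff mat_def)

lemma inj_map_matrix_to_ac: "inj (map_matrix to_ac)"
  by (rule injI) (simp add: vec_eq_iff)

lemma vec_ac_add: "vec_ac (v + w) = vec_ac v + vec_ac w"
  and vec_ac_smult: "vec_ac (c *s v) = to_ac c *s vec_ac v"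
  and vec_ac_eq_iff: "vec_ac v = vec_ac w \<longleftrightarrow> v = w"
  and vec_ac_zero: "vec_ac 0 = 0"
  by (simp_all add: vec_ac_def vec_eq_iff)

lemma matrix_group_map_to_ac:
  assumes "matrix_group G"
  shows "matrix_group (map_matrix to_ac ` G)"
  unfolding matrix_group_def
proof (intro conjI ballI)
  show "finite (map_matrix to_ac ` G)" using mg_finite[OF assms] by simp
  show "mat 1 \<in> map_matrix to_ac ` G"
    using mg_one[OF assms] map_matrix_to_ac_one by (metis imageI)
  show "x ** y \<in> map_matrix to_ac ` G" if "x \<in> map_matrix to_ac ` G" "y \<in> map_matrix to_ac ` G" for x y
    using that mg_mult[OF assms] by (auto simp flip: map_matrix_to_ac_mult)
  show "\<exists>y\<in>map_matrix to_ac ` G. y ** x = mat 1" if x: "x \<in> map_matrix to_ac ` G" for x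
  proof -
    obtain g where g: "g \<in> G" "x = map_matrix to_ac g" using x by blast
    have "map_matrix to_ac (minv g) ** x = mat 1"
      by (simp add: g(2) mg_left[OF assms g(1)] map_matrix_to_ac_one flip: map_matrix_to_ac_mult)
    then show ?thesis using mg_inv[OF assms g(1)] by blast
  qed
qed

section \<open>Frobenius stability and rational vectors\<close>

context
  assumes q: "\<exists>r k. Factorial_Ring.prime r \<and> CARD('k::finite_field) = r ^ k"
begin

lemma card_eq_CHAR_power: "\<exists>k. CARD('k) = CHAR('k) ^ k"
proof -
  obtain r k where r: "Factorial_Ring.prime r" "CARD('k) = r ^ k" using q by blast
  have "CHAR('k) dvd r ^ k" using CHAR_dvd_CARD[where 'a = 'k] r(2) by simp
  then have "CHAR('k) dvd r" using CHAR_prime[where 'a = 'k] prime_dvd_power by blast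
  then have "CHAR('k) = r" using r(1) CHAR_prime[where 'a = 'k] primes_dvd_imp_eq by blast
  then show ?thesis using r(2) by blast
qed

lemma power_card_add: "((x :: 'k alg_closure) + y) ^ CARD('k) = x ^ CARD('k) + y ^ CARD('k)"
proof -
  obtain k where "CARD('k) = CHAR('k alg_closure) ^ k" using card_eq_CHAR_power by auto
  moreover have "Factorial_Ring.prime CHAR('k alg_closure)" using CHAR_prime[where 'a = 'k] by simp
  ultimately show ?thesis by (intro freshmans_dream')
qed

lemma frob_add: "frob (v + w) = frob v + frob (w :: 'k alg_closure^'n)"
  by (simp add: frob_def vec_eq_iff power_card_add)

lemma frob_smult: "frob (c *s v) = c ^ CARD('k) *s frob (v :: 'k alg_closure^'n)"
  by (simp add: frob_def vec_eq_iff power_mult_distrib)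

lemma frob_zero: "frob (0 :: 'k alg_closure^'n) = 0"
  by (simp add: frob_def vec_eq_iff zero_power)

lemma power_card_sum: "(\<Sum>i\<in>I. f i :: 'k alg_closure) ^ CARD('k) = (\<Sum>i\<in>I. f i ^ CARD('k))"
  by (induction I rule: infinite_finite_induct) (simp_all add: power_card_add zero_power)

lemma frob_mult: "frob (map_matrix to_ac A *v v) = map_matrix to_ac A *v frob (v :: 'k alg_closure^'n)"
proof -
  have "to_ac a ^ CARD('k) = to_ac a" for a :: 'k
    by (metis finite_field_power_card_eq_same to_ac_power)
  then show ?thesis
    by (simp add: frob_def vec_eq_iff matrix_vector_mult_def power_card_sum power_mult_distrib)
qed

lemma frob_vec_ac: "frob (vec_ac v) = vec_ac (v :: 'k^'n)"
  by (simp add: frob_def vec_ac_def vec_eq_iff finite_field_power_card_eq_same flip: to_ac_power)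

lemma exists_root_card: "\<exists>y. y ^ CARD('k) = (x :: 'k alg_closure)"
  using nth_root_exists[of "CARD('k)" x] by auto

lemma surj_frob: "surj (frob :: 'k alg_closure^'n \<Rightarrow> _)"
proof (rule surjI)
  fix v :: "'k alg_closure^'n"
  show "frob (\<chi> i. SOME y. y ^ CARD('k) = v $ i) = v"
    using someI_ex[OF exists_root_card] by (simp add: frob_def vec_eq_iff)
qed

lemma frob_eq_0_iff: "frob v = 0 \<longleftrightarrow> v = (0 :: 'k alg_closure^'n)"
  by (simp add: frob_def vec_eq_iff)

text \<open>\<open>X^q - X\<close> has at most \<open>q\<close> roots, and the \<open>q\<close>
  elements of the base field are already roots.\<close>

lemma fixed_imp_in_range:
  assumes "(x :: 'k alg_closure) ^ CARD('k) = x"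
  shows "x \<in> range to_ac"
proof -
  define p where "p = Polynomial.monom (1 :: 'k alg_closure) CARD('k) - Polynomial.monom 1 1"
  have "CARD('k) > 1"
    using card_mono[of "UNIV :: 'k set" "{0, 1}"] by simp
  then have "coeff p CARD('k) = 1" by (simp add: p_def)
  then have p: "p \<noteq> 0" by auto
  have roots: "poly p y = 0 \<longleftrightarrow> y ^ CARD('k) = y" for y by (simp add: p_def poly_monom)
  have sub: "range to_ac \<subseteq> {y. poly p y = 0}"
    unfolding roots by (auto simp: finite_field_power_card_eq_same simp flip: to_ac_power)
  have "degree p \<le> CARD('k)"
    unfolding p_def by (intro degree_diff_le degree_monom_le order_trans[OF degree_monom_le]) (use \<open>CARD('k) > 1\<close> in simp)
  then have "card {y. poly p y = 0} \<le> CARD('k)" using card_poly_roots_bound[OF p] by linarith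
  also have "\<dots> = card (range (to_ac :: 'k \<Rightarrow> _))" by (simp add: card_image inj_to_ac)
  finally have "range to_ac = {y. poly p y = 0}"
    using card_seteq[OF poly_roots_finite[OF p] sub] by blast
  then show ?thesis using assms roots by blast
qed

text \<open>
  A vector \<open>u\<close> of minimal support with a coordinate \<open>1\<close> is fixed by Frobenius, since \<open>frob u - u\<close> has
  smaller support.
\<close>

lemma frob_stable_contains_rational:
  fixes S :: "('k alg_closure^'n) set"
  assumes S: "vec.subspace S" "\<And>v. v \<in> S \<Longrightarrow> frob v \<in> S" and "v0 \<in> S" "v0 \<noteq> 0"
  obtains w where "w \<noteq> 0" "vec_ac w \<in> S"
proof -
  define supp where "supp v = {i. v $ i \<noteq> 0}" for v :: "'k alg_closure^'n"
  obtain v where v: "v \<in> S" "v \<noteq> 0" "\<And>u. u \<in> S \<Longrightarrow> u \<noteq> 0 \<Longrightarrow> card (supp v) \<le> card (supp u)"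
    using ex_has_least_nat[of "\<lambda>v. v \<in> S \<and> v \<noteq> 0" v0 "\<lambda>v. card (supp v)"] assms(3,4) by blast
  obtain k where k: "v $ k \<noteq> 0" using v(2) by (auto simp: vec_eq_iff)
  define u where "u = inverse (v $ k) *s v"
  have u: "u \<in> S" "u $ k = 1" "supp u = supp v"
    using v(1) k vec.subspace_scale[OF S(1)] by (auto simp: u_def supp_def)
  have "frob u = u"
  proof (rule ccontr)
    assume "frob u \<noteq> u"
    then have "frob u - u \<noteq> 0" by simp
    moreover have "frob u - u \<in> S" using vec.subspace_diff[OF S(1) S(2)[OF u(1)] u(1)] .
    ultimately have "card (supp u) \<le> card (supp (frob u - u))" using v(3) u(3) by simp
    moreover have "supp (frob u - u) \<subset> supp u"
    proof
      show "supp (frob u - u) \<subseteq> supp u" by (auto simp: supp_def frob_def zero_power)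
      have "k \<in> supp u" "k \<notin> supp (frob u - u)" by (simp_all add: supp_def u(2) frob_def)
      then show "supp (frob u - u) \<noteq> supp u" by blast
    qed
    then have "card (supp (frob u - u)) < card (supp u)" by (intro psubset_card_mono) auto
    ultimately show False by simp
  qed
  then have "u $ i \<in> range to_ac" for i by (intro fixed_imp_in_range) (metis frob_def vec_lambda_beta)
  then have "vec_ac (\<chi> i. of_ac (u $ i)) = u" by (simp add: vec_ac_def vec_eq_iff to_ac_of_ac)
  moreover have "u \<noteq> 0" using u(2) by auto
  ultimately show thesis using that[of "\<chi> i. of_ac (u $ i)"] u(1) vec_ac_zero by metis
qed

text \<open>A projection onto \<open>W\<close> with entries in the base field still fixes the span
  of \<open>W\<close> over the closure. A rational vector of this span is thus fixed by the
  projection and lies in \<open>W\<close>.\<close>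

lemma vec_ac_span_descend:
  fixes W :: "('k^'n) set"
  assumes "vec.subspace W" "vec_ac w \<in> vec.span (vec_ac ` W)"
  shows "w \<in> W"
proof -
  obtain P :: "'k^'n^'n" where P: "\<And>v. P *v v \<in> W" "\<And>w. w \<in> W \<Longrightarrow> P *v w = w"
    using exists_projection[OF assms(1)] by blast
  have "map_matrix to_ac P *v y = y" if "y \<in> vec.span (vec_ac ` W)" for y
    using that
  proof (induction rule: vec.span_induct_alt)
    case (step c x y)
    then obtain w where "w \<in> W" "x = vec_ac w" by blast
    then have "map_matrix to_ac P *v x = x" using P(2) by (simp flip: vec_ac_mult)
    then show ?case using step(2) by (simp add: matrix_vector_right_distrib matrix_vector_smult)
  qed simp
  from this[OF assms(2)] have "P *v w = w" by (simp add: vec_ac_eq_iff flip: vec_ac_mult)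
  then show ?thesis using P(1)[of w] by simp
qed

text \<open>Frobenius commutes with matrices over the base field. A scalar acting on the image comes
  from its \<open>q\<close>-th root acting on \<open>U\<close>.\<close>

lemma frob_image_submod:
  fixes U :: "('k alg_closure^'n) set"
  assumes \<Gamma>: "\<Gamma> \<subseteq> range (map_matrix to_ac)" and U: "submod \<Gamma> U"
  shows "submod \<Gamma> (frob ` U)" "submod \<Gamma> (frob -` U)"
proof -
  have Us: "vec.subspace U" using U by (simp add: submod_def)
  show "submod \<Gamma> (frob ` U)"
    unfolding submod_def vec.subspace_def
  proof (intro conjI ballI allI)
    show "0 \<in> frob ` U" using vec.subspace_0[OF Us] frob_zero by (metis imageI)
    show "x + y \<in> frob ` U" if "x \<in> frob ` U" "y \<in> frob ` U" for x y
      using that vec.subspace_add[OF Us] by (auto simp flip: frob_add)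
    show "c *s x \<in> frob ` U" if x: "x \<in> frob ` U" for c x
    proof -
      obtain u where "u \<in> U" "x = frob u" using x by blast
      moreover obtain y where "y ^ CARD('k) = c" using exists_root_card by blast
      ultimately have "c *s x = frob (y *s u)" "y *s u \<in> U"
        using vec.subspace_scale[OF Us] by (simp_all add: frob_smult)
      then show ?thesis by blast
    qed
    show "g *v w \<in> frob ` U" if g: "g \<in> \<Gamma>" "w \<in> frob ` U" for g w
    proof -
      obtain u where u: "u \<in> U" "w = frob u" using g(2) by blast
      obtain A where A: "g = map_matrix to_ac A" using \<Gamma> g(1) by blast
      have "g *v w = frob (g *v u)" by (simp add: u(2) A frob_mult)
      moreover have "g *v u \<in> U" using U g(1) u(1) by (simp add: submod_def)
      ultimately show ?thesis by blast
    qed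
  qed
  show "submod \<Gamma> (frob -` U)"
    unfolding submod_def vec.subspace_def
  proof (intro conjI ballI allI)
    show "g *v w \<in> frob -` U" if g: "g \<in> \<Gamma>" "w \<in> frob -` U" for g w
    proof -
      obtain A where A: "g = map_matrix to_ac A" using \<Gamma> g(1) by blast
      have "frob (g *v w) = g *v frob w" by (simp add: A frob_mult)
      then show ?thesis using U g by (simp add: submod_def)
    qed
  qed (use Us in \<open>simp_all add: frob_zero frob_add frob_smult vec.subspace_0 vec.subspace_add vec.subspace_scale\<close>)
qed

lemma frob_image_simple_submod:
  fixes X :: "('k alg_closure^'n) set"
  assumes \<Gamma>: "\<Gamma> \<subseteq> range (map_matrix to_ac)" and X: "simple_submod \<Gamma> X"
  shows "simple_submod \<Gamma> (frob ` X)"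
  unfolding simple_submod_def
proof (intro conjI allI impI)
  have Xs: "submod \<Gamma> X" "X \<noteq> {0}" using X by (simp_all add: simple_submod_def)
  show "submod \<Gamma> (frob ` X)" by (rule frob_image_submod(1)[OF \<Gamma> Xs(1)])
  have "0 \<in> X" using Xs(1) by (simp add: submod_def vec.subspace_0)
  then obtain x where "x \<in> X" "x \<noteq> 0" using Xs(2) by blast
  then have "frob x \<in> frob ` X" "frob x \<noteq> 0" by (simp_all add: frob_eq_0_iff)
  then show "frob ` X \<noteq> {0}" by blast
  fix U assume U: "submod \<Gamma> U \<and> U \<subseteq> frob ` X"
  have surj: "frob ` (frob -` U) = U" by (rule surj_image_vimage_eq[OF surj_frob])
  have inj: "x = y" if "frob x = frob y" for x y :: "'k alg_closure^'n"
  proof -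
    have "frob (x - y) + frob y = frob x" by (simp flip: frob_add)
    then have "frob (x - y) = 0" using that by simp
    then show ?thesis by (simp add: frob_eq_0_iff)
  qed
  have "frob -` U \<subseteq> X" using U inj by blast
  then have "frob -` U = {0} \<or> frob -` U = X"
    using X frob_image_submod(2)[OF \<Gamma>] U by (simp add: simple_submod_def)
  then have "frob ` (frob -` U) = frob ` {0} \<or> frob ` (frob -` U) = frob ` X" by (elim disjE) simp_all
  then show "U = {0} \<or> U = frob ` X" unfolding surj by (simp add: frob_zero)
qed

lemma frob_stable_span:
  fixes Y :: "('k alg_closure^'n) set"
  assumes "\<And>y. y \<in> Y \<Longrightarrow> frob y \<in> vec.span Y" "v \<in> vec.span Y"
  shows "frob v \<in> vec.span Y"
  using assms(2)
proof (induction rule: vec.span_induct_alt)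
  case (step c x y)
  then show ?case using assms(1) by (simp add: frob_add frob_smult vec.span_add vec.span_scale)
qed (simp add: frob_zero vec.span_zero)

text \<open>Let \<open>S\<close> be the socle of \<Gamma> over the closure; it is stable under
  \<open>G\<close> and under Frobenius. For a simple \<open>W\<close> over the base field, the
  vectors of \<open>W\<close> lying in \<open>S\<close> form a \<open>G\<close>-submodule. The
  scalar extension of \<open>W\<close> contains a simple \<Gamma>-submodule, so it meets
  \<open>S\<close>, and by Frobenius stability it does so in a rational vector. Hence this submodule
  is nonzero and equals \<open>W\<close>.\<close>

lemma semisimple_descends_to_normal:
  fixes G :: "('k^'n^'n) set"
  assumes G: "matrix_group G"
    and ss: "\<And>W. W \<in> \<W> \<Longrightarrow> simple_submod G W" "vec.span (\<Union>\<W>) = UNIV"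
    and \<Gamma>: "matrix_group \<Gamma>" "\<Gamma> \<subseteq> map_matrix to_ac ` G"
      "\<And>g x. g \<in> map_matrix to_ac ` G \<Longrightarrow> x \<in> \<Gamma> \<Longrightarrow> g ** x ** minv g \<in> \<Gamma>"
  shows "vec.span (\<Union>{X. simple_submod \<Gamma> X}) = UNIV"
proof -
  define S where "S = vec.span (\<Union>{X. simple_submod \<Gamma> X})"
  note G' = matrix_group_map_to_ac[OF G]
  have range: "\<Gamma> \<subseteq> range (map_matrix to_ac)" using \<Gamma>(2) by blast
  have sub: "X \<subseteq> S" if "simple_submod \<Gamma> X" for X
    using that unfolding S_def by (auto intro: vec.span_base)
  have S: "vec.subspace S" by (simp add: S_def)
  have frobS: "frob v \<in> S" if "v \<in> S" for v
    unfolding S_def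
  proof (rule frob_stable_span)
    show "v \<in> vec.span (\<Union>{X. simple_submod \<Gamma> X})" using that by (simp add: S_def)
    fix y assume "y \<in> \<Union>{X. simple_submod \<Gamma> X}"
    then obtain X where "y \<in> X" "simple_submod \<Gamma> X" by blast
    then have "frob y \<in> \<Union>{X. simple_submod \<Gamma> X}" using frob_image_simple_submod[OF range] by blast
    then show "frob y \<in> vec.span (\<Union>{X. simple_submod \<Gamma> X})" by (rule vec.span_base)
  qed
  \<comment> \<open>Clifford's argument: elements normalizing \<Gamma> map simple submodules to
    simple submodules.\<close>
  have GS: "g *v v \<in> S" if g: "g \<in> map_matrix to_ac ` G" and v: "v \<in> S" for g v
    using v unfolding S_def
  proof (induction rule: vec.span_induct_alt)
    case (step c x y)
    then obtain X where X: "x \<in> X" "simple_submod \<Gamma> X" by blast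
    have "minv g ** \<gamma> ** g \<in> \<Gamma>" if "\<gamma> \<in> \<Gamma>" for \<gamma>
      using \<Gamma>(3)[OF mg_inv[OF G' g] that] by (simp add: mg_inv_inv[OF G' g])
    then have "simple_submod \<Gamma> ((*v) g ` X)"
      using simple_submod_translate(1)[OF X(2) mg_left[OF G' g] \<Gamma>(3)[OF g]] by blast
    then have "g *v x \<in> vec.span (\<Union>{X. simple_submod \<Gamma> X})" using X(1) by (intro vec.span_base) blast
    then show ?case using step(2)
      by (simp add: matrix_vector_right_distrib matrix_vector_smult vec.span_add vec.span_scale)
  qed (simp add: vec.span_zero)
  have W: "vec_ac w \<in> S" if W: "W \<in> \<W>" and w: "w \<in> W" for W w
  proof -
    have Ws: "submod G W" "vec.subspace W" "W \<noteq> {0}"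
      using ss(1)[OF W] by (auto simp: simple_submod_def submod_def)
    define U where "U = {w\<in>W. vec_ac w \<in> S}"
    have "submod G U"
      unfolding submod_def vec.subspace_def U_def
      using Ws S GS by (auto simp: vec_ac_add vec_ac_smult vec_ac_zero vec_ac_mult submod_def
          vec.subspace_0 vec.subspace_add vec.subspace_scale)
    define Y where "Y = vec.span (vec_ac ` W)"
    have Y: "submod \<Gamma> Y"
      unfolding submod_def
    proof (intro conjI ballI)
      fix g y assume g: "g \<in> \<Gamma>" and "y \<in> Y"
      obtain A where A: "A \<in> G" "g = map_matrix to_ac A" using \<Gamma>(2) g by blast
      show "g *v y \<in> Y"
        using \<open>y \<in> Y\<close> unfolding Y_def
      proof (induction rule: vec.span_induct_alt)
        case (step c x y)
        then obtain w where "w \<in> W" "x = vec_ac w" by blast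
        then have "g *v x \<in> vec.span (vec_ac ` W)"
          using Ws(1) A by (auto simp: submod_def intro!: vec.span_base simp flip: vec_ac_mult)
        then show ?case using step(2)
          by (simp add: matrix_vector_right_distrib matrix_vector_smult vec.span_add vec.span_scale)
      qed (simp add: vec.span_zero)
    qed (simp add: Y_def)
    have frobY: "frob v \<in> Y" if "v \<in> Y" for v
      unfolding Y_def
      by (rule frob_stable_span) (use that in \<open>auto simp: Y_def frob_vec_ac intro: vec.span_base\<close>)
    have "0 \<in> W" using Ws(2) by (rule vec.subspace_0)
    then obtain w1 where w1: "w1 \<in> W" "w1 \<noteq> 0" using Ws(3) by blast
    then have "vec_ac w1 \<in> Y" "vec_ac w1 \<noteq> 0"
      using vec_ac_eq_iff[of w1 0] by (auto simp: Y_def vec_ac_zero intro: vec.span_base)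
    then have "Y \<noteq> {0}" by blast
    then obtain X where X: "simple_submod \<Gamma> X" "X \<subseteq> Y" using contains_simple_submod[OF Y] by blast
    have "X \<noteq> {0}" "0 \<in> X" using X(1) by (auto simp: simple_submod_def submod_def vec.subspace_0)
    then obtain x where x: "x \<in> X" "x \<noteq> 0" by blast
    have xYS: "x \<in> Y \<inter> S" using x(1) X(2) sub[OF X(1)] by blast
    have YS: "vec.subspace (Y \<inter> S)" using Y S by (simp add: submod_def vec.subspace_inter)
    \<comment> \<open>\<open>x\<close> itself has coordinates in the closure; Frobenius stability of
      the intersection replaces it by a vector over the base field, which can be compared with
      \<open>W\<close>.\<close>
    obtain u where u: "u \<noteq> 0" "vec_ac u \<in> Y \<inter> S"
      by (rule frob_stable_contains_rational[OF YS _ xYS x(2)]) (use frobY frobS in auto)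
    then have "u \<in> W" using vec_ac_span_descend[OF Ws(2)] by (simp add: Y_def)
    then have "u \<in> U" using u by (simp add: U_def)
    then have "U \<noteq> {0}" using u(1) by blast
    moreover have "U \<subseteq> W" by (auto simp: U_def)
    ultimately have "U = W" using ss(1)[OF W] \<open>submod G U\<close> unfolding simple_submod_def by blast
    then show ?thesis using w unfolding U_def by blast
  qed
  have all: "vec_ac v \<in> S" for v
  proof -
    have "v \<in> vec.span (\<Union>\<W>)" by (simp add: ss(2))
    then show ?thesis
    proof (induction rule: vec.span_induct_alt)
      case (step c x y)
      then show ?case using W S by (auto simp: vec_ac_add vec_ac_smult vec.subspace_add vec.subspace_scale)
    qed (simp add: vec_ac_zero vec.subspace_0[OF S])
  qed
  have "cart_basis \<subseteq> S"
  proof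
    fix b :: "'k alg_closure^'n" assume "b \<in> cart_basis"
    then obtain i where "b = axis i 1" by (auto simp: cart_basis_def)
    moreover have "vec_ac (axis i 1) = axis i 1" by (simp add: vec_ac_def vec_eq_iff axis_def)
    ultimately show "b \<in> S" using all by metis
  qed
  then have "vec.span cart_basis \<subseteq> S" by (rule vec.span_minimal[OF _ S])
  then show ?thesis unfolding S_def[symmetric] by (simp add: top_unique)
qed

end

section \<open>Monomial groups and the constant \<open>J\<^sub>3(n)\<close>\<close>

lemma (in abelian_monoid) finsum_swap:
  assumes "finite A" "finite B" "\<And>i j. i \<in> A \<Longrightarrow> j \<in> B \<Longrightarrow> f i j \<in> carrier G"
  shows "(\<Oplus>i\<in>A. \<Oplus>j\<in>B. f i j) = (\<Oplus>j\<in>B. \<Oplus>i\<in>A. f i j)"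
  using assms(1,3)
proof (induction A rule: finite_induct)
  case (insert a A)
  have "(\<Oplus>i\<in>insert a A. \<Oplus>j\<in>B. f i j) = (\<Oplus>j\<in>B. f a j) \<oplus> (\<Oplus>j\<in>B. \<Oplus>i\<in>A. f i j)"
    using insert by (subst finsum_insert) auto
  also have "\<dots> = (\<Oplus>j\<in>B. f a j \<oplus> (\<Oplus>i\<in>A. f i j))"
    using insert by (intro finsum_addf[symmetric]) auto
  also have "\<dots> = (\<Oplus>j\<in>B. \<Oplus>i\<in>insert a A. f i j)"
    using insert by (intro finsum_cong') (auto intro!: finsum_closed)
  finally show ?case .
qed simp

lemma mat_monoid_simps:
  "carrier (mat_monoid n R) = ({..<n} \<times> {..<n}) \<rightarrow>\<^sub>E carrier R"
  "A \<otimes>\<^bsub>mat_monoid n R\<^esub> B = (\<lambda>(i, j)\<in>{..<n} \<times> {..<n}. \<Oplus>\<^bsub>R\<^esub>k\<in>{..<n}. A (i, k) \<otimes>\<^bsub>R\<^esub> B (k, j))"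
  "\<one>\<^bsub>mat_monoid n R\<^esub> = (\<lambda>(i, j)\<in>{..<n} \<times> {..<n}. if i = j then \<one>\<^bsub>R\<^esub> else \<zero>\<^bsub>R\<^esub>)"
  by (simp_all add: mat_monoid_def)

lemma mat_entry_closed:
  "A \<in> carrier (mat_monoid n R) \<Longrightarrow> i < n \<Longrightarrow> j < n \<Longrightarrow> A (i, j) \<in> carrier R"
  by (auto simp: mat_monoid_simps)

lemma mat_eqI:
  assumes "A \<in> carrier (mat_monoid n R)" "B \<in> carrier (mat_monoid n R)"
    "\<And>i j. i < n \<Longrightarrow> j < n \<Longrightarrow> A (i, j) = B (i, j)"
  shows "A = B"
  by (rule PiE_ext[OF assms(1,2)[unfolded mat_monoid_simps]]) (use assms(3) in auto)

lemma (in ring) monoid_mat_monoid: "monoid (mat_monoid n R)"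
proof (rule monoidI)
  let ?M = "mat_monoid n R"
  show closed: "A \<otimes>\<^bsub>?M\<^esub> B \<in> carrier ?M"
    if "A \<in> carrier ?M" "B \<in> carrier ?M" for A B
    using that by (auto simp: mat_monoid_simps intro!: finsum_closed)
  show one: "\<one>\<^bsub>?M\<^esub> \<in> carrier ?M"
    by (auto simp: mat_monoid_simps)
  have entry: "(A \<otimes>\<^bsub>?M\<^esub> B) (i, j) = (\<Oplus>k\<in>{..<n}. A (i, k) \<otimes> B (k, j))" if "i < n" "j < n" for A B i j
    using that by (simp add: mat_monoid_simps)
  fix A B C assume A: "A \<in> carrier ?M"
  note Ac = mat_entry_closed[OF A]
  show "\<one>\<^bsub>?M\<^esub> \<otimes>\<^bsub>?M\<^esub> A = A"
  proof (rule mat_eqI[OF closed[OF one A] A])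
    fix i j assume ij: "i < n" "j < n"
    have "(\<Oplus>k\<in>{..<n}. \<one>\<^bsub>?M\<^esub> (i, k) \<otimes> A (k, j)) = (\<Oplus>k\<in>{..<n}. if i = k then A (k, j) else \<zero>)"
      using ij Ac by (intro finsum_cong') (auto simp: mat_monoid_simps)
    also have "\<dots> = A (i, j)" using ij Ac by (subst add.finprod_singleton) auto
    finally show "(\<one>\<^bsub>?M\<^esub> \<otimes>\<^bsub>?M\<^esub> A) (i, j) = A (i, j)" using ij by (simp add: entry)
  qed
  show "A \<otimes>\<^bsub>?M\<^esub> \<one>\<^bsub>?M\<^esub> = A"
  proof (rule mat_eqI[OF closed[OF A one] A])
    fix i j assume ij: "i < n" "j < n"
    have "(\<Oplus>k\<in>{..<n}. A (i, k) \<otimes> \<one>\<^bsub>?M\<^esub> (k, j)) = (\<Oplus>k\<in>{..<n}. if j = k then A (i, k) else \<zero>)"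
      using ij Ac by (intro finsum_cong') (auto simp: mat_monoid_simps)
    also have "\<dots> = A (i, j)" using ij Ac by (subst add.finprod_singleton) auto
    finally show "(A \<otimes>\<^bsub>?M\<^esub> \<one>\<^bsub>?M\<^esub>) (i, j) = A (i, j)" using ij by (simp add: entry)
  qed
  assume B: "B \<in> carrier ?M" and C: "C \<in> carrier ?M"
  note Bc = mat_entry_closed[OF B] and Cc = mat_entry_closed[OF C]
  show "A \<otimes>\<^bsub>?M\<^esub> B \<otimes>\<^bsub>?M\<^esub> C = A \<otimes>\<^bsub>?M\<^esub> (B \<otimes>\<^bsub>?M\<^esub> C)"
  proof (rule mat_eqI[OF closed[OF closed[OF A B] C] closed[OF A closed[OF B C]]])
    fix i j assume ij: "i < n" "j < n"
    have "(A \<otimes>\<^bsub>?M\<^esub> B \<otimes>\<^bsub>?M\<^esub> C) (i, j) = (\<Oplus>k\<in>{..<n}. (\<Oplus>l\<in>{..<n}. A (i, l) \<otimes> B (l, k)) \<otimes> C (k, j))"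
      unfolding entry[OF ij] using ij Ac Bc Cc by (intro finsum_cong') (auto simp: entry intro!: finsum_closed)
    also have "\<dots> = (\<Oplus>k\<in>{..<n}. \<Oplus>l\<in>{..<n}. A (i, l) \<otimes> B (l, k) \<otimes> C (k, j))"
      using ij Ac Bc Cc by (intro finsum_cong') (auto simp: finsum_ldistr intro!: finsum_closed)
    also have "\<dots> = (\<Oplus>l\<in>{..<n}. \<Oplus>k\<in>{..<n}. A (i, l) \<otimes> B (l, k) \<otimes> C (k, j))"
      using ij Ac Bc Cc by (intro finsum_swap) auto
    also have "\<dots> = (\<Oplus>l\<in>{..<n}. A (i, l) \<otimes> (\<Oplus>k\<in>{..<n}. B (l, k) \<otimes> C (k, j)))"
      using ij Ac Bc Cc by (intro finsum_cong') (auto simp: finsum_rdistr m_assoc intro!: finsum_closed finsum_cong')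
    also have "\<dots> = (A \<otimes>\<^bsub>?M\<^esub> (B \<otimes>\<^bsub>?M\<^esub> C)) (i, j)"
      unfolding entry[OF ij] using ij Ac Bc Cc by (intro finsum_cong') (auto simp: entry intro!: finsum_closed)
    finally show "(A \<otimes>\<^bsub>?M\<^esub> B \<otimes>\<^bsub>?M\<^esub> C) (i, j) = (A \<otimes>\<^bsub>?M\<^esub> (B \<otimes>\<^bsub>?M\<^esub> C)) (i, j)" .
  qed
qed

lemma (in ring) group_GL: "group (GL n R)"
  unfolding GL_def by (rule monoid.units_group[OF monoid_mat_monoid])

section \<open>Type-class fields as rings with explicit carrier\<close>

lemma ring_of_type_simps:
  "carrier ring_of_type_algebra = UNIV"
  "x \<otimes>\<^bsub>ring_of_type_algebra\<^esub> y = x * y" "x \<oplus>\<^bsub>ring_of_type_algebra\<^esub> y = x + y"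
  "\<one>\<^bsub>ring_of_type_algebra\<^esub> = 1" "\<zero>\<^bsub>ring_of_type_algebra\<^esub> = 0"
  by (simp_all add: ring_of_type_algebra_def)

lemma finsum_ring_of_type:
  "finsum (ring_of_type_algebra :: 'a::comm_ring_1 ring) f A = sum f A"
proof -
  interpret R: cring "ring_of_type_algebra :: 'a ring" by (rule cring_from_type_algebra)
  show ?thesis
  proof (induction A rule: infinite_finite_induct)
    case (infinite A)
    then show ?case by (simp add: R.add.finprod_infinite ring_of_type_simps)
  next
    case (insert x A)
    then show ?case by (subst R.finsum_insert) (simp_all add: ring_of_type_simps)
  qed (simp add: ring_of_type_simps)
qed

lemma nat_pow_ring_of_type:
  "x [^]\<^bsub>ring_of_type_algebra\<^esub> (k :: nat) = (x :: 'a::comm_ring_1) ^ k"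
proof -
  interpret R: cring "ring_of_type_algebra :: 'a ring" by (rule cring_from_type_algebra)
  show ?thesis by (induction k) (simp_all add: ring_of_type_simps mult.commute)
qed

lemma algebraically_closed_ring_of_type:
  "algebraically_closed (ring_of_type_algebra :: 'a::alg_closed_field ring)"
proof -
  let ?R = "ring_of_type_algebra :: 'a ring"
  interpret R: field ?R by (rule field_from_type_algebra)
  \<comment> \<open>Coefficient lists begin with the leading coefficient, whereas the sum runs
    through exponents from 0; hence \<open>rev\<close>.\<close>
  have eval: "R.eval p x = (\<Sum>k<length p. rev p ! k * x ^ k)" for p x
  proof (induction p)
    case (Cons a p)
    have "(\<Sum>k<length p. (rev p @ [a]) ! k * x ^ k) = (\<Sum>k<length p. rev p ! k * x ^ k)"
      by (rule sum.cong) (auto simp: nth_append)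
    then show ?case
      by (simp add: Cons ring_of_type_simps nat_pow_ring_of_type nth_append add.commute)
  qed (simp add: ring_of_type_simps)
  show ?thesis
  proof (rule R.algebraically_closedI)
    fix p assume p: "p \<in> carrier (poly_ring ?R)" "length p - 1 > 1"
    then have "p \<noteq> []" "hd p \<noteq> 0"
      by (auto simp: univ_poly_def polynomial_def ring_of_type_simps)
    then have "rev p ! (length p - 1) \<noteq> 0" by (simp add: rev_nth hd_conv_nth)
    then obtain x where "(\<Sum>k\<le>length p - 1. rev p ! k * x ^ k) = 0"
      using alg_closed[of "length p - 1" "\<lambda>k. rev p ! k"] p(2) by (metis less_trans zero_less_one)
    moreover have "{..length p - 1} = {..<length p}" using p(2) by auto
    ultimately have "R.eval p x = 0" by (simp add: eval)
    then show "\<exists>x\<in>carrier ?R. R.eval p x = \<zero>\<^bsub>?R\<^esub>" by (auto simp: ring_of_type_simps)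
  qed
qed

section \<open>Monomial matrices over the complex numbers\<close>

abbreviation cmat :: "nat \<Rightarrow> (nat \<times> nat \<Rightarrow> complex) monoid" where
  "cmat n \<equiv> mat_monoid n ring_of_type_algebra"

text \<open>The \<open>j\<close>-th basis vector goes to \<open>d j\<close> times the one with index
  \<open>\<sigma> j\<close>; with the scalar attached to the column, products correspond to
  compositions of permutations.\<close>

definition monomial_mat :: "nat \<Rightarrow> (nat \<Rightarrow> nat) \<Rightarrow> (nat \<Rightarrow> complex) \<Rightarrow> nat \<times> nat \<Rightarrow> complex" where
  "monomial_mat n \<sigma> d = (\<lambda>(i, j)\<in>{..<n} \<times> {..<n}. if i = \<sigma> j then d j else 0)"

definition monomial_group :: "nat \<Rightarrow> nat \<Rightarrow> (nat \<times> nat \<Rightarrow> complex) set" where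
  "monomial_group n m = {monomial_mat n \<sigma> d | \<sigma> d. \<sigma> permutes {..<n} \<and> (\<forall>j<n. d j ^ m = 1)}"

lemma monomial_mat_mult:
  assumes "\<tau> permutes {..<n}"
  shows "monomial_mat n \<sigma> d \<otimes>\<^bsub>cmat n\<^esub> monomial_mat n \<tau> e =
    monomial_mat n (\<sigma> \<circ> \<tau>) (\<lambda>j. d (\<tau> j) * e j)"
proof (rule mat_eqI[where n = n and R = ring_of_type_algebra])
  fix i j assume ij: "i < n" "j < n"
  have \<tau>: "\<tau> j < n" using permutes_in_image[OF assms] ij(2) by simp
  have "(\<Sum>k<n. monomial_mat n \<sigma> d (i, k) * monomial_mat n \<tau> e (k, j)) =
      (\<Sum>k<n. if k = \<tau> j then (if i = \<sigma> k then d k * e j else 0) else 0)"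
    using ij by (intro sum.cong) (auto simp: monomial_mat_def)
  also have "\<dots> = (if i = \<sigma> (\<tau> j) then d (\<tau> j) * e j else 0)" using \<tau> by (subst sum.delta) auto
  finally show "(monomial_mat n \<sigma> d \<otimes>\<^bsub>cmat n\<^esub> monomial_mat n \<tau> e) (i, j) =
      monomial_mat n (\<sigma> \<circ> \<tau>) (\<lambda>j. d (\<tau> j) * e j) (i, j)"
    using ij by (simp add: mat_monoid_simps finsum_ring_of_type ring_of_type_simps monomial_mat_def)
qed (auto simp: mat_monoid_simps ring_of_type_simps monomial_mat_def)

lemma monomial_mat_one:
  "\<one>\<^bsub>cmat n\<^esub> = monomial_mat n id (\<lambda>_. 1)"
  unfolding mat_monoid_simps monomial_mat_def by (rule restrict_ext) (auto simp: ring_of_type_simps)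

lemma monomial_mat_cong:
  assumes "\<And>j. j < n \<Longrightarrow> \<sigma> j = \<tau> j" "\<And>j. j < n \<Longrightarrow> d j = e j"
  shows "monomial_mat n \<sigma> d = monomial_mat n \<tau> e"
  using assms by (auto simp: monomial_mat_def fun_eq_iff restrict_def)

lemma monomial_mat_eqD:
  assumes "monomial_mat n \<sigma> d = monomial_mat n \<tau> e" "\<sigma> permutes {..<n}" "j < n" "d j \<noteq> 0"
  shows "\<sigma> j = \<tau> j" "d j = e j"
proof -
  have "\<sigma> j < n" using permutes_in_image[OF assms(2)] assms(3) by simp
  then have "monomial_mat n \<tau> e (\<sigma> j, j) = d j"
    unfolding assms(1)[symmetric] using assms(3) by (simp add: monomial_mat_def)
  then show "\<sigma> j = \<tau> j" "d j = e j"
    using \<open>\<sigma> j < n\<close> assms(3,4) by (auto simp: monomial_mat_def split: if_splits)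
qed

lemma monomial_mat_inverse:
  assumes \<sigma>: "\<sigma> permutes {..<n}" and d: "\<And>j. j < n \<Longrightarrow> d j \<noteq> 0"
  defines "e \<equiv> \<lambda>j. inverse (d (Hilbert_Choice.inv \<sigma> j))"
  shows "monomial_mat n \<sigma> d \<otimes>\<^bsub>cmat n\<^esub> monomial_mat n (Hilbert_Choice.inv \<sigma>) e = \<one>\<^bsub>cmat n\<^esub>"
    "monomial_mat n (Hilbert_Choice.inv \<sigma>) e \<otimes>\<^bsub>cmat n\<^esub> monomial_mat n \<sigma> d = \<one>\<^bsub>cmat n\<^esub>"
proof -
  have inv: "Hilbert_Choice.inv \<sigma> j < n" if "j < n" for j using permutes_in_image[OF permutes_inv[OF \<sigma>]] that by simp
  show "monomial_mat n \<sigma> d \<otimes>\<^bsub>cmat n\<^esub> monomial_mat n (Hilbert_Choice.inv \<sigma>) e = \<one>\<^bsub>cmat n\<^esub>"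
    unfolding monomial_mat_mult[OF permutes_inv[OF \<sigma>]] monomial_mat_one
    by (rule monomial_mat_cong) (use d inv permutes_inverses[OF \<sigma>] in \<open>auto simp: e_def\<close>)
  show "monomial_mat n (Hilbert_Choice.inv \<sigma>) e \<otimes>\<^bsub>cmat n\<^esub> monomial_mat n \<sigma> d = \<one>\<^bsub>cmat n\<^esub>"
    unfolding monomial_mat_mult[OF \<sigma>] monomial_mat_one
    by (rule monomial_mat_cong) (use d inv permutes_inverses[OF \<sigma>] in \<open>auto simp: e_def\<close>)
qed

lemma monomial_mat_carrier: "monomial_mat n \<sigma> d \<in> carrier (cmat n)"
  by (auto simp: mat_monoid_simps ring_of_type_simps monomial_mat_def)

lemma monomial_group_subgroup:
  assumes "m > 0"
  shows "subgroup (monomial_group n m) (GL n ring_of_type_algebra)" "finite (monomial_group n m)"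
proof -
  let ?R = "ring_of_type_algebra :: complex ring"
  interpret R: cring ?R by (rule cring_from_type_algebra)
  interpret M: monoid "cmat n" by (rule R.monoid_mat_monoid)
  interpret GL: group "GL n ?R" by (rule R.group_GL)
  have nz: "x \<noteq> 0" if "x ^ m = 1" for x :: complex using that assms by (auto simp: zero_power)
  have inverse: "\<exists>y\<in>monomial_group n m. x \<otimes>\<^bsub>cmat n\<^esub> y = \<one>\<^bsub>cmat n\<^esub> \<and>
      y \<otimes>\<^bsub>cmat n\<^esub> x = \<one>\<^bsub>cmat n\<^esub>" if x: "x \<in> monomial_group n m" for x
  proof -
    obtain \<sigma> d where \<sigma>: "\<sigma> permutes {..<n}" "\<forall>j<n. d j ^ m = 1" "x = monomial_mat n \<sigma> d"
      using x by (auto simp: monomial_group_def)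
    have inv: "Hilbert_Choice.inv \<sigma> j < n" if "j < n" for j using permutes_in_image[OF permutes_inv[OF \<sigma>(1)]] that by simp
    have "monomial_mat n (Hilbert_Choice.inv \<sigma>) (\<lambda>j. inverse (d (Hilbert_Choice.inv \<sigma> j))) \<in> monomial_group n m"
      unfolding monomial_group_def using \<sigma> inv permutes_inv[OF \<sigma>(1)]
      by (auto simp: power_inverse intro!: exI[of _ "Hilbert_Choice.inv \<sigma>"] exI[of _ "\<lambda>j. inverse (d (Hilbert_Choice.inv \<sigma> j))"])
    then show ?thesis using monomial_mat_inverse[OF \<sigma>(1), of d] \<sigma>(2,3) nz by blast
  qed
  have carr: "x \<in> carrier (cmat n)" if "x \<in> monomial_group n m" for x
    using that monomial_mat_carrier by (auto simp: monomial_group_def)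
  have GLc: "x \<in> carrier (GL n ?R)" if "x \<in> monomial_group n m" for x
    using inverse[OF that] carr carr[OF that] by (auto simp: GL_def units_of_def Units_def)
  have GLm: "x \<otimes>\<^bsub>GL n ?R\<^esub> y = x \<otimes>\<^bsub>cmat n\<^esub> y" "\<one>\<^bsub>GL n ?R\<^esub> = \<one>\<^bsub>cmat n\<^esub>" for x y
    by (simp_all add: GL_def units_of_def)
  show "subgroup (monomial_group n m) (GL n ?R)"
  proof
    show "monomial_group n m \<subseteq> carrier (GL n ?R)" using GLc by blast
    show "x \<otimes>\<^bsub>GL n ?R\<^esub> y \<in> monomial_group n m" if xy: "x \<in> monomial_group n m" "y \<in> monomial_group n m" for x y
    proof -
      obtain \<sigma> d where \<sigma>: "\<sigma> permutes {..<n}" "\<forall>j<n. d j ^ m = 1" "x = monomial_mat n \<sigma> d"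
        using xy(1) by (auto simp: monomial_group_def)
      obtain \<tau> e where \<tau>: "\<tau> permutes {..<n}" "\<forall>j<n. e j ^ m = 1" "y = monomial_mat n \<tau> e"
        using xy(2) by (auto simp: monomial_group_def)
      have "\<tau> j < n" if "j < n" for j using permutes_in_image[OF \<tau>(1)] that by simp
      then have "\<forall>j<n. (d (\<tau> j) * e j) ^ m = 1" using \<sigma>(2) \<tau>(2) by (simp add: power_mult_distrib)
      then show ?thesis
        unfolding GLm \<sigma>(3) \<tau>(3) monomial_mat_mult[OF \<tau>(1)] monomial_group_def
        using permutes_compose[OF \<tau>(1) \<sigma>(1)] by blast
    qed
    show "\<one>\<^bsub>GL n ?R\<^esub> \<in> monomial_group n m"
      unfolding GLm monomial_mat_one monomial_group_def using permutes_id by fastforce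
    show "inv\<^bsub>GL n ?R\<^esub> x \<in> monomial_group n m" if x: "x \<in> monomial_group n m" for x
    proof -
      obtain y where y: "y \<in> monomial_group n m" "y \<otimes>\<^bsub>cmat n\<^esub> x = \<one>\<^bsub>cmat n\<^esub>"
        using inverse[OF x] by blast
      then have "inv\<^bsub>GL n ?R\<^esub> x = y" using GL.inv_equality[of y x] GLc[OF x] GLc[OF y(1)] by (simp add: GLm)
      then show ?thesis using y(1) by simp
    qed
  qed
  have "monomial_group n m \<subseteq> ({..<n} \<times> {..<n}) \<rightarrow>\<^sub>E insert 0 {z. z ^ m = 1}"
    by (auto simp: monomial_group_def monomial_mat_def PiE_def extensional_def)
  moreover have "finite (({..<n} \<times> {..<n}) \<rightarrow>\<^sub>E insert 0 {z::complex. z ^ m = 1})"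
    using finite_roots_unity[of m, where 'a = complex] assms by (intro finite_PiE) (auto simp: Suc_le_eq)
  ultimately show "finite (monomial_group n m)" by (rule finite_subset)
qed

text \<open>Lagrange's theorem in the quotient, whose order is the index of
  \<open>H\<close>.\<close>

lemma (in normal) pow_index_mem:
  assumes "finite (carrier G)" "x \<in> carrier G"
  shows "x [^] card (rcosets H) \<in> H"
proof -
  interpret Q: group "G Mod H" by (rule factorgroup_is_group)
  interpret h: group_hom G "G Mod H" "\<lambda>x. H #> x"
    using r_coset_hom_Mod by unfold_locales
  have "finite (carrier (G Mod H))"
    using assms(1) by (simp add: FactGroup_def RCOSETS_def)
  then have "(H #> x) [^]\<^bsub>G Mod H\<^esub> Coset.order (G Mod H) = \<one>\<^bsub>G Mod H\<^esub>"
    using Q.pow_order_eq_1 assms(2) h.hom_closed by blast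
  then have "H #> (x [^] card (rcosets H)) = H"
    using h.hom_nat_pow[OF assms(2)] by (simp add: Coset.order_def FactGroup_def)
  then show ?thesis using rcos_self[OF nat_pow_closed[OF assms(2)] subgroup_axioms] by blast
qed

lemma monomial_mat_diag_pow:
  assumes "\<sigma> = id"
  shows "monomial_mat n \<sigma> d [^]\<^bsub>GL n ring_of_type_algebra\<^esub> (k :: nat) = monomial_mat n \<sigma> (\<lambda>j. d j ^ k)"
proof (induction k)
  case 0
  have "monomial_mat n \<sigma> d [^]\<^bsub>GL n ring_of_type_algebra\<^esub> (0 :: nat) =
      \<one>\<^bsub>cmat n\<^esub>"
    by (simp add: GL_def units_of_def)
  then show ?case by (simp only: monomial_mat_one power_0 assms)
next
  case (Suc k)
  have "monomial_mat n \<sigma> d [^]\<^bsub>GL n ring_of_type_algebra\<^esub> Suc k =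
      monomial_mat n \<sigma> d [^]\<^bsub>GL n ring_of_type_algebra\<^esub> k \<otimes>\<^bsub>cmat n\<^esub> monomial_mat n \<sigma> d"
    by (simp add: GL_def units_of_def)
  also have "\<dots> = monomial_mat n (\<sigma> \<circ> \<sigma>) (\<lambda>j. d (\<sigma> j) ^ k * d j)"
    unfolding Suc unfolding assms by (rule monomial_mat_mult[OF permutes_id])
  also have "\<dots> = monomial_mat n \<sigma> (\<lambda>j. d j ^ Suc k)"
    by (rule monomial_mat_cong) (simp_all add: assms)
  finally show ?case .
qed

text \<open>
  An abelian normal subgroup \<open>A\<close> of bounded index in the monomial group with many roots of unity contains a
  diagonal matrix with distinct entries. So \<open>A\<close> is diagonal, and distinct permutations lie in distinct cosets.
\<close>

lemma J3_constant_ge_fact: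
  assumes "J3_constant n J"
  shows "fact n \<le> J"
proof -
  let ?R = "ring_of_type_algebra :: complex ring"
  interpret R: cring ?R by (rule cring_from_type_algebra)
  \<comment> \<open>An index \<open>c\<close> bounded by \<open>J\<close> satisfies
    \<open>n * c < m\<close>. So the exponents \<open>j * c\<close> with \<open>j < n\<close> stay
    below \<open>m\<close>, and the corresponding powers of a primitive \<open>m\<close>-th root of
    unity remain distinct.\<close>
  define m where "m = n * nat \<lfloor>J\<rfloor> + 1"
  have m: "m > 0" by (simp add: m_def)
  define \<G> where "\<G> = (GL n ?R)\<lparr>carrier := monomial_group n m\<rparr>"
  interpret GL: group "GL n ?R" by (rule R.group_GL)
  have sub: "subgroup (monomial_group n m) (GL n ?R)" and fin: "finite (monomial_group n m)"
    using monomial_group_subgroup[OF m] by auto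
  have "[k] \<cdot>\<^bsub>?R\<^esub> \<one>\<^bsub>?R\<^esub> = of_nat k" for k :: nat
    by (induction k) (simp_all add: add_pow_def ring_of_type_simps nat_pow_def)
  then have "\<forall>k::nat. k > 0 \<longrightarrow> [k] \<cdot>\<^bsub>?R\<^esub> \<one>\<^bsub>?R\<^esub> \<noteq> \<zero>\<^bsub>?R\<^esub>" by (simp add: ring_of_type_simps)
  then obtain A where A: "A \<lhd> \<G>" "comm_group ((GL n ?R)\<lparr>carrier := A\<rparr>)" "real (card (rcosets\<^bsub>\<G>\<^esub> A)) \<le> J"
    using assms algebraically_closed_ring_of_type sub fin unfolding J3_constant_def \<G>_def by blast
  interpret A: normal A \<G> by (rule A(1))
  have G\<G>: "carrier \<G> = monomial_group n m" "\<And>x y. x \<otimes>\<^bsub>\<G>\<^esub> y = x \<otimes>\<^bsub>cmat n\<^esub> y"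
    by (simp_all add: \<G>_def GL_def units_of_def)
  define c where "c = card (rcosets\<^bsub>\<G>\<^esub> A)"
  have finr: "finite (rcosets\<^bsub>\<G>\<^esub> A)" using fin by (simp add: RCOSETS_def G\<G>)
  have "A \<in> rcosets\<^bsub>\<G>\<^esub> A" by (rule A.subgroup_in_rcosets[OF A.is_group])
  then have c0: "c > 0" using finr by (auto simp: c_def card_gt_0_iff)
  have "c \<le> nat \<lfloor>J\<rfloor>" using A(3) by (simp add: c_def le_nat_floor)
  then have nc: "n * c < m" by (simp add: m_def less_Suc_eq_le)
  define z where "z j = cis (2 * pi * real j / real m)" for j :: nat
  have zinj: "z i \<noteq> z j" if "i < m" "j < m" "i \<noteq> j" for i j
    using bij_betw_imp_inj_on[OF bij_betw_roots_unity[OF m]] that unfolding z_def inj_on_def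
    by (auto simp: z_def)
  have zroot: "z j ^ m = 1" for j
    using m by (simp add: z_def DeMoivre cis_2pi mult_ac) (metis cis_multiple_2pi Ints_of_nat mult.commute mult.assoc)
  have zpow: "z j ^ k = z (j * k)" for j k by (simp add: z_def DeMoivre mult_ac)
  have d0: "monomial_mat n id z \<in> monomial_group n m"
    unfolding monomial_group_def using permutes_id zroot by blast
  have pow: "x [^]\<^bsub>\<G>\<^esub> k = x [^]\<^bsub>GL n ?R\<^esub> (k::nat)" for x k
    by (simp add: \<G>_def nat_pow_def)
  have t: "monomial_mat n id (\<lambda>j. z (j * c)) \<in> A"
    using A.pow_index_mem[of "monomial_mat n id z"] fin d0
    by (simp add: G\<G> pow monomial_mat_diag_pow[OF refl] zpow c_def)
  \<comment> \<open>Commuting with the diagonal element of \<open>A\<close> equates its entries at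
    \<open>j\<close> and at \<open>\<sigma> j\<close>, which are distinct unless
    \<open>\<sigma> j = j\<close>.\<close>
  have diag: "\<sigma> j = j" if a: "monomial_mat n \<sigma> d \<in> A" and \<sigma>: "\<sigma> permutes {..<n}" "\<forall>j<n. d j \<noteq> 0" "j < n" for \<sigma> d j
  proof -
    interpret cA: comm_group "(GL n ?R)\<lparr>carrier := A\<rparr>" by (rule A(2))
    have "monomial_mat n \<sigma> d \<otimes>\<^bsub>cmat n\<^esub> monomial_mat n id (\<lambda>j. z (j * c)) =
        monomial_mat n id (\<lambda>j. z (j * c)) \<otimes>\<^bsub>cmat n\<^esub> monomial_mat n \<sigma> d"
      using cA.m_comm[of "monomial_mat n \<sigma> d" "monomial_mat n id (\<lambda>j. z (j * c))"] a t
      by (simp add: GL_def units_of_def)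
    then have eq: "monomial_mat n \<sigma> (\<lambda>j. d j * z (j * c)) = monomial_mat n \<sigma> (\<lambda>j. z (\<sigma> j * c) * d j)"
      by (simp add: monomial_mat_mult[OF permutes_id] monomial_mat_mult[OF \<sigma>(1)])
    have "z i \<noteq> 0" for i by (simp add: z_def)
    then have "z (j * c) = z (\<sigma> j * c)" using monomial_mat_eqD(2)[OF eq \<sigma>(1,3)] \<sigma>(2,3) by simp
    moreover have "\<sigma> j < n" using permutes_in_image[OF \<sigma>(1)] \<sigma>(3) by simp
    then have "\<sigma> j * c < m" "j * c < m"
      using nc \<sigma>(3) by (meson le_less_trans less_imp_le mult_le_mono1)+
    ultimately have "j * c = \<sigma> j * c" using zinj by blast
    then show ?thesis using c0 by simp
  qed
  define P where "P \<sigma> = monomial_mat n \<sigma> (\<lambda>_. 1)" for \<sigma>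
  have PG: "P \<sigma> \<in> carrier \<G>" if "\<sigma> permutes {..<n}" for \<sigma>
    using that unfolding P_def G\<G> monomial_group_def by force
  have "inj_on (\<lambda>\<sigma>. A #>\<^bsub>\<G>\<^esub> P \<sigma>) {\<sigma>. \<sigma> permutes {..<n}}"
  proof (rule inj_onI)
    fix \<sigma> \<tau> assume "\<sigma> \<in> {\<sigma>. \<sigma> permutes {..<n}}" "\<tau> \<in> {\<sigma>. \<sigma> permutes {..<n}}"
      and eq: "A #>\<^bsub>\<G>\<^esub> P \<sigma> = A #>\<^bsub>\<G>\<^esub> P \<tau>"
    then have \<sigma>: "\<sigma> permutes {..<n}" and \<tau>: "\<tau> permutes {..<n}" by auto
    have "P \<sigma> \<in> A #>\<^bsub>\<G>\<^esub> P \<tau>" using A.rcos_self[OF PG[OF \<sigma>] A.subgroup_axioms] eq by simp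
    then obtain a where a: "a \<in> A" "P \<sigma> = a \<otimes>\<^bsub>cmat n\<^esub> P \<tau>" by (auto simp: r_coset_def G\<G>)
    have "a \<in> monomial_group n m" using a(1) A.subset by (auto simp: G\<G>)
    then obtain \<rho> d where \<rho>: "\<rho> permutes {..<n}" "\<forall>j<n. d j ^ m = 1" "a = monomial_mat n \<rho> d"
      by (auto simp: monomial_group_def)
    then have "\<forall>j<n. d j \<noteq> 0" using m by (auto simp: zero_power)
    then have fixed: "\<rho> j = j" if "j < n" for j using diag a(1) \<rho> that by blast
    have eq': "monomial_mat n \<sigma> (\<lambda>_. 1) = monomial_mat n (\<rho> \<circ> \<tau>) (\<lambda>j. d (\<tau> j) * 1)"
      using a(2) unfolding P_def \<rho>(3) monomial_mat_mult[OF \<tau>] .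
    have "\<sigma> j = \<tau> j" if j: "j < n" for j
    proof -
      have "\<sigma> j = (\<rho> \<circ> \<tau>) j" by (rule monomial_mat_eqD(1)[OF eq' \<sigma> j]) simp
      moreover have "\<tau> j < n" using permutes_in_image[OF \<tau>] j by simp
      ultimately show ?thesis using fixed by simp
    qed
    then show "\<sigma> = \<tau>" using \<sigma> \<tau> by (metis ext lessThan_iff permutes_not_in)
  qed
  then have "card {\<sigma>. \<sigma> permutes {..<n}} \<le> card (rcosets\<^bsub>\<G>\<^esub> A)"
    by (rule card_inj_on_le) (use finr PG in \<open>auto simp: RCOSETS_def\<close>)
  then have "fact n \<le> card (rcosets\<^bsub>\<G>\<^esub> A)" by (simp add: card_permutations)
  then have "fact n \<le> real (card (rcosets\<^bsub>\<G>\<^esub> A))" by (metis of_nat_fact of_nat_mono)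
  then show ?thesis using A(3) by linarith
qed

section \<open>Matrices over rings with explicit carrier\<close>

lemma finprod_ring_of_type:
  "finprod (ring_of_type_algebra :: 'a::comm_ring_1 ring) f A = prod f A"
proof -
  interpret R: cring "ring_of_type_algebra :: 'a ring" by (rule cring_from_type_algebra)
  show ?thesis
  proof (induction A rule: infinite_finite_induct)
    case (infinite A)
    then show ?case by (simp add: R.finprod_infinite ring_of_type_simps)
  next
    case (insert x A)
    then show ?case by (subst R.finprod_insert) (simp_all add: ring_of_type_simps)
  qed (simp add: ring_of_type_simps)
qed

lemma a_inv_ring_of_type: "\<ominus>\<^bsub>ring_of_type_algebra\<^esub> x = - (x :: 'a::comm_ring_1)"
proof -
  interpret R: cring "ring_of_type_algebra :: 'a ring" by (rule cring_from_type_algebra)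
  show ?thesis by (rule R.minus_equality) (simp_all add: ring_of_type_simps)
qed

lemma vec_space_simps:
  "carrier (vec_space n K) = {..<n} \<rightarrow>\<^sub>E carrier K"
  "\<zero>\<^bsub>vec_space n K\<^esub> = (\<lambda>i\<in>{..<n}. \<zero>\<^bsub>K\<^esub>)"
  "v \<oplus>\<^bsub>vec_space n K\<^esub> w = (\<lambda>i\<in>{..<n}. v i \<oplus>\<^bsub>K\<^esub> w i)"
  "c \<odot>\<^bsub>vec_space n K\<^esub> v = (\<lambda>i\<in>{..<n}. c \<otimes>\<^bsub>K\<^esub> v i)"
  by (simp_all add: vec_space_def)

lemma vec_entry_closed: "v \<in> carrier (vec_space n K) \<Longrightarrow> i < n \<Longrightarrow> v i \<in> carrier K"
  using PiE_mem[of v "{..<n}" "\<lambda>_. carrier K" i] by (simp add: vec_space_simps)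

lemma (in ring) abelian_group_vec_space: "abelian_group (vec_space n R)"
proof (rule abelian_groupI)
  fix v assume v: "v \<in> carrier (vec_space n R)"
  let ?w = "\<lambda>i\<in>{..<n}. \<ominus> v i"
  have "?w \<in> carrier (vec_space n R)" using v by (auto simp: vec_space_simps)
  moreover have "?w \<oplus>\<^bsub>vec_space n R\<^esub> v = \<zero>\<^bsub>vec_space n R\<^esub>"
    using v by (auto simp: vec_space_simps fun_eq_iff restrict_def l_neg PiE_iff)
  ultimately show "\<exists>w\<in>carrier (vec_space n R). w \<oplus>\<^bsub>vec_space n R\<^esub> v = \<zero>\<^bsub>vec_space n R\<^esub>" by blast
qed (auto simp: vec_space_simps a_assoc a_comm a_lcomm intro!: restrict_ext PiE_restrict[symmetric]
    simp: PiE_iff extensional_def fun_eq_iff)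

lemma map_poly_to_ac_add: "map_poly to_ac (f + g) = map_poly to_ac f + map_poly to_ac g"
  and map_poly_to_ac_mult: "map_poly to_ac (f * g) = map_poly to_ac f * map_poly to_ac g"
  by (simp_all add: poly_eq_iff coeff_map_poly coeff_mult to_ac_sum)

lemma map_poly_to_ac_sum: "map_poly to_ac (\<Sum>i\<in>I. f i) = (\<Sum>i\<in>I. map_poly to_ac (f i))"
  by (induction I rule: infinite_finite_induct) (simp_all add: map_poly_to_ac_add)

lemma map_poly_to_ac_prod: "map_poly to_ac (\<Prod>i\<in>I. f i) = (\<Prod>i\<in>I. map_poly to_ac (f i))"
  by (induction I rule: infinite_finite_induct) (simp_all add: map_poly_to_ac_mult)

lemma rev_char_poly_map_to_ac:
  fixes B :: "'a::field^'n^'n"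
  shows "rev_char_poly (map_matrix to_ac B) = map_poly to_ac (rev_char_poly B)"
proof -
  have "map_poly to_ac (of_int (sign p) :: 'a poly) = of_int (sign p)" for p :: "'n \<Rightarrow> 'n"
    by (simp add: of_int_poly map_poly_pCons)
  moreover have "map_poly to_ac [:if i = j then 1 else 0, - B $ i $ j:] = [:if i = j then 1 else 0, - to_ac (B $ i $ j):]" for i j
    by (simp add: map_poly_pCons)
  ultimately show ?thesis
    by (simp add: rev_char_poly_def det_def map_poly_to_ac_sum map_poly_to_ac_mult map_poly_to_ac_prod)
qed

text \<open>The bridge to matrices over types: \<open>r\<close> identifies the carrier with a
  type-class field, and \<iota> numbers the index type by \<open>{..<n}\<close>.\<close>

locale matrix_transfer =
  fixes K :: "'c ring" and n :: nat and r :: "'c \<Rightarrow> 'k::finite_field" and \<iota> :: "'n::finite \<Rightarrow> nat"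
  assumes field_K: "field K" and r_hom: "r \<in> ring_hom K ring_of_type_algebra"
    and r_bij: "bij_betw r (carrier K) UNIV" and \<iota>_bij: "bij_betw \<iota> UNIV {..<n}"
begin

sublocale K: field K by (rule field_K)

lemma ring_hom_cring_r: "ring_hom_cring K (ring_of_type_algebra :: 'k ring) r"
  by (rule ring_hom_cringI[OF K.is_cring cring_from_type_algebra r_hom])

lemma \<iota>_less [simp]: "\<iota> i < n"
  using bij_betw_apply[OF \<iota>_bij, of i] by simp

lemma \<iota>_inj: "inj \<iota>"
  using \<iota>_bij by (simp add: bij_betw_def)

lemma \<iota>_eq_iff [simp]: "\<iota> i = \<iota> j \<longleftrightarrow> i = j"
  using \<iota>_inj by (rule inj_eq)

lemma \<iota>_surj: "i < n \<Longrightarrow> \<exists>j. i = \<iota> j"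
  using \<iota>_bij by (auto simp: bij_betw_def)

lemma card_index: "CARD('n) = n"
  using bij_betw_same_card[OF \<iota>_bij] by simp

lemma r_inj: "x \<in> carrier K \<Longrightarrow> y \<in> carrier K \<Longrightarrow> r x = r y \<Longrightarrow> x = y"
  using r_bij by (auto simp: bij_betw_def inj_on_def)

lemma r_surj: obtains x where "x \<in> carrier K" "r x = y"
  using r_bij by (auto simp: bij_betw_def) (metis UNIV_I imageE)

lemma r_simps:
  "x \<in> carrier K \<Longrightarrow> y \<in> carrier K \<Longrightarrow> r (x \<otimes>\<^bsub>K\<^esub> y) = r x * r y"
  "x \<in> carrier K \<Longrightarrow> y \<in> carrier K \<Longrightarrow> r (x \<oplus>\<^bsub>K\<^esub> y) = r x + r y"
  "r \<one>\<^bsub>K\<^esub> = 1" "r \<zero>\<^bsub>K\<^esub> = 0"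
  using ring_hom_mult[OF r_hom, of x y] ring_hom_add[OF r_hom, of x y] ring_hom_one[OF r_hom]
    ring_hom_cring.hom_zero[OF ring_hom_cring_r]
  by (simp_all add: ring_of_type_simps)

lemma r_finsum: "f \<in> A \<rightarrow> carrier K \<Longrightarrow> r (finsum K f A) = (\<Sum>i\<in>A. r (f i))"
  using ring_hom_cring.hom_finsum[OF ring_hom_cring_r, of f A] by (simp add: finsum_ring_of_type comp_def)

lemma sum_index: "(\<Sum>k\<in>{..<n}. f k) = (\<Sum>k\<in>(UNIV :: 'n set). f (\<iota> k))"
  by (rule sum.reindex_bij_betw[OF \<iota>_bij, symmetric])

section \<open>Transfer of matrices, vectors and submodules\<close>

definition tmat :: "(nat \<times> nat \<Rightarrow> 'c) \<Rightarrow> 'k^'n^'n" where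
  "tmat A = (\<chi> i j. r (A (\<iota> i, \<iota> j)))"

definition tvec :: "(nat \<Rightarrow> 'c) \<Rightarrow> 'k^'n" where
  "tvec v = (\<chi> i. r (v (\<iota> i)))"

lemma tmat_inj: "inj_on tmat (carrier (mat_monoid n K))"
proof (rule inj_onI)
  fix A B assume AB: "A \<in> carrier (mat_monoid n K)" "B \<in> carrier (mat_monoid n K)" "tmat A = tmat B"
  show "A = B"
  proof (rule mat_eqI[OF AB(1,2)])
    fix i j assume ij: "i < n" "j < n"
    then obtain i' j' where "i = \<iota> i'" "j = \<iota> j'" using \<iota>_surj by metis
    then have "r (A (i, j)) = r (B (i, j))" using AB(3) by (simp add: tmat_def vec_eq_iff)
    then show "A (i, j) = B (i, j)" using r_inj mat_entry_closed[OF AB(1) ij] mat_entry_closed[OF AB(2) ij] by blast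
  qed
qed

lemma tmat_mult:
  assumes "A \<in> carrier (mat_monoid n K)" "B \<in> carrier (mat_monoid n K)"
  shows "tmat (A \<otimes>\<^bsub>mat_monoid n K\<^esub> B) = tmat A ** tmat B"
proof -
  note c = mat_entry_closed[OF assms(1)] mat_entry_closed[OF assms(2)]
  have "r ((A \<otimes>\<^bsub>mat_monoid n K\<^esub> B) (\<iota> i, \<iota> j)) = (\<Sum>k\<in>UNIV. r (A (\<iota> i, \<iota> k)) * r (B (\<iota> k, \<iota> j)))" for i j
  proof -
    have "r ((A \<otimes>\<^bsub>mat_monoid n K\<^esub> B) (\<iota> i, \<iota> j)) = (\<Sum>k\<in>{..<n}. r (A (\<iota> i, k) \<otimes>\<^bsub>K\<^esub> B (k, \<iota> j)))"
      using c by (subst r_finsum[symmetric]) (auto simp: mat_monoid_simps)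
    then show ?thesis using c by (simp add: sum_index r_simps)
  qed
  then show ?thesis by (simp add: tmat_def vec_eq_iff matrix_matrix_mult_def)
qed

lemma tmat_one: "tmat \<one>\<^bsub>mat_monoid n K\<^esub> = mat 1"
  by (simp add: tmat_def mat_monoid_simps vec_eq_iff mat_def r_simps)

lemma GL_simps:
  "x \<otimes>\<^bsub>GL n K\<^esub> y = x \<otimes>\<^bsub>mat_monoid n K\<^esub> y" "\<one>\<^bsub>GL n K\<^esub> = \<one>\<^bsub>mat_monoid n K\<^esub>"
  "x \<in> carrier (GL n K) \<Longrightarrow> x \<in> carrier (mat_monoid n K)"
  by (simp_all add: GL_def units_of_def Units_def)

lemma finite_mats: "finite (carrier (mat_monoid n K))"
proof -
  have "finite (carrier K)" using bij_betw_finite[OF r_bij] by simp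
  then show ?thesis by (simp add: mat_monoid_simps finite_PiE)
qed

lemma tmat_group:
  assumes "subgroup G (GL n K)"
  shows "matrix_group (tmat ` G)" "card (tmat ` G) = card G" "G \<subseteq> carrier (mat_monoid n K)"
proof -
  interpret GL: group "GL n K" by (rule K.group_GL)
  interpret G: subgroup G "GL n K" by (rule assms)
  show sub: "G \<subseteq> carrier (mat_monoid n K)" using G.subset GL_simps(3) by blast
  show "card (tmat ` G) = card G" using tmat_inj sub by (intro card_image) (rule inj_on_subset)
  show "matrix_group (tmat ` G)"
    unfolding matrix_group_def
  proof (intro conjI ballI)
    show "finite (tmat ` G)" using finite_subset[OF sub finite_mats] by simp
    show "mat 1 \<in> tmat ` G" using G.one_closed tmat_one GL_simps(2) by (metis imageI)
    fix x assume "x \<in> tmat ` G"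
    then obtain a where a: "a \<in> G" "x = tmat a" by blast
    show "\<exists>y\<in>tmat ` G. y ** x = mat 1"
    proof
      have ia: "inv\<^bsub>GL n K\<^esub> a \<in> G" by (rule G.m_inv_closed[OF a(1)])
      then show "tmat (inv\<^bsub>GL n K\<^esub> a) \<in> tmat ` G" by blast
      have "tmat (inv\<^bsub>GL n K\<^esub> a) ** x = tmat (inv\<^bsub>GL n K\<^esub> a \<otimes>\<^bsub>GL n K\<^esub> a)"
        using ia a sub by (simp add: GL_simps tmat_mult subsetD[OF sub])
      also have "inv\<^bsub>GL n K\<^esub> a \<otimes>\<^bsub>GL n K\<^esub> a = \<one>\<^bsub>GL n K\<^esub>" using GL.l_inv G.subset a(1) by blast
      finally show "tmat (inv\<^bsub>GL n K\<^esub> a) ** x = mat 1" by (simp add: GL_simps tmat_one)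
    qed
    fix y assume "y \<in> tmat ` G"
    then obtain b where b: "b \<in> G" "y = tmat b" by blast
    have "x ** y = tmat (a \<otimes>\<^bsub>GL n K\<^esub> b)"
      using a b by (simp add: GL_simps tmat_mult subsetD[OF sub])
    then show "x ** y \<in> tmat ` G" using G.m_closed[OF a(1) b(1)] by blast
  qed
qed

lemma tvec_inj: "inj_on tvec (carrier (vec_space n K))"
proof (rule inj_onI)
  fix v w assume vw: "v \<in> carrier (vec_space n K)" "w \<in> carrier (vec_space n K)" "tvec v = tvec w"
  show "v = w"
  proof (rule PiE_ext[OF vw(1,2)[unfolded vec_space_simps]])
    fix i assume i: "i \<in> {..<n}"
    then obtain i' where "i = \<iota> i'" using \<iota>_surj by blast
    then have "r (v i) = r (w i)" using vw(3) by (simp add: tvec_def vec_eq_iff)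
    moreover have "v i \<in> carrier K" "w i \<in> carrier K" using vw(1,2) i by (auto simp: vec_space_simps)
    ultimately show "v i = w i" using r_inj by blast
  qed
qed

lemma tvec_surj: obtains v where "v \<in> carrier (vec_space n K)" "tvec v = u"
proof -
  have "\<forall>y. \<exists>x. x \<in> carrier K \<and> r x = y" using r_surj by blast
  then obtain s where s: "\<And>y. s y \<in> carrier K" "\<And>y. r (s y) = y" by metis
  define v where "v = (\<lambda>i\<in>{..<n}. s (u $ (the_inv \<iota> i)))"
  have "v \<in> carrier (vec_space n K)" using s by (auto simp: v_def vec_space_simps)
  moreover have "tvec v = u" using s by (simp add: tvec_def v_def vec_eq_iff the_inv_f_f[OF \<iota>_inj])
  ultimately show thesis by (rule that)
qed

lemma tvec_simps:
  assumes "v \<in> carrier (vec_space n K)"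
  shows "w \<in> carrier (vec_space n K) \<Longrightarrow> tvec (v \<oplus>\<^bsub>vec_space n K\<^esub> w) = tvec v + tvec w"
    "c \<in> carrier K \<Longrightarrow> tvec (c \<odot>\<^bsub>vec_space n K\<^esub> v) = r c *s tvec v"
    "A \<in> carrier (mat_monoid n K) \<Longrightarrow> tvec (mat_vec n K A v) = tmat A *v tvec v"
proof -
  have vc: "v (\<iota> i) \<in> carrier K" for i by (rule vec_entry_closed[OF assms \<iota>_less])
  show "tvec (v \<oplus>\<^bsub>vec_space n K\<^esub> w) = tvec v + tvec w" if "w \<in> carrier (vec_space n K)"
  proof -
    have "w (\<iota> i) \<in> carrier K" for i by (rule vec_entry_closed[OF that \<iota>_less])
    then show ?thesis using vc by (simp add: tvec_def vec_eq_iff vec_space_simps r_simps)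
  qed
  show "c \<in> carrier K \<Longrightarrow> tvec (c \<odot>\<^bsub>vec_space n K\<^esub> v) = r c *s tvec v"
    using vc by (simp add: tvec_def vec_eq_iff vec_space_simps r_simps)
  show "tvec (mat_vec n K A v) = tmat A *v tvec v" if A: "A \<in> carrier (mat_monoid n K)"
  proof -
    have vj: "v j \<in> carrier K" if "j < n" for j by (rule vec_entry_closed[OF assms that])
    note Ac = mat_entry_closed[OF A]
    have "r (mat_vec n K A v (\<iota> i)) = (\<Sum>k\<in>UNIV. r (A (\<iota> i, \<iota> k)) * r (v (\<iota> k)))" for i
    proof -
      have "r (mat_vec n K A v (\<iota> i)) = (\<Sum>k\<in>{..<n}. r (A (\<iota> i, k) \<otimes>\<^bsub>K\<^esub> v k))"
        using Ac vj by (subst r_finsum[symmetric]) (auto simp: mat_vec_def)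
      then show ?thesis using Ac vj by (simp add: sum_index r_simps)
    qed
    then show ?thesis by (simp add: tvec_def tmat_def vec_eq_iff matrix_vector_mult_def)
  qed
qed

lemma tvec_zero: "tvec \<zero>\<^bsub>vec_space n K\<^esub> = 0"
  by (simp add: tvec_def vec_space_simps vec_eq_iff r_simps)

lemma submod_tvec:
  assumes G: "G \<subseteq> carrier (mat_monoid n K)" and W: "G_submodule n K G W"
  shows "submod (tmat ` G) (tvec ` W)" "W \<subseteq> carrier (vec_space n K)"
proof -
  interpret W: submodule W K "vec_space n K" using W by (simp add: G_submodule_def)
  show sub: "W \<subseteq> carrier (vec_space n K)" using W.subset by simp
  note Wc = subsetD[OF sub]
  show "submod (tmat ` G) (tvec ` W)"
    unfolding submod_def vec.subspace_def
  proof (intro conjI ballI allI)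
    show "0 \<in> tvec ` W" using W.one_closed tvec_zero by (metis imageI monoid.simps(2))
    fix x assume "x \<in> tvec ` W"
    then obtain v where v: "v \<in> W" "x = tvec v" by blast
    show "c *s x \<in> tvec ` W" for c
    proof -
      obtain d where d: "d \<in> carrier K" "r d = c" using r_surj by blast
      have "c *s x = tvec (d \<odot>\<^bsub>vec_space n K\<^esub> v)" using v d Wc by (simp add: tvec_simps)
      then show ?thesis using W.smult_closed[OF d(1) v(1)] by blast
    qed
    fix y assume "y \<in> tvec ` W"
    then obtain w where w: "w \<in> W" "y = tvec w" by blast
    have "x + y = tvec (v \<oplus>\<^bsub>vec_space n K\<^esub> w)" using v w Wc by (simp add: tvec_simps)
    moreover have "v \<oplus>\<^bsub>vec_space n K\<^esub> w \<in> W" using W.m_closed[OF v(1) w(1)] by simp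
    ultimately show "x + y \<in> tvec ` W" by blast
  next
    fix g x assume "g \<in> tmat ` G" "x \<in> tvec ` W"
    then obtain A v where A: "A \<in> G" "g = tmat A" and v: "v \<in> W" "x = tvec v" by blast
    have "g *v x = tvec (mat_vec n K A v)" using A v Wc subsetD[OF G] by (simp add: tvec_simps)
    moreover have "mat_vec n K A v \<in> W" using W A v by (simp add: G_submodule_def)
    ultimately show "g *v x \<in> tvec ` W" by blast
  qed
qed

text \<open>Simplicity over \<open>K\<close> speaks about submodules over \<open>K\<close>, so a
  submodule on the type side has to be pulled back before it can be compared with
  \<open>W\<close>.\<close>

lemma submod_vimage_tvec:
  assumes G: "G \<subseteq> carrier (mat_monoid n K)" and U: "submod (tmat ` G) U"
  shows "G_submodule n K G {v \<in> carrier (vec_space n K). tvec v \<in> U}"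
proof -
  let ?V = "vec_space n K"
  let ?W = "{v \<in> carrier ?V. tvec v \<in> U}"
  interpret V: abelian_group ?V by (rule K.abelian_group_vec_space)
  have Us: "vec.subspace U" using U by (simp add: submod_def)
  have smult: "c \<odot>\<^bsub>?V\<^esub> v \<in> ?W" if "c \<in> carrier K" "v \<in> ?W" for c v
  proof -
    have "c \<odot>\<^bsub>?V\<^esub> v \<in> carrier ?V" using that by (auto simp: vec_space_simps)
    then show ?thesis using that vec.subspace_scale[OF Us] by (simp add: tvec_simps)
  qed
  have "subgroup ?W (add_monoid ?V)"
  proof (rule V.add.subgroupI)
    show "?W \<noteq> {}" using V.zero_closed tvec_zero vec.subspace_0[OF Us] by force
    show "\<ominus>\<^bsub>?V\<^esub> v \<in> ?W" if v: "v \<in> ?W" for v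
    proof -
      have vc: "v \<in> carrier ?V" "\<ominus>\<^bsub>?V\<^esub> v \<in> carrier ?V" using v by auto
      have "tvec (\<ominus>\<^bsub>?V\<^esub> v) + tvec v = 0"
        using tvec_simps(1)[OF vc(2,1)] V.l_neg[OF vc(1)] tvec_zero by simp
      then have "tvec (\<ominus>\<^bsub>?V\<^esub> v) = - tvec v" by (rule eq_neg_iff_add_eq_0[THEN iffD2])
      then have "tvec (\<ominus>\<^bsub>?V\<^esub> v) \<in> U" using v vec.subspace_neg[OF Us] by simp
      then show ?thesis using vc(2) by simp
    qed
    show "v \<oplus>\<^bsub>?V\<^esub> w \<in> ?W" if "v \<in> ?W" "w \<in> ?W" for v w
      using that vec.subspace_add[OF Us] by (simp add: tvec_simps)
  qed auto
  then have "submodule ?W K ?V"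
    using smult by (simp add: submodule_def submodule_axioms_def)
  moreover have "mat_vec n K A v \<in> ?W" if "A \<in> G" "v \<in> ?W" for A v
  proof -
    have A: "A \<in> carrier (mat_monoid n K)" using that G by blast
    have "mat_vec n K A v \<in> carrier ?V"
      using that mat_entry_closed[OF A] by (auto simp: mat_vec_def vec_space_simps intro!: K.finsum_closed)
    moreover have "tvec (mat_vec n K A v) \<in> U" using that A U by (simp add: tvec_simps submod_def)
    ultimately show ?thesis by simp
  qed
  ultimately show ?thesis by (simp add: G_submodule_def)
qed

lemma simple_submod_tvec:
  assumes G: "G \<subseteq> carrier (mat_monoid n K)" and W: "simple_G_submodule n K G W"
  shows "simple_submod (tmat ` G) (tvec ` W)"
  unfolding simple_submod_def
proof (intro conjI allI impI)
  have Ws: "G_submodule n K G W" using W by (simp add: simple_G_submodule_def)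
  note sub = submod_tvec[OF G Ws]
  show "submod (tmat ` G) (tvec ` W)" by (rule sub(1))
  have zero: "tvec v = 0 \<Longrightarrow> v = \<zero>\<^bsub>vec_space n K\<^esub>" if "v \<in> carrier (vec_space n K)" for v
    using inj_onD[OF tvec_inj, of v "\<zero>\<^bsub>vec_space n K\<^esub>"] that tvec_zero
    by (simp add: vec_space_simps)
  have "\<zero>\<^bsub>vec_space n K\<^esub> \<in> W"
    using Ws subgroup.one_closed[of W "add_monoid (vec_space n K)"] by (simp add: G_submodule_def submodule_def)
  then obtain w where "w \<in> W" "w \<noteq> \<zero>\<^bsub>vec_space n K\<^esub>" using W by (auto simp: simple_G_submodule_def)
  then have "tvec w \<in> tvec ` W" "tvec w \<noteq> 0" using zero sub(2) by auto
  then show "tvec ` W \<noteq> {0}" by blast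
  fix U assume U: "submod (tmat ` G) U \<and> U \<subseteq> tvec ` W"
  define U' where "U' = {v \<in> carrier (vec_space n K). tvec v \<in> U}"
  have "G_submodule n K G U'" unfolding U'_def using submod_vimage_tvec[OF G] U by blast
  moreover have "U' \<subseteq> W"
  proof
    fix v assume v: "v \<in> U'"
    then obtain w where w: "w \<in> W" "tvec v = tvec w" using U by (auto simp: U'_def)
    then have "v = w" using tvec_inj v subsetD[OF sub(2) w(1)] unfolding inj_on_def U'_def by blast
    then show "v \<in> W" using w(1) by simp
  qed
  ultimately have "U' = {\<zero>\<^bsub>vec_space n K\<^esub>} \<or> U' = W" using W by (simp add: simple_G_submodule_def)
  moreover have "U = tvec ` U'"
  proof (intro subset_antisym subsetI)
    fix x assume x: "x \<in> U"
    then obtain w where "w \<in> W" "x = tvec w" using U by blast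
    then show "x \<in> tvec ` U'" using x subsetD[OF sub(2)] by (simp add: U'_def)
  qed (auto simp: U'_def)
  ultimately show "U = {0} \<or> U = tvec ` W" by (auto simp: tvec_zero)
qed

lemma tvec_finsum:
  assumes "\<And>i. i \<in> I \<Longrightarrow> w i \<in> carrier (vec_space n K)"
  shows "tvec (\<Oplus>\<^bsub>vec_space n K\<^esub>i\<in>I. w i) = (\<Sum>i\<in>I. tvec (w i))"
proof -
  interpret V: abelian_group "vec_space n K" by (rule K.abelian_group_vec_space)
  show ?thesis
    using assms
  proof (induction I rule: infinite_finite_induct)
    case (insert x F)
    then show ?case by (subst V.finsum_insert) (auto simp: tvec_simps V.finsum_closed)
  qed (simp_all add: tvec_zero V.add.finprod_infinite)
qed

lemma semisimple_transfer:
  assumes G: "G \<subseteq> carrier (mat_monoid n K)" and ss: "semisimple_linear_group n K G"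
  obtains \<W> where "\<And>W. W \<in> \<W> \<Longrightarrow> simple_submod (tmat ` G) W" "vec.span (\<Union>\<W>) = UNIV"
proof -
  obtain m :: nat and W where W: "\<And>i. i < m \<Longrightarrow> simple_G_submodule n K G (W i)"
    "\<And>v. v \<in> carrier (vec_space n K) \<Longrightarrow>
      \<exists>w. w \<in> (\<Pi>\<^sub>E i\<in>{..<m}. W i) \<and> v = (\<Oplus>\<^bsub>vec_space n K\<^esub>i\<in>{..<m}. w i)"
    using ss unfolding semisimple_linear_group_def by metis
  let ?W = "(\<lambda>i. tvec ` W i) ` {..<m}"
  show thesis
  proof (rule that[of ?W])
    show "simple_submod (tmat ` G) X" if "X \<in> ?W" for X using that simple_submod_tvec[OF G W(1)] by auto
    have "u \<in> vec.span (\<Union>?W)" for u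
    proof -
      obtain v where v: "v \<in> carrier (vec_space n K)" "tvec v = u" using tvec_surj .
      obtain w where w: "w \<in> (\<Pi>\<^sub>E i\<in>{..<m}. W i)" "v = (\<Oplus>\<^bsub>vec_space n K\<^esub>i\<in>{..<m}. w i)" using W(2)[OF v(1)] by blast
      have wW: "w i \<in> W i" if "i < m" for i using w(1) that by auto
      have "u = (\<Sum>i<m. tvec (w i))"
        unfolding v(2)[symmetric] w(2)
      proof (rule tvec_finsum)
        fix i assume "i \<in> {..<m}"
        then have i: "i < m" by simp
        then have "G_submodule n K G (W i)" using W(1) by (simp add: simple_G_submodule_def)
        then show "w i \<in> carrier (vec_space n K)" using submod_tvec(2)[OF G] wW[OF i] by blast
      qed
      also have "\<dots> \<in> vec.span (\<Union>?W)" using wW by (intro vec.span_sum vec.span_base) auto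
      finally show ?thesis .
    qed
    then show "vec.span (\<Union>?W) = UNIV" by blast
  qed
qed

text \<open>Elements of \<open>UP K\<close> are coefficient functions of bounded support, so the
  transported function is a legitimate argument of \<open>Abs_poly\<close>.\<close>

definition tpoly :: "(nat \<Rightarrow> 'c) \<Rightarrow> 'k poly" where
  "tpoly f = Abs_poly (\<lambda>i. r (f i))"

lemma coeff_tpoly:
  assumes "f \<in> carrier (UP K)"
  shows "Polynomial.coeff (tpoly f) i = r (f i)"
proof -
  obtain m where "bound \<zero>\<^bsub>K\<^esub> m f" using assms by (auto simp: UP_def up_def)
  then have "\<forall>i>m. r (f i) = 0" using r_simps(4) bound.bound by metis
  then show ?thesis unfolding tpoly_def by (subst coeff_Abs_poly) auto
qed

lemma cring_UP: "cring (UP K)"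
  by (rule UP_cring.UP_cring[OF UP_cring.intro[OF K.is_cring]])

lemma UP_entry_closed: "f \<in> carrier (UP K) \<Longrightarrow> f i \<in> carrier K"
  unfolding UP_def by (simp add: mem_upD)

lemma UP_ops:
  assumes "f \<in> carrier (UP K)" "g \<in> carrier (UP K)"
  shows "(f \<otimes>\<^bsub>UP K\<^esub> g) i = (\<Oplus>\<^bsub>K\<^esub>j\<in>{..i}. f j \<otimes>\<^bsub>K\<^esub> g (i - j))" "(f \<oplus>\<^bsub>UP K\<^esub> g) i = f i \<oplus>\<^bsub>K\<^esub> g i"
  using assms by (simp_all add: UP_def)

lemma UP_one_apply: "\<one>\<^bsub>UP K\<^esub> i = (if i = 0 then \<one>\<^bsub>K\<^esub> else \<zero>\<^bsub>K\<^esub>)"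
  by (simp add: UP_def)

lemma UP_monom_apply: "a \<in> carrier K \<Longrightarrow> UnivPoly.monom (UP K) a k i = (if i = k then a else \<zero>\<^bsub>K\<^esub>)"
  by (simp add: UP_def)

lemma tpoly_hom: "tpoly \<in> ring_hom (UP K) ring_of_type_algebra"
proof (rule ring_hom_memI)
  note UP_closed = cring.cring_simprules(1,5,6)[OF cring_UP]
  fix f g assume f: "f \<in> carrier (UP K)" and g: "g \<in> carrier (UP K)"
  note fg = UP_entry_closed[OF f] UP_entry_closed[OF g]
  show "tpoly (f \<otimes>\<^bsub>UP K\<^esub> g) = tpoly f \<otimes>\<^bsub>ring_of_type_algebra\<^esub> tpoly g"
  proof (rule poly_eqI)
    fix i
    have "r ((f \<otimes>\<^bsub>UP K\<^esub> g) i) = (\<Sum>j\<le>i. r (f j \<otimes>\<^bsub>K\<^esub> g (i - j)))"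
      unfolding UP_ops(1)[OF f g] by (rule r_finsum) (use fg in simp)
    also have "\<dots> = (\<Sum>j\<le>i. r (f j) * r (g (i - j)))" by (simp only: r_simps(1) fg)
    finally show "Polynomial.coeff (tpoly (f \<otimes>\<^bsub>UP K\<^esub> g)) i = Polynomial.coeff (tpoly f \<otimes>\<^bsub>ring_of_type_algebra\<^esub> tpoly g) i"
      unfolding ring_of_type_simps coeff_mult coeff_tpoly[OF UP_closed(2)[OF f g]] coeff_tpoly[OF f] coeff_tpoly[OF g] .
  qed
  show "tpoly (f \<oplus>\<^bsub>UP K\<^esub> g) = tpoly f \<oplus>\<^bsub>ring_of_type_algebra\<^esub> tpoly g"
    by (rule poly_eqI)
      (simp only: ring_of_type_simps coeff_add coeff_tpoly UP_closed f g UP_ops(2) r_simps(2) fg)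
next
  show "tpoly \<one>\<^bsub>UP K\<^esub> = \<one>\<^bsub>ring_of_type_algebra\<^esub>"
    by (rule poly_eqI)
      (simp add: ring_of_type_simps(4) coeff_tpoly cring.cring_simprules(6)[OF cring_UP] UP_one_apply r_simps coeff_1)
qed (simp add: ring_of_type_simps(1))

lemma monom_UP_closed: "a \<in> carrier K \<Longrightarrow> UnivPoly.monom (UP K) a k \<in> carrier (UP K)"
  by (rule UP_ring.monom_closed[OF UP_ring.intro[OF K.is_ring]])

lemma rev_char_poly_tmat:
  assumes A: "A \<in> carrier (mat_monoid n K)"
  shows "rev_char_poly (tmat A) = tpoly (char_det n K A)"
proof -
  interpret UP: cring "UP K" by (rule cring_UP)
  interpret t: ring_hom_cring "UP K" "ring_of_type_algebra :: 'k poly ring" tpoly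
    by (rule ring_hom_cringI[OF cring_UP cring_from_type_algebra tpoly_hom])
  define M where "M = (\<lambda>(i, j). (if i = j then \<one>\<^bsub>UP K\<^esub> else \<zero>\<^bsub>UP K\<^esub>) \<ominus>\<^bsub>UP K\<^esub> UnivPoly.monom (UP K) (A (i, j)) 1)"
  note Ac = mat_entry_closed[OF A]
  have Mc: "M (i, j) \<in> carrier (UP K)" if "i < n" "j < n" for i j
    using monom_UP_closed[OF Ac[OF that], of 1] by (simp add: M_def)
  have tM: "tpoly (M (\<iota> i, \<iota> j)) = [:if i = j then 1 else 0, - tmat A $ i $ j:]" for i j
  proof -
    have c: "A (\<iota> i, \<iota> j) \<in> carrier K" using Ac by simp
    have mc: "UnivPoly.monom (UP K) (A (\<iota> i, \<iota> j)) 1 \<in> carrier (UP K)" by (rule monom_UP_closed[OF c])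
    have "tpoly (UnivPoly.monom (UP K) (A (\<iota> i, \<iota> j)) 1) = [:0, r (A (\<iota> i, \<iota> j)):]"
    proof (rule poly_eqI)
      fix k
      show "Polynomial.coeff (tpoly (UnivPoly.monom (UP K) (A (\<iota> i, \<iota> j)) 1)) k = Polynomial.coeff [:0, r (A (\<iota> i, \<iota> j)):] k"
        by (simp add: coeff_tpoly[OF mc] UP_monom_apply[OF c] r_simps coeff_pCons split: nat.splits del: One_nat_def)
    qed
    then show ?thesis
      using mc t.hom_one t.hom_zero by (auto simp: M_def a_minus_def ring_of_type_simps a_inv_ring_of_type tmat_def one_pCons simp del: One_nat_def)
  qed
  have sgn: "tpoly (if evenperm \<sigma> then \<one>\<^bsub>UP K\<^esub> else \<ominus>\<^bsub>UP K\<^esub> \<one>\<^bsub>UP K\<^esub>) = of_int (sign \<sigma>)" for \<sigma> :: "nat \<Rightarrow> nat"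
    using t.hom_one by (simp add: sign_def ring_of_type_simps a_inv_ring_of_type)
  have perm_less: "\<sigma> i < n" if "\<sigma> permutes {..<n}" "i < n" for \<sigma> i
    using permutes_in_image[OF that(1)] that(2) by simp
  have "tpoly (char_det n K A) = tpoly (mat_det n (UP K) M)" by (simp add: char_det_def M_def)
  also have "\<dots> = (\<Sum>\<sigma> | \<sigma> permutes {..<n}. of_int (sign \<sigma>) * (\<Prod>i<n. tpoly (M (i, \<sigma> i))))"
  proof -
    have "tpoly (mat_det n (UP K) M) = (\<Sum>\<sigma> | \<sigma> permutes {..<n}.
       tpoly ((if evenperm \<sigma> then \<one>\<^bsub>UP K\<^esub> else \<ominus>\<^bsub>UP K\<^esub> \<one>\<^bsub>UP K\<^esub>) \<otimes>\<^bsub>UP K\<^esub> (\<Otimes>\<^bsub>UP K\<^esub>i\<in>{..<n}. M (i, \<sigma> i))))"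
      unfolding mat_det_def using Mc perm_less
      by (subst t.hom_finsum) (auto simp: finsum_ring_of_type comp_def intro!: UP.finprod_closed)
    also have "\<dots> = (\<Sum>\<sigma> | \<sigma> permutes {..<n}. of_int (sign \<sigma>) * (\<Prod>i<n. tpoly (M (i, \<sigma> i))))"
    proof (rule sum.cong[OF refl])
      fix \<sigma> assume "\<sigma> \<in> {\<sigma>. \<sigma> permutes {..<n}}"
      then have M\<sigma>: "(\<lambda>i. M (i, \<sigma> i)) \<in> {..<n} \<rightarrow> carrier (UP K)" using Mc perm_less by auto
      have "tpoly (\<Otimes>\<^bsub>UP K\<^esub>i\<in>{..<n}. M (i, \<sigma> i)) = (\<Prod>i<n. tpoly (M (i, \<sigma> i)))"
        using t.hom_finprod[OF M\<sigma>] by (simp add: finprod_ring_of_type comp_def)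
      then show "tpoly ((if evenperm \<sigma> then \<one>\<^bsub>UP K\<^esub> else \<ominus>\<^bsub>UP K\<^esub> \<one>\<^bsub>UP K\<^esub>) \<otimes>\<^bsub>UP K\<^esub> (\<Otimes>\<^bsub>UP K\<^esub>i\<in>{..<n}. M (i, \<sigma> i))) =
          of_int (sign \<sigma>) * (\<Prod>i<n. tpoly (M (i, \<sigma> i)))"
        using t.hom_mult[OF _ UP.finprod_closed[OF M\<sigma>]] sgn[of \<sigma>] by (simp add: ring_of_type_simps)
    qed
    finally show ?thesis .
  qed
  also have "\<dots> = (\<Sum>p | p permutes (UNIV :: 'n set). of_int (sign p) * (\<Prod>i\<in>UNIV. tpoly (M (\<iota> i, \<iota> (p i)))))"
  \<comment> \<open>After the ring homomorphism has been applied termwise, only the index sets of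
    the permutations differ. Conjugation with \<iota> matches them and preserves the sign.\<close>
  proof (rule sum.reindex_bij_witness[symmetric, of _ "map_permutation {..<n} (the_inv \<iota>)" "map_permutation UNIV \<iota>"])
    fix p :: "'n \<Rightarrow> 'n" assume "p \<in> {p. p permutes UNIV}"
    then have p: "p permutes UNIV" by simp
    show "map_permutation UNIV \<iota> p \<in> {\<sigma>. \<sigma> permutes {..<n}}" using map_permutation_permutes[OF \<iota>_bij p] by simp
    show "map_permutation {..<n} (the_inv \<iota>) (map_permutation UNIV \<iota> p) = p"
      by (rule map_permutation_compose_inv[OF \<iota>_bij p]) (simp add: the_inv_f_f[OF \<iota>_inj])
    have "(\<Prod>i<n. tpoly (M (i, map_permutation UNIV \<iota> p i))) = (\<Prod>i\<in>UNIV. tpoly (M (\<iota> i, map_permutation UNIV \<iota> p (\<iota> i))))"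
      by (rule prod.reindex_bij_betw[OF \<iota>_bij, symmetric])
    then show "of_int (sign (map_permutation UNIV \<iota> p)) * (\<Prod>i<n. tpoly (M (i, map_permutation UNIV \<iota> p i))) =
        of_int (sign p) * (\<Prod>i\<in>UNIV. tpoly (M (\<iota> i, \<iota> (p i))))"
      by (simp add: sign_map_permutation[OF \<iota>_inj p] map_permutation_apply[OF \<iota>_inj])
  next
    fix \<sigma> assume "\<sigma> \<in> {\<sigma>. \<sigma> permutes {..<n}}"
    then have \<sigma>: "\<sigma> permutes {..<n}" by simp
    have inv_bij: "bij_betw (the_inv \<iota>) {..<n} UNIV"
      using bij_betw_the_inv_into[OF \<iota>_bij] .
    show "map_permutation {..<n} (the_inv \<iota>) \<sigma> \<in> {p. p permutes UNIV}" using map_permutation_permutes[OF inv_bij \<sigma>] by simp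
    show "map_permutation UNIV \<iota> (map_permutation {..<n} (the_inv \<iota>) \<sigma>) = \<sigma>"
      by (rule map_permutation_compose_inv[OF inv_bij \<sigma>]) (use \<iota>_bij f_the_inv_into_f[OF \<iota>_inj] in \<open>auto simp: bij_betw_def\<close>)
  qed
  also have "\<dots> = rev_char_poly (tmat A)" by (simp add: rev_char_poly_def det_def tM)
  finally show ?thesis by simp
qed

text \<open>Passage from \<open>K\<close> to \<open>'k\<close> and on to its algebraic closure. Both
  maps are injective on matrices, so \<open>G\<close> and \<open>H\<close> keep their sizes; the
  polynomials on \<open>H\<close> are images of the original ones, so their number does not
  grow.\<close>

theorem card_le_group_bound_transfer:
  assumes q: "\<exists>p k. Factorial_Ring.prime p \<and> card (carrier K) = p ^ k"
    and G: "subgroup G (GL n K)" "semisimple_linear_group n K G" "property_C n K G \<eta> N"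
    and \<eta>: "0 \<le> \<eta>" "\<eta> * fact n < 1"
  shows "card G \<le> group_bound n \<eta> N"
proof -
  note tG = tmat_group[OF G(1)]
  have q': "\<exists>p k. Factorial_Ring.prime p \<and> CARD('k) = p ^ k"
    using q bij_betw_same_card[OF r_bij] by simp
  obtain H where H: "H \<subseteq> G" "(1 - \<eta>) * real (card G) \<le> real (card H)"
    "real (card (char_det n K ` H)) \<le> N"
    using G(3) by (auto simp: property_C_def)
  obtain \<W> where \<W>: "\<And>W. W \<in> \<W> \<Longrightarrow> simple_submod (tmat ` G) W" "vec.span (\<Union>\<W>) = UNIV"
    using semisimple_transfer[OF tG(3) G(2)] by blast
  let ?L = "map_matrix to_ac :: 'k^'n^'n \<Rightarrow> _"
  let ?G = "?L ` tmat ` G" and ?H = "?L ` tmat ` H"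
  have injL: "inj_on ?L S" for S using inj_map_matrix_to_ac by (rule inj_on_subset) simp
  have Hc: "H \<subseteq> carrier (mat_monoid n K)" using H(1) tG(3) by blast
  have finH: "finite H" using finite_subset[OF Hc finite_mats] .
  have cG: "card ?G = card G" by (simp add: card_image[OF injL] tG(2))
  have cH: "card ?H = card H"
    by (simp add: card_image[OF injL] card_image[OF inj_on_subset[OF tmat_inj Hc]])
  have lift_poly: "rev_char_poly (?L B) = map_poly to_ac (rev_char_poly B)" for B
    by (rule rev_char_poly_map_to_ac)
  have "card ?G \<le> group_bound CARD('n) \<eta> N"
  proof (rule card_le_group_bound[OF matrix_group_map_to_ac[OF tG(1)]])
    show "?H \<subseteq> ?G" using H(1) by blast
    show "(1 - \<eta>) * real (card ?G) \<le> real (card ?H)" using H(2) by (simp add: cG cH)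
    have "rev_char_poly ` ?H = (map_poly to_ac \<circ> tpoly) ` char_det n K ` H"
      using Hc by (auto simp: image_image lift_poly rev_char_poly_tmat intro!: image_cong)
    then have "card (rev_char_poly ` ?H) \<le> card (char_det n K ` H)"
      using card_image_le[of "char_det n K ` H" "map_poly to_ac \<circ> tpoly"] finH by simp
    then show "real (card (rev_char_poly ` ?H)) \<le> N" using H(3) by linarith
    show "vec.span (\<Union>{X. simple_submod \<Gamma> X}) = UNIV"
      if "matrix_group \<Gamma>" "\<Gamma> \<subseteq> ?G" "\<And>g x. g \<in> ?G \<Longrightarrow> x \<in> \<Gamma> \<Longrightarrow> g ** x ** minv g \<in> \<Gamma>" for \<Gamma>
      by (rule semisimple_descends_to_normal[OF q' tG(1) \<W> that])
  qed (use \<eta> in \<open>simp_all add: card_index\<close>)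
  then show ?thesis by (simp add: cG card_index)
qed

end

section \<open>The theorem\<close>

text \<open>
  The types of matrices over a fixed field and of a fixed size cannot depend on the variables \<open>K\<close>, \<open>n\<close> of the
  theorem. They are therefore built once and for all from a pair \<open>(K, n)\<close> chosen as a counterexample to the
  bound if there is one; the bound for this pair implies it for all pairs.
\<close>

definition bounded_over :: "nat ring \<times> nat \<Rightarrow> bool" where
  "bounded_over = (\<lambda>(K, n). \<forall>G \<eta> N. subgroup G (GL n K) \<and> semisimple_linear_group n K G \<and>
     property_C n K G \<eta> N \<and> 0 \<le> \<eta> \<and> \<eta> * fact n < 1 \<longrightarrow> card G \<le> group_bound n \<eta> N)"

definition finite_field_dim :: "nat ring \<times> nat \<Rightarrow> bool" where
  "finite_field_dim = (\<lambda>(K, n). field K \<and> n \<ge> 1 \<and> (\<exists>p k. Factorial_Ring.prime p \<and> card (carrier K) = p ^ k))"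

definition worst_case :: "nat ring \<times> nat" where
  "worst_case = (SOME P. finite_field_dim P \<and> ((\<exists>Q. finite_field_dim Q \<and> \<not> bounded_over Q) \<longrightarrow> \<not> bounded_over P))"

text \<open>Shows that the choice in \<open>worst_case\<close> is made from a nonempty collection,
  so that the types built from it exist even if there is no counterexample.\<close>

definition field_two :: "nat ring" where
  "field_two = \<lparr>carrier = {0, 1}, monoid.mult = (*), one = 1, ring.zero = 0, add = (\<lambda>x y. (x + y) mod 2)\<rparr>"

lemma finite_field_dim_two: "finite_field_dim (field_two, 1)"
proof -
  have "cring field_two"
  proof (rule cringI)
    show "abelian_group field_two" by (rule abelian_groupI) (auto simp: field_two_def)
    show "comm_monoid field_two" by (rule comm_monoidI) (auto simp: field_two_def)
  qed (auto simp: field_two_def)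
  then have "field field_two"
    by (rule cring.cring_fieldI2) (auto simp: field_two_def)
  moreover have "card (carrier field_two) = 2 ^ 1" by (simp add: field_two_def)
  moreover have "Factorial_Ring.prime (2::nat)" by simp
  ultimately show ?thesis unfolding finite_field_dim_def by blast
qed

lemma worst_case_dim: "finite_field_dim worst_case"
  and worst_case_bounded: "bounded_over worst_case \<Longrightarrow> finite_field_dim Q \<Longrightarrow> bounded_over Q"
proof -
  have "\<exists>P. finite_field_dim P \<and> ((\<exists>Q. finite_field_dim Q \<and> \<not> bounded_over Q) \<longrightarrow> \<not> bounded_over P)"
    using finite_field_dim_two by blast
  from someI_ex[OF this] show "finite_field_dim worst_case"
    and "bounded_over worst_case \<Longrightarrow> finite_field_dim Q \<Longrightarrow> bounded_over Q"
    unfolding worst_case_def[symmetric] by blast+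
qed

lemma field_worst_case: "field (fst worst_case)"
  and worst_case_index: "snd worst_case \<ge> 1"
  and card_worst_case: "\<exists>p k. Factorial_Ring.prime p \<and> card (carrier (fst worst_case)) = p ^ k"
  using worst_case_dim unfolding finite_field_dim_def by (simp_all add: case_prod_unfold)

typedef worst_field = "carrier (fst worst_case)"
proof -
  interpret field "fst worst_case" by (rule field_worst_case)
  show "\<exists>x. x \<in> carrier (fst worst_case)" using zero_closed by blast
qed

typedef worst_index = "{..<snd worst_case}"
proof -
  show "\<exists>x. x \<in> {..<snd worst_case}" using worst_case_index by (auto simp: Suc_le_eq)
qed

setup_lifting type_definition_worst_field

instantiation worst_field :: field
begin

interpretation K: field "fst worst_case" by (rule field_worst_case)

lift_definition zero_worst_field :: worst_field is "ring.zero (fst worst_case)" by simp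
lift_definition one_worst_field :: worst_field is "monoid.one (fst worst_case)" by simp
lift_definition plus_worst_field :: "worst_field \<Rightarrow> worst_field \<Rightarrow> worst_field" is "ring.add (fst worst_case)"
  by simp
lift_definition times_worst_field :: "worst_field \<Rightarrow> worst_field \<Rightarrow> worst_field" is "monoid.mult (fst worst_case)"
  by simp
lift_definition uminus_worst_field :: "worst_field \<Rightarrow> worst_field" is "a_inv (fst worst_case)" by simp
lift_definition minus_worst_field :: "worst_field \<Rightarrow> worst_field \<Rightarrow> worst_field" is "a_minus (fst worst_case)"
  by simp
text \<open>The type class demands that the inverse of 0 be 0, so this value is set
  explicitly.\<close>

lift_definition inverse_worst_field :: "worst_field \<Rightarrow> worst_field" is
  "\<lambda>x. if x = ring.zero (fst worst_case) then ring.zero (fst worst_case) else m_inv (fst worst_case) x"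
  by (auto simp: K.field_Units)
definition divide_worst_field :: "worst_field \<Rightarrow> worst_field \<Rightarrow> worst_field" where
  "divide_worst_field x y = x * inverse y"

instance
proof
  fix a b c :: worst_field
  show "a * b * c = a * (b * c)" by transfer (rule K.m_assoc)
  show "a * b = b * a" by transfer (rule K.m_comm)
  show "1 * a = a" by transfer (rule K.l_one)
  show "a + b + c = a + (b + c)" by transfer (rule K.a_assoc)
  show "a + b = b + a" by transfer (rule K.a_comm)
  show "0 + a = a" by transfer (rule K.l_zero)
  show "- a + a = 0" by transfer (rule K.l_neg)
  show "a - b = a + - b" by transfer (simp add: a_minus_def)
  show "(a + b) * c = a * c + b * c" by transfer (rule K.l_distr)
  show "(0::worst_field) \<noteq> 1" by transfer simp
  show "a \<noteq> 0 \<Longrightarrow> inverse a * a = 1" by transfer (auto simp: K.field_Units)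
  show "a div b = a * inverse b" by (rule divide_worst_field_def)
  show "inverse (0::worst_field) = 0" by transfer simp
qed

end

lemma finite_carrier_worst_case: "finite (carrier (fst worst_case))"
proof -
  obtain p k where "Factorial_Ring.prime p" "card (carrier (fst worst_case)) = p ^ k"
    using card_worst_case by blast
  \<comment> \<open>An infinite carrier would have cardinality 0, which is not a prime
    power.\<close>
  then have "card (carrier (fst worst_case)) > 0" by (simp add: prime_gt_0_nat)
  then show ?thesis by (rule card_ge_0_finite)
qed

instance worst_field :: finite_field
proof
  show "finite (UNIV :: worst_field set)"
    unfolding type_definition.univ[OF type_definition_worst_field]
    by (rule finite_imageI[OF finite_carrier_worst_case])
qed

instance worst_index :: finite
proof
  show "finite (UNIV :: worst_index set)"
    unfolding type_definition.univ[OF type_definition_worst_index] by simp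
qed

lemma matrix_transfer_worst_case:
  "matrix_transfer (fst worst_case) (snd worst_case) Abs_worst_field Rep_worst_index"
proof (rule matrix_transfer.intro)
  interpret K: field "fst worst_case" by (rule field_worst_case)
  show "Abs_worst_field \<in> ring_hom (fst worst_case) ring_of_type_algebra"
    by (rule ring_hom_memI)
      (simp_all add: ring_of_type_simps times_worst_field.abs_eq plus_worst_field.abs_eq eq_onp_def
        one_worst_field_def)
  show "bij_betw Abs_worst_field (carrier (fst worst_case)) UNIV"
    by (rule bij_betwI[where g = Rep_worst_field])
      (use Rep_worst_field Rep_worst_field_inverse Abs_worst_field_inverse in auto)
  show "bij_betw Rep_worst_index UNIV {..<snd worst_case}"
    by (rule bij_betwI[where g = Abs_worst_index])
      (use Rep_worst_index Rep_worst_index_inverse Abs_worst_index_inverse in auto)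
qed (rule field_worst_case)

lemma bounded_over_finite_field: "finite_field_dim Q \<Longrightarrow> bounded_over Q"
proof (rule worst_case_bounded)
  have "bounded_over (fst worst_case, snd worst_case)"
    using matrix_transfer.card_le_group_bound_transfer[OF matrix_transfer_worst_case card_worst_case]
    unfolding bounded_over_def by blast
  then show "bounded_over worst_case" by simp
qed

theorem theorem5p14:
  shows "\<exists>B0 B :: real \<Rightarrow> real \<Rightarrow> nat \<Rightarrow> real.
    \<forall>(n::nat) (C::real) (J1::real) (J2::real) (J3::real).
      n \<ge> 1 \<and> J1_constant n J1 \<and> J2_constant n J2 \<and> J3_constant n J3 \<and>
      C > Max {3, real n - 3, J1, J2, J3} \<longrightarrow>
      (\<forall>(\<eta>::real) (N::real) (p::nat) (a::nat) (q::nat) (K :: nat ring) G.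
         0 < \<eta> \<and> \<eta> < 1 / C \<and> N > 0 \<and>
         Factorial_Ring.prime p \<and> real p > C \<and> a \<ge> 1 \<and> q = p ^ a \<and>
         field K \<and> card (carrier K) = q \<and>
         subgroup G (GL n K) \<and> semisimple_linear_group n K G \<and> property_C n K G \<eta> N \<longrightarrow>
         (real (card G) \<le> B0 \<eta> N n \<or> real q \<le> B0 \<eta> N n) \<and>
         real (card G) \<le> B \<eta> N n)"
proof -
  define B :: "real \<Rightarrow> real \<Rightarrow> nat \<Rightarrow> real" where "B \<eta> N n = real (group_bound n \<eta> N)" for \<eta> N n
  have main: "real (card G) \<le> B \<eta> N n"
    if n: "n \<ge> 1" and J3: "J3_constant n J3" and C: "C > Max {3, real n - 3, J1, J2, J3}"
      and \<eta>: "0 < \<eta>" "\<eta> < 1 / C" and p: "Factorial_Ring.prime p" "q = p ^ a"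
      and K: "field K" "card (carrier K) = q"
      and G: "subgroup G (GL n K)" "semisimple_linear_group n K G" "property_C n K G \<eta> N"
    for n C J1 J2 J3 \<eta> N p a q and K :: "nat ring" and G
  proof -
    have C': "C > J3" "C > 3" using C by simp_all
    \<comment> \<open>The link between the constants and \<eta>: \<open>C\<close> exceeds
      \<open>J3\<close>, hence \<open>n!\<close>, so \<open>\<eta> < 1 / C\<close> leaves the
      positive density \<open>1 - \<eta> * fact n\<close>.\<close>
    then have "fact n < C" using J3_constant_ge_fact[OF J3] by simp
    then have "\<eta> * fact n < \<eta> * C" using \<eta>(1) by simp
    also have "\<dots> < 1" using \<eta>(2) C'(2) by (simp add: field_simps)
    finally have "\<eta> * fact n < 1" .
    moreover have "bounded_over (K, n)"
      by (rule bounded_over_finite_field) (use n p K in \<open>auto simp: finite_field_dim_def\<close>)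
    ultimately show ?thesis using G \<eta>(1) unfolding B_def bounded_over_def by simp
  qed
  \<comment> \<open>The disjunction is met by its first member, the bound on \<open>G\<close>, so
    one function serves as both witnesses.\<close>
  show ?thesis
    by (rule exI[of _ B], rule exI[of _ B]) (use main in blast)
qed

end
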